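(* A graph $G$ has finite path-width if and only if all of the following hold: (1) $G$ has finitely many vertices of infinite degree; (2) $G$ does not contain infinitely many pairwise disjoint 1-way infinite paths; and (3) there exists a finite tree $T$ of maximum degree $3$ such that $G$ contains no subdivision of $T$.
   Context: All graphs are simple and countable (the vertex set is finite or countably infinite). A graph $U$ contains a graph $G$ if a subgraph of $U$ is isomorphic to $G$. Paths are disjoint if they are vertex-disjoint subgraphs. The 1-way infinite path is, up to isomorphism, the graph with vertex set $\mathbb{N}$ and edge set $\{\{n,n+1\}:n\in\mathbb{N}\}$. A path-decomposition of a graph $G$ is a sequence $(B_t:t\in\mathbb{N})$ of subsets of $V(G)$ (bags) such that: $\bigcup_{t}B_t=V(G)$; for each edge $vw\in E(G)$ there is $t\in\mathbb{N}$ with $v,w\in B_t$; and $B_{t_1}\cap B_{t_3}\subseteq B_{t_2}$ whenever $t_1\leq t_2\leq t_3$. Its width is $\sup_{t\in\mathbb{N}}(|B_t|-1)$. The path-width of $G$ is the minimum width of a path-decomposition of $G$ (it is $\infty$ if every path-decomposition has bags of unbounded size). *)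

theory Defs
  imports Complex_Main "HOL-Library.Extended_Real" "HOL-Library.Countable_Set"
begin

section \<open>Simple graphs\<close>

text \<open>Graphs may be infinite.  Edges are two-element sets of vertices.\<close>

record 'a ugraph =
  verts :: "'a set"
  edges :: "'a set set"

definition simple_graph :: "'a ugraph \<Rightarrow> bool" where
  "simple_graph G \<longleftrightarrow> (\<forall>e\<in>edges G. e \<subseteq> verts G \<and> card e = 2)"

definition subgraph :: "'a ugraph \<Rightarrow> 'a ugraph \<Rightarrow> bool" where
  "subgraph H G \<longleftrightarrow> simple_graph H \<and> verts H \<subseteq> verts G \<and> edges H \<subseteq> edges G"

definition isomorphic :: "'a ugraph \<Rightarrow> 'b ugraph \<Rightarrow> bool" where
  "isomorphic G H \<longleftrightarrow>
     (\<exists>f. bij_betw f (verts G) (verts H) \<and>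
          (\<forall>u\<in>verts G. \<forall>v\<in>verts G. {u, v} \<in> edges G \<longleftrightarrow> {f u, f v} \<in> edges H))"

definition contains :: "'a ugraph \<Rightarrow> 'b ugraph \<Rightarrow> bool" where
  "contains U G \<longleftrightarrow> (\<exists>S. subgraph S U \<and> isomorphic S G)"

definition disjoint_graphs :: "'a ugraph \<Rightarrow> 'a ugraph \<Rightarrow> bool" where
  "disjoint_graphs G H \<longleftrightarrow> verts G \<inter> verts H = {}"


section \<open>Degrees\<close>

text \<open>Infinite sets have size \<open>\<infinity>\<close> here, unlike for \<^const>\<open>card\<close>.\<close>

definition ecard :: "'a set \<Rightarrow> enat" where
  "ecard A = (if finite A then enat (card A) else \<infinity>)"

definition neighbours :: "'a ugraph \<Rightarrow> 'a \<Rightarrow> 'a set" where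
  "neighbours G v = {w. {v, w} \<in> edges G}"

definition degree :: "'a ugraph \<Rightarrow> 'a \<Rightarrow> enat" where
  "degree G v = ecard (neighbours G v)"

definition max_degree :: "'a ugraph \<Rightarrow> enat" where
  "max_degree G = (SUP v\<in>verts G. degree G v)"


section \<open>Paths, rays and trees\<close>

text \<open>A finite path is represented by the list of its vertices, in order.\<close>

definition path_edges :: "'a list \<Rightarrow> 'a set set" where
  "path_edges p = {{p ! i, p ! Suc i} | i. Suc i < length p}"

definition graph_path :: "'a ugraph \<Rightarrow> 'a list \<Rightarrow> bool" where
  "graph_path G p \<longleftrightarrow> p \<noteq> [] \<and> distinct p \<and> set p \<subseteq> verts G \<and> path_edges p \<subseteq> edges G"

definition graph_cycle :: "'a ugraph \<Rightarrow> 'a list \<Rightarrow> bool" where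
  "graph_cycle G p \<longleftrightarrow> graph_path G p \<and> 3 \<le> length p \<and> {last p, hd p} \<in> edges G"

definition connected_graph :: "'a ugraph \<Rightarrow> bool" where
  "connected_graph G \<longleftrightarrow>
     verts G \<noteq> {} \<and>
     (\<forall>u\<in>verts G. \<forall>v\<in>verts G. \<exists>p. graph_path G p \<and> hd p = u \<and> last p = v)"

definition tree :: "'a ugraph \<Rightarrow> bool" where
  "tree T \<longleftrightarrow> simple_graph T \<and> connected_graph T \<and> (\<nexists>p. graph_cycle T p)"

definition ray :: "nat ugraph" where
  "ray = \<lparr>verts = UNIV, edges = {{n, Suc n} | n. True}\<rparr>"


section \<open>Subdivisions\<close>

text \<open>
  \<open>H\<close> arises from \<open>G\<close> by replacing each edge \<open>e\<close> by a path \<open>P e\<close> with the same ends,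
  where the interiors of these paths avoid \<open>G\<close> and are pairwise disjoint.  The vertices
  of \<open>G\<close> are kept as vertices of \<open>H\<close>, and a path \<open>P e\<close> may have length one.
\<close>

definition is_subdivision :: "'a ugraph \<Rightarrow> 'a ugraph \<Rightarrow> bool" where
  "is_subdivision H G \<longleftrightarrow>
     (\<exists>P. (\<forall>e\<in>edges G. graph_path H (P e) \<and> {hd (P e), last (P e)} = e
                       \<and> (set (P e) - e) \<inter> verts G = {}) \<and>
          (\<forall>e\<in>edges G. \<forall>f\<in>edges G. e \<noteq> f \<longrightarrow> (set (P e) - e) \<inter> (set (P f) - f) = {}) \<and>
          verts H = verts G \<union> (\<Union>e\<in>edges G. set (P e)) \<and>
          edges H = (\<Union>e\<in>edges G. path_edges (P e)))"


section \<open>Path-width\<close>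

definition path_decomposition :: "'a ugraph \<Rightarrow> (nat \<Rightarrow> 'a set) \<Rightarrow> bool" where
  "path_decomposition G B \<longleftrightarrow>
     (\<Union>t. B t) = verts G \<and>
     (\<forall>v w. {v, w} \<in> edges G \<longrightarrow> (\<exists>t. v \<in> B t \<and> w \<in> B t)) \<and>
     (\<forall>t1 t2 t3. t1 \<le> t2 \<and> t2 \<le> t3 \<longrightarrow> B t1 \<inter> B t3 \<subseteq> B t2)"

text \<open>The graph without vertices has path-width \<open>-1\<close>, hence \<^typ>\<open>ereal\<close> and not \<^typ>\<open>enat\<close>.\<close>

definition decomposition_width :: "(nat \<Rightarrow> 'a set) \<Rightarrow> ereal" where
  "decomposition_width B = (SUP t. ereal_of_enat (ecard (B t)) - 1)"

text \<open>
  The infimum is attained: the constant sequence \<open>verts G\<close> is a path-decomposition, and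
  widths are \<open>\<infinity>\<close> or integers that are at least \<open>-1\<close>.
\<close>

definition path_width :: "'a ugraph \<Rightarrow> ereal" where
  "path_width G = (INF B\<in>{B. path_decomposition G B}. decomposition_width B)"

end

theory Submission
  imports Defs "HOL-Library.Disjoint_Sets" "HOL-Library.Diagonal_Subsequence"
begin

text \<open>
  A path-decomposition of bounded width amounts to an injective numbering \<open>p\<close> of the vertices
  such that the sets \<open>{v. p v < m}\<close> have inner boundaries of bounded size.  Vertices of infinite
  degree and disjoint rays eventually meet every bag, and in a complete binary tree three
  disjoint subtrees force a bag that is larger than the bags of the subtrees.

  Conversely, delete the vertices of infinite degree.  For finite induced subgraphs the numbering
  comes from the argument for excluding a forest of Bienstock, Robertson, Seymour and Thomas: a
  maximal set with a good numbering and boundary of size \<open>i\<close> carries a minor of a subtree with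
  \<open>i\<close> vertices, each branch set containing one boundary vertex; adding a new vertex and linking to
  the next maximal set extends the minor.  A minor of maximum degree \<open>3\<close> yields a subdivision.
  By compactness the numberings converge to a linear order of all vertices whose initial segments
  have bounded boundary.  If some interval cannot be exhausted by finite sets of bounded
  boundary, it splits into another such interval and one that contains a ray, which produces
  infinitely many disjoint rays.  So finite sets of bounded boundary exhaust the graph, and
  numbering the finite differences separately gives the numbering.
\<close>

section \<open>Boundaries and connected sets\<close>

text \<open>The obstacle is the order type. Bounds on finite subgraphs survive the limit, but the
  limit may order the vertices like omega * omega or like the rationals, with infinite initial
  segments, whereas bags are indexed by natural numbers. Infinitely many disjoint rays show that
  this is no artefact: their finite subgraphs have path-width at most 1, yet late bags meet
  arbitrarily many of the rays. So the absence of a subdivision provides the bound, the condition on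
  rays brings the order back to type omega, and deleting the vertices of infinite degree makes
  Koenig's lemma available for finding rays. Boundaries are inner and one-sided because of the bags:
  a vertex of \<open>bd r {v. p v < m}\<close> still has a neighbour to come and must be
  kept.\<close>

definition bd :: "'a rel \<Rightarrow> 'a set \<Rightarrow> 'a set" where
  "bd r X = {x \<in> X. \<exists>y. y \<notin> X \<and> (x, y) \<in> r}"

definition conn :: "'a rel \<Rightarrow> 'a set \<Rightarrow> bool" where
  "conn r X \<longleftrightarrow> X \<noteq> {} \<and> (\<forall>x\<in>X. \<forall>y\<in>X. (x, y) \<in> (Restr r X)\<^sup>*)"

lemma bd_subset: "bd r X \<subseteq> X"
  by (auto simp: bd_def)

lemma bdD: "x \<in> bd r X \<Longrightarrow> x \<in> X"
  by (simp add: bd_def)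

lemma bdI: "x \<in> X \<Longrightarrow> y \<notin> X \<Longrightarrow> (x, y) \<in> r \<Longrightarrow> x \<in> bd r X"
  by (auto simp: bd_def)

lemma finite_bd: "finite X \<Longrightarrow> finite (bd r X)"
  by (rule finite_subset[OF bd_subset])

text \<open>A boundary vertex of \<open>X \<inter> Y\<close> or of \<open>X \<union> Y\<close> is
  one of \<open>X\<close> or of \<open>Y\<close>. A vertex in both of the former boundaries lies in
  \<open>X \<inter> Y\<close> and has a neighbour outside \<open>X \<union> Y\<close>, so it is in
  both of the latter.\<close>

lemma bd_submodular:
  assumes "finite X" "finite Y"
  shows "card (bd r (X \<inter> Y)) + card (bd r (X \<union> Y)) \<le> card (bd r X) + card (bd r Y)"
proof -
  have fin: "finite (bd r (X \<inter> Y))" "finite (bd r (X \<union> Y))" "finite (bd r X)" "finite (bd r Y)"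
    using assms by (auto intro: finite_bd)
  have "card (bd r (X \<inter> Y)) + card (bd r (X \<union> Y))
      = card (bd r (X \<inter> Y) \<union> bd r (X \<union> Y)) + card (bd r (X \<inter> Y) \<inter> bd r (X \<union> Y))"
    using fin by (intro card_Un_Int)
  also have "\<dots> \<le> card (bd r X \<union> bd r Y) + card (bd r X \<inter> bd r Y)"
    by (intro add_mono card_mono) (use fin in \<open>auto simp: bd_def\<close>)
  also have "\<dots> = card (bd r X) + card (bd r Y)"
    using fin by (intro card_Un_Int[symmetric])
  finally show ?thesis .
qed

lemma conn_singleton: "conn r {x}"
  by (auto simp: conn_def)

lemma conn_mono_rel:
  assumes "conn r X" "r \<subseteq> s"
  shows "conn s X"
proof -
  have "(Restr r X)\<^sup>* \<subseteq> (Restr s X)\<^sup>*"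
    using assms(2) by (intro rtrancl_mono) auto
  then show ?thesis using assms(1) unfolding conn_def by blast
qed

lemma Restr_rtrancl_mono: "(x, y) \<in> (Restr r X)\<^sup>* \<Longrightarrow> X \<subseteq> Y \<Longrightarrow> (x, y) \<in> (Restr r Y)\<^sup>*"
  using rtrancl_mono[of "Restr r X" "Restr r Y"] by blast

lemma conn_Un:
  assumes "conn r X" "conn r Y" "X \<inter> Y \<noteq> {}"
  shows "conn r (X \<union> Y)"
proof -
  obtain z where z: "z \<in> X" "z \<in> Y" using assms(3) by blast
  have *: "(x, z) \<in> (Restr r (X \<union> Y))\<^sup>* \<and> (z, x) \<in> (Restr r (X \<union> Y))\<^sup>*" if x: "x \<in> X \<union> Y" for x
  proof (cases "x \<in> X")
    case True
    then have "(x, z) \<in> (Restr r X)\<^sup>*" "(z, x) \<in> (Restr r X)\<^sup>*"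
      using assms(1) z unfolding conn_def by auto
    then show ?thesis using Restr_rtrancl_mono[OF _ Un_upper1, of _ _ r X Y] by auto
  next
    case False
    then have "(x, z) \<in> (Restr r Y)\<^sup>*" "(z, x) \<in> (Restr r Y)\<^sup>*"
      using assms(2) x z unfolding conn_def by auto
    then show ?thesis using Restr_rtrancl_mono[OF _ Un_upper2, of _ _ r Y X] by auto
  qed
  show ?thesis
    unfolding conn_def
  proof (intro conjI ballI)
    show "X \<union> Y \<noteq> {}" using z by blast
    show "(x, y) \<in> (Restr r (X \<union> Y))\<^sup>*" if "x \<in> X \<union> Y" "y \<in> X \<union> Y" for x y
      using *[OF that(1)] *[OF that(2)] by (meson rtrancl_trans)
  qed
qed

lemma conn_edge: "(x, y) \<in> r \<Longrightarrow> sym r \<Longrightarrow> conn r {x, y}"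
  using symD[of r x y] unfolding conn_def by (auto intro!: r_into_rtrancl)

text \<open>Disjoint sets that meet \<open>B\<close> use up different points of \<open>B\<close>,
  and there are as many sets as points, so none contains a second one. This turns a linkage between
  boundaries of equal size into a bijection.\<close>

lemma disjoint_transversal:
  assumes "finite B" "card I = card B" "finite I"
    and meet: "\<And>i. i \<in> I \<Longrightarrow> Q i \<inter> B \<noteq> {}"
    and disj: "disjoint_family_on Q I"
  obtains g where "bij_betw g I B" "\<And>i. i \<in> I \<Longrightarrow> Q i \<inter> B = {g i}"
proof -
  obtain g where g: "\<And>i. i \<in> I \<Longrightarrow> g i \<in> Q i \<inter> B"
    using bchoice[of I "\<lambda>i x. x \<in> Q i \<inter> B"] meet by blast
  have uniq: "i = j" if "i \<in> I" "j \<in> I" "x \<in> Q i" "x \<in> Q j" for i j x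
    using disj that unfolding disjoint_family_on_def by blast
  have inj: "inj_on g I"
    by (rule inj_onI) (metis g IntE uniq)
  moreover have "g ` I = B"
    using assms(1,2,3) g inj by (intro card_subset_eq) (auto simp: card_image)
  ultimately have bij: "bij_betw g I B" by (simp add: bij_betw_def)
  have "Q i \<inter> B = {g i}" if "i \<in> I" for i
  proof -
    have "x = g i" if "x \<in> Q i" "x \<in> B" for x
    proof -
      obtain j where "j \<in> I" "x = g j" using \<open>g ` I = B\<close> \<open>x \<in> B\<close> by blast
      then show ?thesis using uniq[of i j x] g[of j] \<open>i \<in> I\<close> \<open>x \<in> Q i\<close> by auto
    qed
    then show ?thesis using g[OF that] by blast
  qed
  with bij show ?thesis by (rule that)
qed

section \<open>Linkages\<close>

text \<open>Menger's theorem, by deleting an edge or splitting at a set with a boundary of the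
  smallest size.\<close>

lemma linkage:
  assumes "finite r" "sym r" "finite Y" "X \<subseteq> Y"
    and "\<And>Z. X \<subseteq> Z \<Longrightarrow> Z \<subseteq> Y \<Longrightarrow> card (bd r X) \<le> card (bd r Z)"
  shows "\<exists>Q. (\<forall>a\<in>bd r X. a \<in> Q a \<and> conn r (Q a) \<and> Q a \<subseteq> (Y - X) \<union> bd r X \<and> Q a \<inter> bd r Y \<noteq> {})
           \<and> disjoint_family_on Q (bd r X)"
  using assms
proof (induction "card (Y - X) + card r" arbitrary: r X Y rule: less_induct)
  case less
  note fr = less.prems(1) and sr = less.prems(2) and fY = less.prems(3) and XY = less.prems(4)
    and sep = less.prems(5)
  have fX: "finite X" using finite_subset[OF XY fY] .
  show ?case
  proof (cases "\<exists>Z. X \<subset> Z \<and> Z \<subset> Y \<and> card (bd r Z) = card (bd r X)")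
    case True
    \<comment> \<open>\<open>Z\<close> is a proper intermediate set of minimum boundary: link
      \<open>bd r X\<close> to \<open>bd r Z\<close> and \<open>bd r Z\<close> to
      \<open>bd r Y\<close>, then glue at the vertices of \<open>bd r Z\<close>.\<close>
    then obtain Z where Z: "X \<subset> Z" "Z \<subset> Y" "card (bd r Z) = card (bd r X)" by blast
    have fZ: "finite Z" using finite_subset[OF _ fY] Z by blast
    have lt: "card (Z - X) < card (Y - X)" "card (Y - Z) < card (Y - X)"
      using Z fY by (auto intro!: psubset_card_mono)
    obtain P where P: "\<And>a. a \<in> bd r X \<Longrightarrow> a \<in> P a \<and> conn r (P a) \<and> P a \<subseteq> (Z - X) \<union> bd r X \<and> P a \<inter> bd r Z \<noteq> {}"
        and Pd: "disjoint_family_on P (bd r X)"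
    proof -
      have "card (Z - X) + card r < card (Y - X) + card r" "X \<subseteq> Z" using lt Z by auto
      moreover have "card (bd r X) \<le> card (bd r W)" if "X \<subseteq> W" "W \<subseteq> Z" for W
        using sep[of W] Z that by auto
      ultimately show ?thesis using less.hyps[of Z X r, OF _ fr sr fZ] that by metis
    qed
    obtain Q where Q: "\<And>a. a \<in> bd r Z \<Longrightarrow> a \<in> Q a \<and> conn r (Q a) \<and> Q a \<subseteq> (Y - Z) \<union> bd r Z \<and> Q a \<inter> bd r Y \<noteq> {}"
        and Qd: "disjoint_family_on Q (bd r Z)"
    proof -
      have "card (bd r Z) \<le> card (bd r W)" if "Z \<subseteq> W" "W \<subseteq> Y" for W
        using sep[of W] Z that by auto
      moreover have "card (Y - Z) + card r < card (Y - X) + card r" "Z \<subseteq> Y" using lt Z by auto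
      ultimately show ?thesis using less.hyps[of Y Z r, OF _ fr sr fY] that by metis
    qed
    obtain z where z: "bij_betw z (bd r X) (bd r Z)" "\<And>a. a \<in> bd r X \<Longrightarrow> P a \<inter> bd r Z = {z a}"
      using disjoint_transversal[OF finite_bd[OF fZ] Z(3)[symmetric] finite_bd[OF fX] _ Pd] P by metis
    have zin: "z a \<in> bd r Z" "z a \<in> P a" if "a \<in> bd r X" for a
      using z(2)[OF that] by auto
    \<comment> \<open>Every vertex of \<open>bd r Z\<close> lies in a linking set of its own, so
      \<open>Q (z a)\<close> contains only one of them. As \<open>P\<close> stays in
      \<open>Z\<close>, the two families overlap only at the gluing vertices.\<close>
    have Qz: "w = z a" if "a \<in> bd r X" "w \<in> Q (z a)" "w \<in> bd r Z" for a w
      using Qd Q[of w] that zin unfolding disjoint_family_on_def by blast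
    define R where "R = (\<lambda>a. P a \<union> Q (z a))"
    have "a \<in> R a \<and> conn r (R a) \<and> R a \<subseteq> (Y - X) \<union> bd r X \<and> R a \<inter> bd r Y \<noteq> {}"
      if a: "a \<in> bd r X" for a
    proof (intro conjI)
      show "a \<in> R a" using P[OF a] by (auto simp: R_def)
      show "conn r (R a)"
        unfolding R_def using P[OF a] Q[OF zin(1)[OF a]] zin(2)[OF a] by (intro conn_Un) auto
      show "R a \<subseteq> (Y - X) \<union> bd r X"
      proof
        fix w assume w: "w \<in> R a"
        consider "w \<in> P a" | "w \<in> Q (z a)" "w \<in> bd r Z" | "w \<in> Y - Z"
          using w Q[OF zin(1)[OF a]] unfolding R_def by blast
        then show "w \<in> (Y - X) \<union> bd r X"
          using P[OF a] Qz[OF a] zin(2)[OF a] Z by cases blast+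
      qed
      show "R a \<inter> bd r Y \<noteq> {}" using Q[OF zin(1)[OF a]] by (auto simp: R_def)
    qed
    moreover have "disjoint_family_on R (bd r X)"
      unfolding disjoint_family_on_def
    proof (intro ballI impI)
      fix a b assume ab: "a \<in> bd r X" "b \<in> bd r X" "a \<noteq> b"
      have PQ: False if "a \<in> bd r X" "b \<in> bd r X" "a \<noteq> b" "w \<in> P a" "w \<in> Q (z b)" for a b w
      proof -
        have "w \<in> Z" using P[OF that(1)] that(4) Z by (auto simp: bd_def)
        then have "w \<in> bd r Z" using Q[OF zin(1)[OF that(2)]] that(5) by blast
        then have "w = z b" using Qz that by blast
        then show False using zin(2)[OF that(2)] Pd that unfolding disjoint_family_on_def by blast
      qed
      have "z a \<noteq> z b" using z(1) ab by (auto simp: bij_betw_def inj_on_def)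
      then have "Q (z a) \<inter> Q (z b) = {}" "P a \<inter> P b = {}"
        using Qd Pd zin(1) ab unfolding disjoint_family_on_def by blast+
      then show "R a \<inter> R b = {}"
        using PQ[of a b] PQ[of b a] ab unfolding R_def by blast
    qed
    ultimately show ?thesis by blast
  next
    case noZ: False
    show ?thesis
    proof (cases "\<exists>x\<in>bd r X. \<exists>y\<in>Y - X. (x, y) \<in> r")
      case False
      \<comment> \<open>All neighbours of \<open>bd r X\<close> outside \<open>X\<close> lie outside
        \<open>Y\<close> as well, so single vertices form a linkage.\<close>
      then have "bd r X \<subseteq> bd r Y" using XY by (auto simp: bd_def)
      then show ?thesis
        by (intro exI[of _ "\<lambda>a. {a}"]) (auto simp: conn_singleton disjoint_family_on_def)
    next
      case True
      then obtain x y where xy: "x \<in> bd r X" "y \<in> Y" "y \<notin> X" "(x, y) \<in> r" by blast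
      have xX: "x \<in> X" using xy(1) by (rule bdD)
      show ?thesis
      proof (cases "\<forall>y'. (x, y') \<in> r \<longrightarrow> y' \<notin> X \<longrightarrow> y' = y")
        case True
        \<comment> \<open>\<open>y\<close> is the only neighbour of \<open>x\<close> outside
          \<open>X\<close>, so moving \<open>y\<close> into \<open>X\<close> at best trades
          \<open>x\<close> for \<open>y\<close> in the boundary. The size cannot drop, and since no
          proper intermediate set has this size, \<open>Y\<close> is \<open>insert y X\<close> and
          the edge from \<open>x\<close> to \<open>y\<close> links.\<close>
        let ?B = "insert y (bd r X - {x})"
        have sub: "bd r (insert y X) \<subseteq> ?B" using True by (auto simp: bd_def)
        have "y \<notin> bd r X" using xy(3) bdD by metis
        then have cB: "card ?B = card (bd r X)"
          using finite_bd[OF fX] xy(1) by (metis DiffD1 card.remove card_insert_disjoint finite_Diff)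
        have ge: "card (bd r X) \<le> card (bd r (insert y X))"
          using sep XY xy(2) by blast
        have fin: "finite ?B" using finite_bd[OF fX] by simp
        have eq: "bd r (insert y X) = ?B"
          using sub ge cB fin by (intro card_seteq) auto
        have Y: "Y = insert y X"
          using noZ eq cB XY xy(2,3) by (metis insert_subset psubsetI subset_insertI insertI1)
        show ?thesis
          by (intro exI[of _ "\<lambda>a. if a = x then {x, y} else {a}"])
            (use xy eq Y conn_edge[OF xy(4) sr] in \<open>auto simp: conn_singleton disjoint_family_on_def dest: subsetD[OF bd_subset]\<close>)
      next
        case False
        then obtain y' where y': "(x, y') \<in> r" "y' \<notin> X" "y' \<noteq> y" by blast
        \<comment> \<open>Deleting this edge changes neither end boundary: \<open>x\<close> keeps
          the outer neighbour \<open>y'\<close>, and both \<open>x\<close> and \<open>y\<close> lie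
          in \<open>Y\<close>. A proper intermediate set loses at most \<open>x\<close> from its
          boundary, which was larger than \<open>bd r X\<close> before.\<close>
        define r' where "r' = r - {(x, y), (y, x)}"
        have r'r: "r' \<subseteq> r" by (auto simp: r'_def)
        have fr': "finite r'" using fr by (auto simp: r'_def)
        have "card r' < card r"
          using fr xy by (intro psubset_card_mono) (auto simp: r'_def)
        moreover have "sym r'" using sr by (auto simp: r'_def sym_def)
        moreover have bX: "bd r' X = bd r X"
          using xX xy y' unfolding bd_def r'_def by auto
        moreover have bY: "bd r' Y = bd r Y"
          using xX XY xy unfolding bd_def r'_def by auto
        moreover have "card (bd r X) \<le> card (bd r' Z)" if XZ: "X \<subseteq> Z" and ZY: "Z \<subseteq> Y" for Z
        proof -
          consider "Z = X" | "Z = Y" | "X \<subset> Z" "Z \<subset> Y" using XZ ZY by blast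
          then show ?thesis
          proof cases
            case 3
            then have "card (bd r X) < card (bd r Z)"
              using sep[OF XZ ZY] noZ by (metis le_neq_implies_less)
            moreover have "bd r Z \<subseteq> insert x (bd r' Z)"
              using XZ xX unfolding bd_def r'_def by auto
            moreover have "finite (bd r' Z)" using ZY fY by (meson finite_bd finite_subset)
            ultimately have "card (bd r Z) \<le> card (insert x (bd r' Z))"
                "card (insert x (bd r' Z)) \<le> Suc (card (bd r' Z))"
              by (intro card_mono, auto simp: card_insert_if)
            then show ?thesis using \<open>card (bd r X) < card (bd r Z)\<close> by simp
          qed (use bX bY sep XY in auto)
        qed
        ultimately obtain Q where "\<forall>a\<in>bd r X. a \<in> Q a \<and> conn r' (Q a) \<and> Q a \<subseteq> (Y - X) \<union> bd r X \<and> Q a \<inter> bd r Y \<noteq> {}"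
            "disjoint_family_on Q (bd r X)"
          using less.hyps[of Y X r'] fr' fY XY by auto
        then show ?thesis by (meson conn_mono_rel r'r)
      qed
    qed
  qed
qed

section \<open>Layouts of finite sets\<close>

text \<open>Boundaries are taken in all of \<open>r\<close>, also towards vertices not yet inserted,
  so a laid set is an initial part of a numbering that may continue beyond it.\<close>

inductive_set laid :: "'a rel \<Rightarrow> nat \<Rightarrow> 'a set set" for r N where
  empty: "{} \<in> laid r N"
| insert: "X \<in> laid r N \<Longrightarrow> v \<notin> X \<Longrightarrow> card (bd r (insert v X)) \<le> N \<Longrightarrow> insert v X \<in> laid r N"

lemma laid_finite: "X \<in> laid r N \<Longrightarrow> finite X"
  by (induction rule: laid.induct) auto

text \<open>By submodularity, a good numbering of \<open>Y\<close> restricts to \<open>X\<close> if no set in between has a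
  smaller boundary than \<open>X\<close>.\<close>

lemma laid_linked_subset:
  assumes "Y \<in> laid r N" "X \<subseteq> Y"
    and linked: "\<And>Z. X \<subseteq> Z \<Longrightarrow> Z \<subseteq> Y \<Longrightarrow> card (bd r X) \<le> card (bd r Z)"
  shows "X \<in> laid r N"
proof -
  have fY: "finite Y" using laid_finite[OF assms(1)] .
  have "A \<inter> X \<in> laid r N" if "A \<in> laid r N" "A \<subseteq> Y" for A
    using that
  proof (induction rule: laid.induct)
    case empty
    then show ?case by (simp add: laid.empty)
  next
    case (insert A v)
    have IH: "A \<inter> X \<in> laid r N" using insert by simp
    have "finite (insert v A)" "finite X" using finite_subset[OF _ fY] insert.prems assms(2) by auto
    then have "card (bd r (insert v A \<inter> X)) + card (bd r (insert v A \<union> X))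
        \<le> card (bd r (insert v A)) + card (bd r X)"
      by (rule bd_submodular)
    moreover have "card (bd r X) \<le> card (bd r (insert v A \<union> X))"
      by (rule linked) (use insert.prems assms(2) in auto)
    ultimately have "card (bd r (insert v A \<inter> X)) \<le> N" using insert.hyps by simp
    then show ?case using IH laid.insert[of "A \<inter> X" r N v] insert.hyps(2)
      by (cases "v \<in> X") auto
  qed
  from this[OF assms(1)] show ?thesis using assms(2) by (simp add: inf_absorb2)
qed

text \<open>The order of insertion is the numbering. The bound on its range lets numberings of
  consecutive blocks be placed end to end later.\<close>

lemma laid_positions:
  "X \<in> laid r N \<Longrightarrow> \<exists>p :: 'a \<Rightarrow> nat. inj_on p X \<and> p ` X \<subseteq> {..<card X} \<and>
     (\<forall>m. card (bd r {v \<in> X. p v < m}) \<le> N)"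
proof (induction rule: laid.induct)
  case empty
  then show ?case by (auto simp: bd_def)
next
  case (insert X v)
  obtain p :: "'a \<Rightarrow> nat" where p: "inj_on p X" "p ` X \<subseteq> {..<card X}"
      "\<And>m. card (bd r {v \<in> X. p v < m}) \<le> N" using insert.IH by blast
  have fX: "finite X" using laid_finite[OF insert.hyps(1)] .
  let ?p = "p(v := card X)"
  have px: "p x < card X" if "x \<in> X" for x using p(2) that by blast
  have "inj_on ?p X"
    using p(1) insert.hyps(2) by (subst inj_on_cong[of X ?p p]) auto
  moreover have "?p v \<notin> ?p ` (X - {v})"
  proof
    assume "?p v \<in> ?p ` (X - {v})"
    then obtain x where "x \<in> X" "?p x = ?p v" by force
    moreover have "x \<noteq> v" using \<open>x \<in> X\<close> insert.hyps(2) by blast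
    ultimately have "x \<in> X" "p x = card X" by simp_all
    then show False using px[of x] by simp
  qed
  ultimately have "inj_on ?p (insert v X)"
    by (simp only: inj_on_insert simp_thms)
  moreover have "?p ` insert v X \<subseteq> {..<card (insert v X)}"
    using px insert.hyps(2) fX by (auto simp: less_Suc_eq)
  moreover have "card (bd r {w \<in> insert v X. ?p w < m}) \<le> N" for m
  proof (cases "m \<le> card X")
    case True
    then have "{w \<in> insert v X. ?p w < m} = {w \<in> X. p w < m}" using insert.hyps(2) by auto
    then show ?thesis using p(3) by simp
  next
    case False
    then have "{w \<in> insert v X. ?p w < m} = insert v X"
      using px insert.hyps(2) by (auto intro: less_trans[of _ "card X"])
    then show ?thesis using insert.hyps by simp
  qed
  ultimately show ?case by blast
qed

section \<open>Growing a tree minor\<close>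

lemma maximal_member:
  fixes C :: "'a set set"
  assumes "finite C" "A \<in> C"
  obtains X where "X \<in> C" "A \<subseteq> X" "\<forall>Y\<in>C. X \<subseteq> Y \<longrightarrow> X = Y"
  using finite_has_maximal2[OF assms] that by auto

text \<open>The state after \<open>i\<close> tree vertices, where vertex \<open>j\<close> hangs on
  the earlier vertex \<open>par j\<close>. No larger laid set in \<open>V\<close> has boundary of
  size at most \<open>i\<close>. Each branch set reaches the boundary in one vertex
  \<open>a j\<close>, which has a neighbour outside \<open>X\<close>, so every branch set can still
  receive a child.\<close>

definition grown where
  "grown r V N par i X U a \<longleftrightarrow> X \<in> laid r N \<and> X \<subseteq> V \<and> bij_betw a {..<i} (bd r X) \<and>
     (\<forall>Y\<in>laid r N. X \<subset> Y \<longrightarrow> Y \<subseteq> V \<longrightarrow> i < card (bd r Y)) \<and>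
     (\<forall>j<i. conn r (U j) \<and> U j \<subseteq> X \<and> U j \<inter> bd r X = {a j}) \<and> disjoint_family_on U {..<i} \<and>
     (\<forall>j<i. 0 < j \<longrightarrow> (\<exists>x\<in>U (par j). \<exists>y\<in>U j. (x, y) \<in> r))" for i :: nat

text \<open>The new tree vertex starts as a neighbour \<open>u\<close>, outside \<open>X\<close>, of
  the boundary vertex of its parent's branch set. Maximality of \<open>X\<close> forces the boundary
  of \<open>insert u X\<close> up to \<open>i + 1\<close>. A linkage then carries the branch sets on
  to the boundary of a maximal laid set \<open>Y\<close> of boundary at most
  \<open>i + 1\<close>.\<close>

lemma grown_exists:
  fixes par :: "nat \<Rightarrow> nat"
  assumes V: "finite V" "r \<subseteq> V \<times> V" "sym r" "V \<notin> laid r N"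
    and par: "\<And>j. 0 < j \<Longrightarrow> par j < j"
  shows "i \<le> N \<Longrightarrow> \<exists>X U a. grown r V N par i X U a"
proof (induction i)
  case 0
  let ?C = "{Y \<in> laid r N. Y \<subseteq> V \<and> bd r Y = {}}"
  have "finite ?C" using V(1) by (auto intro: finite_subset[of _ "Pow V"])
  moreover have "{} \<in> ?C" by (auto simp: bd_def laid.empty)
  ultimately obtain X where X: "X \<in> ?C" "{} \<subseteq> X" "\<forall>Y\<in>?C. X \<subseteq> Y \<longrightarrow> X = Y"
    by (rule maximal_member)
  have "0 < card (bd r Y)" if Y: "Y \<in> laid r N" "X \<subset> Y" "Y \<subseteq> V" for Y
  proof -
    have "bd r Y \<noteq> {}" using X(3) Y by blast
    then show ?thesis using finite_bd[OF laid_finite[OF Y(1)], of r] by (simp add: card_gt_0_iff)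
  qed
  then have "X \<in> laid r N" "X \<subseteq> V" "bd r X = {}"
      "\<forall>Y\<in>laid r N. X \<subset> Y \<longrightarrow> Y \<subseteq> V \<longrightarrow> 0 < card (bd r Y)"
    using X(1) by simp_all
  then have "grown r V N par 0 X (\<lambda>_. {}) undefined"
    by (simp add: grown_def disjoint_family_on_def bij_betw_def)
  then show ?case by blast
next
  case (Suc i)
  then obtain X U a where G: "grown r V N par i X U a" by auto
  have X: "X \<in> laid r N" "X \<subseteq> V" and a: "bij_betw a {..<i} (bd r X)"
    and maxX: "\<And>Y. Y \<in> laid r N \<Longrightarrow> X \<subset> Y \<Longrightarrow> Y \<subseteq> V \<Longrightarrow> i < card (bd r Y)"
    and U: "\<And>j. j < i \<Longrightarrow> conn r (U j) \<and> U j \<subseteq> X \<and> U j \<inter> bd r X = {a j}"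
    and Ud: "disjoint_family_on U {..<i}"
    and Ue: "\<And>j. j < i \<Longrightarrow> 0 < j \<Longrightarrow> \<exists>x\<in>U (par j). \<exists>y\<in>U j. (x, y) \<in> r"
    using G unfolding grown_def by simp_all
  have fX: "finite X" and fr: "finite r"
    using finite_subset[OF X(2) V(1)] finite_subset[OF V(2)] V(1) by auto
  have cX: "card (bd r X) = i" using bij_betw_same_card[OF a] by simp
  have "X \<noteq> V" using X(1) V(4) by blast
  \<comment> \<open>The first tree vertex has no parent and may be placed anywhere outside
    \<open>X\<close>; there is room because \<open>X\<close> is laid and \<open>V\<close> is
    not.\<close>
  obtain u where u: "u \<in> V" "u \<notin> X" "i > 0 \<Longrightarrow> (a (par i), u) \<in> r"
  proof (cases "i = 0")
    case True
    then show ?thesis using \<open>X \<noteq> V\<close> X(2) that by blast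
  next
    case False
    then have "a (par i) \<in> bd r X" using a par by (auto simp: bij_betw_def)
    then show ?thesis using that V(2) by (auto simp: bd_def)
  qed
  define X' where "X' = insert u X"
  have X'V: "X' \<subseteq> V" using u X by (simp add: X'_def)
  have bs: "bd r X' \<subseteq> insert u (bd r X)" by (auto simp: bd_def X'_def)
  have cins: "card (insert u (bd r X)) = Suc i"
    using u(2) cX finite_bd[OF fX, of r] bd_subset[of r X] by (subst card_insert_disjoint) auto
  have "card (bd r X') \<le> Suc i"
    using card_mono[OF _ bs] finite_bd[OF fX, of r] cins by simp
  then have X'l: "X' \<in> laid r N"
    unfolding X'_def using X(1) u(2) Suc.prems by (intro laid.insert) (auto simp: X'_def)
  then have "i < card (bd r X')" using maxX u X'V by (auto simp: X'_def)
  then have bX': "bd r X' = insert u (bd r X)"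
    using bs finite_bd[OF fX, of r] cins by (intro card_seteq) auto
  let ?C = "{Y \<in> laid r N. Y \<subseteq> V \<and> card (bd r Y) \<le> Suc i}"
  have "finite ?C" using V(1) by (auto intro: finite_subset[of _ "Pow V"])
  moreover have "X' \<in> ?C" using X'l X'V cins bX' by simp
  ultimately obtain Y where Y: "Y \<in> ?C" "X' \<subseteq> Y" "\<forall>Z\<in>?C. Y \<subseteq> Z \<longrightarrow> Y = Z"
    by (rule maximal_member)
  have fY: "finite Y" using Y(1) finite_subset[OF _ V(1)] by blast
  have XX': "X \<subset> X'" using u(2) by (auto simp: X'_def)
  have Yl: "Y \<in> laid r N" "Y \<subseteq> V" "card (bd r Y) \<le> Suc i" using Y(1) by simp_all
  have XY: "X \<subset> Y" using XX' Y(2) by (rule psubset_subset_trans)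
  have cY: "card (bd r Y) = Suc i" using maxX[OF Yl(1) XY Yl(2)] Yl(3) by simp
  have sep: "card (bd r X') \<le> card (bd r Z)" if Z: "X' \<subseteq> Z" "Z \<subseteq> Y" for Z
  proof -
    \<comment> \<open>A set \<open>Z0\<close> of least boundary between \<open>X'\<close> and
      \<open>Y\<close> is laid by submodularity and properly contains \<open>X\<close>, so
      maximality of \<open>X\<close> gives it a boundary above \<open>i\<close>. This is the
      separation hypothesis of the linkage.\<close>
    have "\<exists>Z0. (X' \<subseteq> Z0 \<and> Z0 \<subseteq> Y) \<and>
        (\<forall>W. X' \<subseteq> W \<and> W \<subseteq> Y \<longrightarrow> card (bd r Z0) \<le> card (bd r W))"
      by (rule ex_has_least_nat[of _ Z]) (use Z in simp)
    then obtain Z0 where "(X' \<subseteq> Z0 \<and> Z0 \<subseteq> Y) \<and>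
        (\<forall>W. X' \<subseteq> W \<and> W \<subseteq> Y \<longrightarrow> card (bd r Z0) \<le> card (bd r W))" ..
    then have Z0: "X' \<subseteq> Z0" "Z0 \<subseteq> Y"
        "\<And>W. X' \<subseteq> W \<Longrightarrow> W \<subseteq> Y \<Longrightarrow> card (bd r Z0) \<le> card (bd r W)"
      by simp_all
    have "Z0 \<in> laid r N"
    proof (rule laid_linked_subset[OF Yl(1) Z0(2)])
      show "card (bd r Z0) \<le> card (bd r W)" if "Z0 \<subseteq> W" "W \<subseteq> Y" for W
        using Z0(1) that by (intro Z0(3)) auto
    qed
    then have "i < card (bd r Z0)"
      by (rule maxX) (use XX' Z0(1,2) Yl(2) in auto)
    then show ?thesis using Z0(3)[OF Z] bX' cins by simp
  qed
  obtain Q where Q: "\<And>b. b \<in> bd r X' \<Longrightarrow> b \<in> Q b \<and> conn r (Q b) \<and> Q b \<subseteq> (Y - X') \<union> bd r X' \<and> Q b \<inter> bd r Y \<noteq> {}"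
      and Qd: "disjoint_family_on Q (bd r X')"
    using linkage[OF fr V(3) fY Y(2) sep] by blast
  obtain g where g: "bij_betw g (bd r X') (bd r Y)" "\<And>b. b \<in> bd r X' \<Longrightarrow> Q b \<inter> bd r Y = {g b}"
  proof (rule disjoint_transversal)
    show "finite (bd r Y)" "finite (bd r X')" using fY fX by (auto intro!: finite_bd simp: X'_def)
    show "card (bd r X') = card (bd r Y)" using cY bX' cins by simp
    show "disjoint_family_on Q (bd r X')" by (rule Qd)
  qed (use Q in auto)
  define a0 where "a0 = a(i := u)"
  have a0: "bij_betw a0 {..<Suc i} (bd r X')"
  proof -
    have "a0 ` {..<i} = bd r X" using a by (auto simp: a0_def bij_betw_def)
    moreover have "a0 i = u" by (simp add: a0_def)
    ultimately have "a0 ` {..<Suc i} = bd r X'" unfolding lessThan_Suc image_insert bX' by simp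
    then show ?thesis
      by (simp add: bij_betw_def eq_card_imp_inj_on cins bX')
  qed
  \<comment> \<open>Old branch sets are prolonged by linking sets; the new one is the linking set of
    \<open>u\<close> alone. A linking set meets \<open>X'\<close> only in its start, which keeps the
    branch sets disjoint.\<close>
  define W where "W = (\<lambda>j. (if j < i then U j else {}) \<union> Q (a0 j))"
  have a0in: "a0 j \<in> bd r X'" if "j < Suc i" for j
    using a0 that by (auto simp: bij_betw_def)
  have a0a: "a0 j = a j" if "j < i" for j using that by (simp add: a0_def)
  have a0i: "a0 i = u" by (simp add: a0_def)
  have aU: "a j \<in> U j" if "j < i" for j using U[OF that] by blast
  have Qeq: "w = b" if "b \<in> bd r X'" "w \<in> Q b" "w \<in> X'" for w b
    using Q[OF that(1)] Q[of w] that Qd unfolding disjoint_family_on_def by blast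
  have W: "conn r (W j) \<and> W j \<subseteq> Y \<and> W j \<inter> bd r Y = {g (a0 j)}" if j: "j < Suc i" for j
  proof (cases "j < i")
    case True
    have "conn r (W j)"
      unfolding W_def using True U[OF True] Q[OF a0in[OF j]] aU[OF True] a0a[OF True]
      by (auto intro!: conn_Un)
    moreover have "W j \<subseteq> Y"
      unfolding W_def using U[OF True] Q[OF a0in[OF j]] True Y(2) XX' bd_subset[of r X'] by auto
    moreover have "U j \<inter> bd r Y \<subseteq> Q (a0 j)"
    proof
      fix w assume w: "w \<in> U j \<inter> bd r Y"
      then have "w \<in> bd r X" using U[OF True] Y(2) XX' by (auto simp: bd_def)
      then have "w = a j" using w U[OF True] by auto
      then show "w \<in> Q (a0 j)" using Q[OF a0in[OF j]] a0a[OF True] by auto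
    qed
    ultimately show ?thesis using g(2)[OF a0in[OF j]] True unfolding W_def by auto
  next
    case False
    then show ?thesis using Q[OF a0in[OF j]] g(2)[OF a0in[OF j]] Y(2) bd_subset[of r X']
      by (auto simp: W_def)
  qed
  moreover have "bij_betw (g \<circ> a0) {..<Suc i} (bd r Y)"
    using a0 g(1) by (rule bij_betw_trans)
  moreover have "disjoint_family_on W {..<Suc i}"
    unfolding disjoint_family_on_def
  proof (intro ballI impI)
    have UQ: "U j \<inter> Q (a0 k) = {}" if "j < i" "k < Suc i" "j \<noteq> k" for j k
    proof -
      have False if w: "w \<in> U j" "w \<in> Q (a0 k)" for w
      proof -
        have wX: "w \<in> X" using w U \<open>j < i\<close> by blast
        then have "w = a0 k" using Qeq[OF a0in] w XX' \<open>k < Suc i\<close> by blast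
        moreover have "k < i" using calculation wX u(2) \<open>k < Suc i\<close> a0i less_Suc_eq by metis
        ultimately show False
          using w(1) aU[of k] a0a[of k] Ud \<open>j < i\<close> \<open>j \<noteq> k\<close> unfolding disjoint_family_on_def by auto
      qed
      then show ?thesis by blast
    qed
    fix j k assume jk: "j \<in> {..<Suc i}" "k \<in> {..<Suc i}" "j \<noteq> k"
    have "a0 j \<noteq> a0 k" using a0 jk by (auto simp: bij_betw_def inj_on_def)
    then have "Q (a0 j) \<inter> Q (a0 k) = {}"
      using Qd a0in jk unfolding disjoint_family_on_def by blast
    moreover have "U j \<inter> U k = {}" if "j < i" "k < i"
      using Ud jk that unfolding disjoint_family_on_def by blast
    ultimately show "W j \<inter> W k = {}"
      using UQ[of j k] UQ[of k j] jk unfolding W_def by (auto split: if_splits)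
  qed
  moreover have "\<exists>x\<in>W (par j). \<exists>y\<in>W j. (x, y) \<in> r" if j: "j < Suc i" "0 < j" for j
  proof (cases "j < i")
    case True
    then show ?thesis using Ue[of j] par[of j] j unfolding W_def by fastforce
  next
    case False
    then have [simp]: "j = i" using j by simp
    have "a (par i) \<in> W (par j)" "u \<in> W j"
      using aU[of "par i"] par[of i] j Q[OF a0in[of i]] a0i by (auto simp: W_def)
    then show ?thesis using u(3) j by auto
  qed
  moreover have "Suc i < card (bd r Z)" if "Z \<in> laid r N" "Y \<subset> Z" "Z \<subseteq> V" for Z
  proof -
    have "Z \<notin> ?C" using Y(3) that(2) by blast
    then show ?thesis using that by simp
  qed
  ultimately have "grown r V N par (Suc i) Y W (g \<circ> a0)"
    unfolding grown_def using Y(1) by simp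
  then show ?case by blast
qed

lemma not_laid_tree_minor:
  fixes par :: "nat \<Rightarrow> nat"
  assumes "finite V" "r \<subseteq> V \<times> V" "sym r" "V \<notin> laid r N"
    and "\<And>j. 0 < j \<Longrightarrow> par j < j"
  obtains U where "\<And>j. j < N \<Longrightarrow> conn r (U j) \<and> U j \<subseteq> V" "disjoint_family_on U {..<N}"
    "\<And>j. j < N \<Longrightarrow> 0 < j \<Longrightarrow> \<exists>x\<in>U (par j). \<exists>y\<in>U j. (x, y) \<in> r"
proof -
  obtain X U a where G: "grown r V N par N X U a"
    using grown_exists[OF assms order_refl] by auto
  show ?thesis
    by (rule that[of U]) (use G in \<open>auto simp: grown_def\<close>)
qed

section \<open>Paths in relations and in graphs\<close>

definition adj :: "'a ugraph \<Rightarrow> 'a rel" where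
  "adj G = {(u, v). {u, v} \<in> edges G}"

definition rpath :: "'a rel \<Rightarrow> 'a list \<Rightarrow> bool" where
  "rpath r p \<longleftrightarrow> p \<noteq> [] \<and> distinct p \<and> successively (\<lambda>x y. (x, y) \<in> r) p"

lemma sym_adj: "sym (adj G)"
  by (auto simp: adj_def sym_def insert_commute)

lemma adj_verts: "simple_graph G \<Longrightarrow> (u, v) \<in> adj G \<Longrightarrow> u \<in> verts G \<and> v \<in> verts G \<and> u \<noteq> v"
  by (fastforce simp: simple_graph_def adj_def)

lemma path_edges_subset_iff:
  "path_edges p \<subseteq> edges G \<longleftrightarrow> successively (\<lambda>x y. (x, y) \<in> adj G) p"
  by (auto simp: path_edges_def successively_conv_nth adj_def)

lemma graph_path_iff: "graph_path G p \<longleftrightarrow> rpath (adj G) p \<and> set p \<subseteq> verts G"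
  by (auto simp: graph_path_def rpath_def path_edges_subset_iff)

lemma path_edges_map:
  "path_edges (map h p) = (`) h ` path_edges p"
proof -
  have 1: "path_edges p = (\<lambda>i. {p ! i, p ! Suc i}) ` {i. Suc i < length p}"
    by (auto simp: path_edges_def)
  have 2: "path_edges (map h p) = (\<lambda>i. {map h p ! i, map h p ! Suc i}) ` {i. Suc i < length p}"
    unfolding path_edges_def length_map by blast
  show ?thesis
    unfolding 1 2 image_image by (rule image_cong) auto
qed

lemma rpath_rev: "sym r \<Longrightarrow> rpath r (rev p) \<longleftrightarrow> rpath r p"
proof -
  assume "sym r"
  then have "(\<lambda>x y. (y, x) \<in> r) = (\<lambda>x y. (x, y) \<in> r)"
    by (intro ext) (auto dest: symD)
  then have "successively (\<lambda>x y. (y, x) \<in> r) p = successively (\<lambda>x y. (x, y) \<in> r) p"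
    by (rule arg_cong)
  then show ?thesis by (simp add: rpath_def)
qed

lemma rpath_append:
  "p \<noteq> [] \<Longrightarrow> q \<noteq> [] \<Longrightarrow> rpath r (p @ q) \<longleftrightarrow>
     rpath r p \<and> rpath r q \<and> set p \<inter> set q = {} \<and> (last p, hd q) \<in> r"
  by (auto simp: rpath_def successively_append_iff)

lemma rtrancl_imp_rpath:
  assumes "(x, y) \<in> (Restr r X)\<^sup>*" "x \<in> X"
  shows "\<exists>p. rpath r p \<and> hd p = x \<and> last p = y \<and> set p \<subseteq> X"
  using assms(1)
proof (induction rule: rtrancl_induct)
  case base
  show ?case by (intro exI[of _ "[x]"]) (auto simp: rpath_def assms)
next
  case (step y z)
  then obtain p where p: "rpath r p" "hd p = x" "last p = y" "set p \<subseteq> X" by blast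
  show ?case
  proof (cases "z \<in> set p")
    case True
    then obtain as bs where "p = (as @ [z]) @ bs" by (auto dest: split_list)
    with p show ?thesis
      by (intro exI[of _ "as @ [z]"]) (auto simp: rpath_def successively_append_iff hd_append split: if_splits)
  next
    case False
    with p step show ?thesis
      by (intro exI[of _ "p @ [z]"]) (auto simp: rpath_def successively_append_iff)
  qed
qed

lemma conn_rpath:
  assumes "conn r X" "x \<in> X" "y \<in> X"
  obtains p where "rpath r p" "hd p = x" "last p = y" "set p \<subseteq> X"
  using rtrancl_imp_rpath[of x y r X] assms unfolding conn_def by auto

lemma successively_conn:
  assumes "sym r"
  shows "successively (\<lambda>x y. (x, y) \<in> r) p \<Longrightarrow> p \<noteq> [] \<Longrightarrow> conn r (set p)"
proof (induction p rule: induct_list012)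
  case (3 x y zs)
  then have "conn r (set (y # zs))" "conn r {x, y}"
    using conn_edge[OF _ assms] by auto
  then have "conn r ({x, y} \<union> set (y # zs))" by (intro conn_Un) auto
  then show ?case by (simp add: insert_commute)
qed (auto simp: conn_singleton)

lemma rtrancl_crossing:
  "(x, y) \<in> r\<^sup>* \<Longrightarrow> x \<in> S \<Longrightarrow> y \<notin> S \<Longrightarrow> \<exists>a b. a \<in> S \<and> b \<notin> S \<and> (a, b) \<in> r"
  by (induction rule: rtrancl_induct) auto

section \<open>Subdivisions from minors\<close>

text \<open>Follow a path from \<open>x3\<close> up to its first vertex \<open>y\<close> on a path
  from \<open>x1\<close> to \<open>x2\<close>. The ends may coincide; some legs are then single
  vertices.\<close>

lemma tripod:
  assumes r: "sym r" and U: "conn r U" and x: "x1 \<in> U" "x2 \<in> U" "x3 \<in> U"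
  obtains y q1 q2 q3 where
    "rpath r q1" "hd q1 = y" "last q1 = x1" "set q1 \<subseteq> U"
    "rpath r q2" "hd q2 = y" "last q2 = x2" "set q2 \<subseteq> U"
    "rpath r q3" "hd q3 = y" "last q3 = x3" "set q3 \<subseteq> U"
    "set q1 \<inter> set q2 = {y}" "set q1 \<inter> set q3 = {y}" "set q2 \<inter> set q3 = {y}"
proof -
  obtain p where p: "rpath r p" "hd p = x1" "last p = x2" "set p \<subseteq> U"
    using conn_rpath[OF U x(1,2)] .
  obtain q where q: "rpath r q" "hd q = x3" "last q = x1" "set q \<subseteq> U"
    using conn_rpath[OF U x(3,1)] .
  have "x1 \<in> set p" "x1 \<in> set q"
    using p q hd_in_set[of p] last_in_set[of q] by (auto simp: rpath_def)
  then have "\<exists>z\<in>set q. z \<in> set p" by blast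
  then obtain bs y cs where y: "q = bs @ y # cs" "y \<in> set p" "\<forall>z\<in>set bs. z \<notin> set p"
    using split_list_first_prop[of q "\<lambda>z. z \<in> set p"] by auto
  obtain as ds where as: "p = as @ y # ds" using split_list[OF y(2)] by blast
  have p1: "rpath r (as @ [y])" "rpath r (y # ds)" and q1: "rpath r (bs @ [y])"
    using p(1) q(1) unfolding y(1) as
    by (auto simp: rpath_def successively_append_iff)
  show ?thesis
  proof (rule that[of "rev (as @ [y])" y "y # ds" "rev (bs @ [y])"])
    show "rpath r (rev (as @ [y]))" "rpath r (rev (bs @ [y]))" "rpath r (y # ds)"
      using p1 q1 by (simp_all only: rpath_rev[OF r])
    show "last (rev (as @ [y])) = x1" "last (rev (bs @ [y])) = x3"
      using p(2) q(2) unfolding y(1) as by (auto simp: hd_append last_rev)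
    show "set (rev (as @ [y])) \<inter> set (y # ds) = {y}"
      using p(1) unfolding as by (auto simp: rpath_def)
  qed (use p q y as in auto)
qed

lemma card_le_3_cases:
  assumes "finite A" "card A \<le> 3"
  obtains "A = {}" | a where "A = {a}" | a b where "a \<noteq> b" "A = {a, b}"
  | a b c where "a \<noteq> b" "a \<noteq> c" "b \<noteq> c" "A = {a, b, c}"
proof -
  have "card A = 0 \<or> card A = 1 \<or> card A = 2 \<or> card A = 3" using assms(2) by auto
  then show ?thesis
    using that assms(1) by (auto simp: card_1_singleton_iff card_2_iff card_3_iff)
qed

text \<open>Three is the limit here: up to three vertices of a connected set are the ends of a star
  with one centre, while four may need two branching vertices. This is the source of the degree
  bound on \<open>T\<close>.\<close>

lemma star_paths:
  assumes r: "sym r" and U: "conn r U" and A: "finite A" "card A \<le> 3" and x: "\<And>s. s \<in> A \<Longrightarrow> x s \<in> U"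
  shows "\<exists>y q. y \<in> U \<and> (\<forall>s\<in>A. rpath r (q s) \<and> hd (q s) = y \<and> last (q s) = x s \<and> set (q s) \<subseteq> U) \<and>
    (\<forall>s\<in>A. \<forall>t\<in>A. s \<noteq> t \<longrightarrow> set (q s) \<inter> set (q t) = {y})"
proof -
  have hd_in: "y \<in> U" if "rpath r q1" "hd q1 = y" "set q1 \<subseteq> U" for y q1
    using that by (auto simp: rpath_def)
  show ?thesis
  using A proof (cases rule: card_le_3_cases)
    case 1
    then show ?thesis using U by (auto simp: conn_def)
  next
    case (2 a)
    then have "x a \<in> U" using x by simp
    then show ?thesis
      using 2 by (intro exI[of _ "x a"] exI[of _ "\<lambda>_. [x a]"]) (auto simp: rpath_def)
  next
    case (3 a b)
    then have "x a \<in> U" "x b \<in> U" using x by simp_all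
    \<comment> \<open>With two ends, the tripod receives the second end twice and its third leg is
      dropped.\<close>
    then obtain y q1 q2 q3 where "rpath r q1" "hd q1 = y" "last q1 = x a" "set q1 \<subseteq> U"
      "rpath r q2" "hd q2 = y" "last q2 = x b" "set q2 \<subseteq> U" "set q1 \<inter> set q2 = {y}"
      using tripod[OF r U, of "x a" "x b" "x b"] by metis
    with 3 hd_in[of q1 y] show ?thesis
      by (intro exI[of _ y] exI[of _ "\<lambda>s. if s = a then q1 else q2"]) auto
  next
    case (4 a b c)
    then have "x a \<in> U" "x b \<in> U" "x c \<in> U" using x by simp_all
    then obtain y q1 q2 q3 where "rpath r q1" "hd q1 = y" "last q1 = x a" "set q1 \<subseteq> U"
      "rpath r q2" "hd q2 = y" "last q2 = x b" "set q2 \<subseteq> U"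
      "rpath r q3" "hd q3 = y" "last q3 = x c" "set q3 \<subseteq> U"
      "set q1 \<inter> set q2 = {y}" "set q1 \<inter> set q3 = {y}" "set q2 \<inter> set q3 = {y}"
      using tripod[OF r U, of "x a" "x b" "x c"] by metis
    with 4 hd_in[of q1 y] show ?thesis
      by (intro exI[of _ y] exI[of _ "\<lambda>s. if s = a then q1 else if s = b then q2 else q3"]) auto
  qed
qed

section \<open>Copying paths of the host graph to a subdivision on natural numbers\<close>

lemma path_edges_subset: "e \<in> path_edges p \<Longrightarrow> e \<subseteq> set p"
  by (auto simp: path_edges_def)

text \<open>A subdivision of \<open>T\<close> keeps the vertices of \<open>T\<close> and so lives on
  natural numbers, while its paths are found in a graph of another vertex type. The renaming
  \<open>h\<close> gives the vertex that represents \<open>v\<close> the name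
  \<open>v\<close>.\<close>

lemma inj_on_nat_extension:
  fixes y :: "nat \<Rightarrow> 'a"
  assumes "finite W" "finite V" "inj_on y V"
  obtains h :: "'a \<Rightarrow> nat" where "inj_on h W" "\<And>v. v \<in> V \<Longrightarrow> h (y v) = v"
proof -
  obtain k :: "'a \<Rightarrow> nat" where k: "inj_on k W"
    using finite_imp_inj_to_nat_seg[OF assms(1)] by blast
  obtain M where M: "\<And>v. v \<in> V \<Longrightarrow> v < M"
    using finite_nat_set_iff_bounded[of V] assms(2) by auto
  \<comment> \<open>\<open>M\<close> exceeds all names in \<open>V\<close>, so the shifted codes of
    the other vertices cannot clash with them.\<close>
  define h where "h = (\<lambda>w. if w \<in> y ` V then inv_into V y w else M + k w)"
  have hV: "h (y v) = v" if "v \<in> V" for v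
    using that assms(3) by (simp add: h_def)
  have "inj_on h W"
  proof (rule inj_onI)
    fix a b assume ab: "a \<in> W" "b \<in> W" "h a = h b"
    have out: "h w \<ge> M" if "w \<notin> y ` V" for w using that by (simp add: h_def)
    have ins: "h w < M" if "w \<in> y ` V" for w using that M hV by auto
    show "a = b"
    proof (cases "a \<in> y ` V")
      case True
      then have "b \<in> y ` V" using ins[of a] out[of b] ab(3) by fastforce
      then show ?thesis using True ab(3) hV by auto
    next
      case False
      then have "b \<notin> y ` V" using out[of a] ins[of b] ab(3) by fastforce
      then show ?thesis using False ab k by (auto simp: h_def inj_on_def)
    qed
  qed
  with hV show ?thesis using that by metis
qed

text \<open>\<open>y\<close> places the vertices of \<open>T\<close> in \<open>G\<close> and
  \<open>L\<close> places its edges. The drawn subgraph \<open>S\<close>, renamed by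
  \<open>h\<close>, is the subdivision; \<open>avoid\<close> and \<open>disj\<close> turn into the
  two disjointness conditions of \<open>is_subdivision\<close>.\<close>

lemma subdivision_from_paths:
  fixes T :: "nat ugraph" and G :: "'a ugraph"
  assumes G: "simple_graph G" and T: "simple_graph T" "finite (verts T)" "finite (edges T)"
    and y: "inj_on y (verts T)" "y ` verts T \<subseteq> verts G"
    and L: "\<And>e. e \<in> edges T \<Longrightarrow> graph_path G (L e)"
    and ends: "\<And>e. e \<in> edges T \<Longrightarrow> {hd (L e), last (L e)} = y ` e"
    and avoid: "\<And>e v. e \<in> edges T \<Longrightarrow> v \<in> verts T \<Longrightarrow> y v \<in> set (L e) \<Longrightarrow> v \<in> e"
    and disj: "\<And>e f. e \<in> edges T \<Longrightarrow> f \<in> edges T \<Longrightarrow> e \<noteq> f \<Longrightarrow> set (L e) \<inter> set (L f) \<subseteq> y ` (e \<inter> f)"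
  shows "\<exists>H. is_subdivision H T \<and> contains G H"
proof -
  define W where "W = y ` verts T \<union> (\<Union>e\<in>edges T. set (L e))"
  have "finite W" using T by (auto simp: W_def)
  then obtain h :: "'a \<Rightarrow> nat" where h: "inj_on h W" and hy: "\<And>v. v \<in> verts T \<Longrightarrow> h (y v) = v"
    using inj_on_nat_extension[OF _ T(2) y(1)] by metis
  define P where "P = (\<lambda>e. map h (L e))"
  define H where "H = \<lparr>verts = h ` W, edges = (\<Union>e\<in>edges T. path_edges (P e))\<rparr>"
  define S where "S = \<lparr>verts = W, edges = (\<Union>e\<in>edges T. path_edges (L e))\<rparr>"
  have LW: "set (L e) \<subseteq> W" if "e \<in> edges T" for e using that by (auto simp: W_def)
  have eT: "e \<subseteq> verts T" if "e \<in> edges T" for e using T(1) that by (auto simp: simple_graph_def)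
  have ne: "L e \<noteq> []" if "e \<in> edges T" for e using L[OF that] by (simp add: graph_path_def)
  have path: "graph_path H (P e)" if e: "e \<in> edges T" for e
    unfolding graph_path_def
  proof (intro conjI)
    show "P e \<noteq> []" using ne[OF e] by (simp add: P_def)
    show "distinct (P e)"
      using L[OF e] inj_on_subset[OF h LW[OF e]] by (simp add: P_def graph_path_def distinct_map)
    show "set (P e) \<subseteq> verts H" using LW[OF e] by (auto simp: P_def H_def)
    show "path_edges (P e) \<subseteq> edges H" using e by (auto simp: H_def)
  qed
  have hye: "h ` y ` e = e" if "e \<in> edges T" for e
    using eT[OF that] hy by (force simp: image_image)
  have pend: "{hd (P e), last (P e)} = e" if e: "e \<in> edges T" for e
  proof -
    have "{hd (P e), last (P e)} = h ` {hd (L e), last (L e)}"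
      using ne[OF e] by (simp add: P_def hd_map last_map)
    then show ?thesis using ends[OF e] hye[OF e] by simp
  qed
  have pavoid: "(set (P e) - e) \<inter> verts T = {}" if e: "e \<in> edges T" for e
  proof -
    have "v \<in> e" if v: "v \<in> set (P e)" "v \<in> verts T" for v
    proof -
      obtain w where w: "w \<in> set (L e)" "v = h w" using v(1) by (auto simp: P_def)
      have "h (y v) = h w" using w(2) hy[OF v(2)] by simp
      then have "y v = w"
        using h w(1) LW[OF e] v(2) by (intro inj_onD[OF h]) (auto simp: W_def)
      then show ?thesis using avoid[OF e v(2)] w(1) by simp
    qed
    then show ?thesis by blast
  qed
  have pdisj: "(set (P e) - e) \<inter> (set (P f) - f) = {}" if ef: "e \<in> edges T" "f \<in> edges T" "e \<noteq> f" for e f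
  proof -
    have "v \<in> e" if v: "v \<in> set (P e)" "v \<in> set (P f)" for v
    proof -
      obtain w w' where w: "w \<in> set (L e)" "v = h w" "w' \<in> set (L f)" "v = h w'"
        using v by (auto simp: P_def)
      have "w = w'" using w LW[OF ef(1)] LW[OF ef(2)] by (intro inj_onD[OF h]) auto
      then have "w \<in> y ` (e \<inter> f)" using disj[OF ef] w(1,3) by blast
      then show ?thesis using w(2) hy eT[OF ef(1)] by auto
    qed
    then show ?thesis by blast
  qed
  have "verts H = verts T \<union> (\<Union>e\<in>edges T. set (P e))"
  proof -
    have "h ` y ` verts T = verts T" using hy by (force simp: image_image)
    then show ?thesis by (simp add: H_def W_def P_def image_Un image_UN)
  qed
  moreover have "edges H = (\<Union>e\<in>edges T. path_edges (P e))" by (simp add: H_def)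
  ultimately have "is_subdivision H T"
    unfolding is_subdivision_def using path pend pavoid pdisj by (intro exI[of _ P]) simp
  moreover have "subgraph S G"
  proof -
    have e1: "edges S \<subseteq> edges G" using L by (auto simp: S_def graph_path_def)
    moreover have "verts S \<subseteq> verts G" using y(2) L by (auto simp: S_def W_def graph_path_def)
    moreover have "e \<subseteq> verts S" if "e \<in> edges S" for e
      using that path_edges_subset LW by (fastforce simp: S_def)
    ultimately show ?thesis using G by (auto simp: subgraph_def simple_graph_def)
  qed
  moreover have "isomorphic S H"
    unfolding isomorphic_def
  proof (intro exI[of _ h] conjI ballI)
    show "bij_betw h (verts S) (verts H)" using h by (simp add: S_def H_def bij_betw_def)
    have EH: "edges H = (`) h ` edges S"
      by (simp add: H_def S_def P_def path_edges_map image_UN)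
    have ES: "e \<subseteq> W" if "e \<in> edges S" for e
      using that path_edges_subset LW by (fastforce simp: S_def)
    fix u v assume "u \<in> verts S" "v \<in> verts S"
    then have uv: "{u, v} \<subseteq> W" by (simp add: S_def)
    show "{u, v} \<in> edges S \<longleftrightarrow> {h u, h v} \<in> edges H"
    proof
      assume "{u, v} \<in> edges S"
      then have "h ` {u, v} \<in> edges H" unfolding EH by (rule imageI)
      then show "{h u, h v} \<in> edges H" by simp
    next
      assume "{h u, h v} \<in> edges H"
      then obtain e where e: "e \<in> edges S" "h ` {u, v} = h ` e" unfolding EH by auto
      then have "{u, v} = e" using inj_on_image_eq_iff[OF h uv ES[OF e(1)]] by simp
      then show "{u, v} \<in> edges S" using e(1) by simp
    qed
  qed
  ultimately show ?thesis unfolding contains_def by blast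
qed

text \<open>The path for an edge \<open>{s, t}\<close> runs from the centre of a star in
  \<open>U s\<close> along a leg, across one chosen edge of \<open>G\<close>, and along a leg to the
  centre in \<open>U t\<close>. Legs in one branch set share only the centre, and the branch sets
  are disjoint, so these paths meet only in common ends.\<close>

lemma subdivision_from_minor:
  fixes T :: "nat ugraph" and G :: "'a ugraph"
  assumes G: "simple_graph G" and T: "simple_graph T" "finite (verts T)"
    and deg: "\<And>t. t \<in> verts T \<Longrightarrow> card (neighbours T t) \<le> 3"
    and U: "\<And>t. t \<in> verts T \<Longrightarrow> conn (adj G) (U t) \<and> U t \<subseteq> verts G"
    and Ud: "disjoint_family_on U (verts T)"
    and Ue: "\<And>s t. {s, t} \<in> edges T \<Longrightarrow> \<exists>a\<in>U s. \<exists>b\<in>U t. (a, b) \<in> adj G"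
  shows "\<exists>H. is_subdivision H T \<and> contains G H"
proof -
  have eT: "e \<subseteq> verts T \<and> card e = 2" if "e \<in> edges T" for e
    using T(1) that by (auto simp: simple_graph_def)
  have finE: "finite (edges T)"
    using eT T(2) by (auto intro: finite_subset[of _ "Pow (verts T)"])
  have nb: "neighbours T t \<subseteq> verts T" for t
    using eT by (fastforce simp: neighbours_def)
  have "\<forall>s t. \<exists>a b. {s, t} \<in> edges T \<longrightarrow> a \<in> U s \<and> b \<in> U t \<and> (a, b) \<in> adj G"
    using Ue by blast
  then obtain a b where ab: "\<And>s t. {s, t} \<in> edges T \<Longrightarrow> a s t \<in> U s \<and> b s t \<in> U t \<and> (a s t, b s t) \<in> adj G"
    by metis
  \<comment> \<open>The choice above depends on the order of \<open>s\<close> and \<open>t\<close>.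
    Comparing the two numbers singles out one edge of \<open>G\<close> per edge of \<open>T\<close>,
    and \<open>x s t\<close> is its end in \<open>U s\<close>.\<close>
  define x where "x = (\<lambda>s t. if s < t then a s t else b t s)"
  have xU: "x s t \<in> U s" if "{s, t} \<in> edges T" for s t
    using ab[of s t] ab[of t s] that by (auto simp: x_def insert_commute)
  have xe: "(x s t, x t s) \<in> adj G" if "{s, t} \<in> edges T" "s < t" for s t
    using ab[of s t] that by (auto simp: x_def)
  have "\<exists>y q. y \<in> U t \<and> (\<forall>s\<in>neighbours T t. rpath (adj G) (q s) \<and> hd (q s) = y \<and> last (q s) = x t s \<and> set (q s) \<subseteq> U t) \<and>
    (\<forall>s\<in>neighbours T t. \<forall>s'\<in>neighbours T t. s \<noteq> s' \<longrightarrow> set (q s) \<inter> set (q s') = {y})"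
    if t: "t \<in> verts T" for t
  proof (rule star_paths)
    show "finite (neighbours T t)" using nb T(2) finite_subset by blast
    show "x t s \<in> U t" if "s \<in> neighbours T t" for s
      using xU that by (simp add: neighbours_def)
  qed (use U deg t sym_adj in auto)
  then obtain y q where
      yU: "\<And>t. t \<in> verts T \<Longrightarrow> y t \<in> U t" and
      q0: "\<And>t s. t \<in> verts T \<Longrightarrow> s \<in> neighbours T t \<Longrightarrow> rpath (adj G) (q t s) \<and> hd (q t s) = y t \<and> last (q t s) = x t s \<and> set (q t s) \<subseteq> U t" and
      qd0: "\<And>t s s'. t \<in> verts T \<Longrightarrow> s \<in> neighbours T t \<Longrightarrow> s' \<in> neighbours T t \<Longrightarrow> s \<noteq> s' \<Longrightarrow> set (q t s) \<inter> set (q t s') = {y t}"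
    by metis
  have vT: "s \<in> verts T" "t \<in> verts T" if "{s, t} \<in> edges T" for s t using eT[OF that] by auto
  have q: "rpath (adj G) (q t s) \<and> hd (q t s) = y t \<and> last (q t s) = x t s \<and> set (q t s) \<subseteq> U t"
    if "{s, t} \<in> edges T" for s t
    using q0[of t s] vT[OF that] that by (simp add: neighbours_def insert_commute)
  have qd: "set (q t s) \<inter> set (q t s') = {y t}" if "{s, t} \<in> edges T" "{s', t} \<in> edges T" "s \<noteq> s'" for s s' t
    using qd0[of t s s'] vT[OF that(1)] that by (simp add: neighbours_def insert_commute)
  have Uuniq: "s = t" if "s \<in> verts T" "t \<in> verts T" "w \<in> U s" "w \<in> U t" for s t w
    using Ud that unfolding disjoint_family_on_def by blast
  \<comment> \<open>\<open>Min\<close> and \<open>Max\<close> orient the edge, which makes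
    \<open>L\<close> a function of the unordered pair.\<close>
  define L where "L = (\<lambda>e. q (Min e) (Max e) @ rev (q (Max e) (Min e)))"
  have edge: "\<exists>s t. e = {s, t} \<and> s < t \<and> L e = q s t @ rev (q t s)" if e: "e \<in> edges T" for e
  proof -
    obtain s t where "e = {s, t}" "s \<noteq> t" using eT[OF e] by (auto simp: card_2_iff)
    then have "\<exists>s t. e = {s, t} \<and> s < t" by (metis insert_commute linorder_neqE_nat)
    then obtain s t where "e = {s, t}" "s < t" by blast
    then show ?thesis by (intro exI[of _ s] exI[of _ t]) (auto simp: L_def min_def max_def)
  qed
  have setL: "\<exists>s t. e = {s, t} \<and> w \<in> set (q s t)" if e: "e \<in> edges T" and w: "w \<in> set (L e)" for e w
  proof -
    obtain s t where st: "e = {s, t}" "L e = q s t @ rev (q t s)" using edge[OF e] by blast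
    then consider "w \<in> set (q s t)" | "w \<in> set (q t s)" using w by auto
    then show ?thesis using st(1) insert_commute[of s t "{}"] by cases metis+
  qed
  show ?thesis
  proof (rule subdivision_from_paths[OF G T finE])
    show "inj_on y (verts T)" using Uuniq yU by (intro inj_onI) metis
    show "y ` verts T \<subseteq> verts G" using yU U by blast
  next
    fix e assume e: "e \<in> edges T"
    obtain s t where st: "e = {s, t}" "s < t" "L e = q s t @ rev (q t s)" using edge[OF e] by blast
    have e1: "{s, t} \<in> edges T" "{t, s} \<in> edges T" using e st by (auto simp: insert_commute)
    note q1 = q[OF e1(1)] q[OF e1(2)]
    have ne: "q s t \<noteq> []" "q t s \<noteq> []" using q1 by (auto simp: rpath_def)
    have "U s \<inter> U t = {}" using Uuniq[OF vT[OF e1(1)]] st(2) by fastforce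
    then have dj: "set (q s t) \<inter> set (q t s) = {}" using q1 by blast
    have "rpath (adj G) (L e)"
      unfolding st(3) using ne dj q1 xe[OF e1(1) st(2)]
      by (simp add: rpath_append rpath_rev[OF sym_adj] hd_rev)
    moreover have "set (L e) \<subseteq> verts G"
      unfolding st(3) using q1 U[OF vT(1)[OF e1(1)]] U[OF vT(2)[OF e1(1)]] by auto
    ultimately show "graph_path G (L e)" by (simp add: graph_path_iff)
    show "{hd (L e), last (L e)} = y ` e"
      unfolding st(3) using ne q1 by (simp add: last_rev st(1))
    show "v \<in> e" if v: "v \<in> verts T" "y v \<in> set (L e)" for v
    proof -
      obtain s t where st: "e = {s, t}" "y v \<in> set (q s t)" using setL[OF e v(2)] by blast
      then have "{t, s} \<in> edges T" using e by (simp add: insert_commute)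
      then have "v = s" using Uuniq[OF v(1) _ yU[OF v(1)]] q vT st(2) by blast
      then show ?thesis using st by simp
    qed
    fix f assume f: "f \<in> edges T" "e \<noteq> f"
    show "set (L e) \<inter> set (L f) \<subseteq> y ` (e \<inter> f)"
    proof
      fix w assume w: "w \<in> set (L e) \<inter> set (L f)"
      obtain s t where st: "e = {s, t}" "w \<in> set (q s t)" using setL[OF e] w by blast
      obtain s' t' where st': "f = {s', t'}" "w \<in> set (q s' t')" using setL[OF f(1)] w by blast
      have es: "{t, s} \<in> edges T" "{t', s'} \<in> edges T" using e f(1) st st' by (simp_all add: insert_commute)
      have "w \<in> U s" "w \<in> U s'" using q[OF es(1)] q[OF es(2)] st(2) st'(2) by blast+
      then have ss: "s = s'" using Uuniq vT(2)[OF es(1)] vT(2)[OF es(2)] by blast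
      then have "t \<noteq> t'" using st(1) st'(1) f(2) by blast
      then have "w = y s" using qd[OF es(1)] es(2) st(2) st'(2) ss by blast
      then show "w \<in> y ` (e \<inter> f)" using st(1) st'(1) ss by blast
    qed
  qed
qed

section \<open>Finite graphs without a subdivision of a tree\<close>

lemma tree_conn: "tree T \<Longrightarrow> conn (adj T) (verts T)"
  unfolding conn_def
proof (intro conjI ballI)
  assume T: "tree T"
  then show "verts T \<noteq> {}" by (simp add: tree_def connected_graph_def)
  fix u v assume "u \<in> verts T" "v \<in> verts T"
  then obtain p where p: "graph_path T p" "hd p = u" "last p = v"
    using T unfolding tree_def connected_graph_def by blast
  then have "conn (adj T) (set p)" "u \<in> set p" "v \<in> set p" "set p \<subseteq> verts T"
    using successively_conn[OF sym_adj, of T p] by (auto simp: graph_path_iff rpath_def)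
  then show "(u, v) \<in> (Restr (adj T) (verts T))\<^sup>*"
    using Restr_rtrancl_mono[of u v "adj T" "set p" "verts T"] by (simp add: conn_def)
qed

text \<open>Two neighbours of \<open>v\<close> in \<open>S\<close>, joined by a path inside
  \<open>S\<close>, would close a cycle through \<open>v\<close>.\<close>

lemma tree_unique_neighbour:
  assumes T: "tree T" and S: "conn (adj T) S" "S \<subseteq> verts T"
    and v: "v \<in> verts T" "v \<notin> S" and a: "a \<in> S" "(a, v) \<in> adj T" and b: "b \<in> S" "(b, v) \<in> adj T"
  shows "a = b"
proof (rule ccontr)
  assume "a \<noteq> b"
  obtain p where p: "rpath (adj T) p" "hd p = a" "last p = b" "set p \<subseteq> S"
    using conn_rpath[OF S(1) a(1) b(1)] .
  have ne: "p \<noteq> []" using p(1) by (simp add: rpath_def)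
  have "length p \<noteq> 1" using p(2,3) \<open>a \<noteq> b\<close> by (auto simp: length_Suc_conv)
  then have "3 \<le> length (p @ [v])" using ne by (cases p) (auto simp: Suc_le_eq)
  moreover have "rpath (adj T) (p @ [v])"
    using p b ne v(2) by (subst rpath_append) (auto simp: rpath_def)
  then have "graph_path T (p @ [v])"
    using p(4) S(2) v(1) by (auto simp: graph_path_iff)
  moreover have "{last (p @ [v]), hd (p @ [v])} \<in> edges T"
    using a(2) p(2) ne by (simp add: adj_def insert_commute)
  ultimately have "graph_cycle T (p @ [v])" by (simp add: graph_cycle_def)
  then show False using T by (auto simp: tree_def)
qed

text \<open>Each new vertex is the far end of an edge leaving the set enumerated so far, which
  therefore stays connected. It has no second neighbour in that set, so every edge of the tree joins
  a vertex to its parent.\<close>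

lemma tree_enumeration:
  assumes T: "tree T" "finite (verts T)"
  obtains ts :: "nat \<Rightarrow> 'a" and par where "bij_betw ts {..<card (verts T)} (verts T)"
    "\<And>j. 0 < j \<Longrightarrow> par j < j"
    "\<And>e. e \<in> edges T \<Longrightarrow> \<exists>j<card (verts T). 0 < j \<and> e = {ts j, ts (par j)}"
proof -
  let ?n = "card (verts T)"
  have sT: "simple_graph T" and neT: "verts T \<noteq> {}"
    using T(1) by (auto simp: tree_def connected_graph_def)
  define P where "P = (\<lambda>n (ts :: nat \<Rightarrow> 'a) (par :: nat \<Rightarrow> nat).
      inj_on ts {..<n} \<and> ts ` {..<n} \<subseteq> verts T \<and> conn (adj T) (ts ` {..<n}) \<and>
      (\<forall>j. 0 < j \<longrightarrow> par j < j) \<and>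
      (\<forall>e\<in>edges T. e \<subseteq> ts ` {..<n} \<longrightarrow> (\<exists>j<n. 0 < j \<and> e = {ts j, ts (par j)})))"
  have ex: "\<exists>ts par. P (Suc k) ts par" if "Suc k \<le> ?n" for k
    using that
  proof (induction k)
    case 0
    obtain r where "r \<in> verts T" using neT by blast
    moreover have "\<not> e \<subseteq> {r}" if "e \<in> edges T" for e
      using sT that card_mono[of "{r}" e] by (auto simp: simple_graph_def)
    \<comment> \<open>The constant 0 satisfies \<open>par j < j\<close> for every positive
      \<open>j\<close>, also for indices beyond the tree, as the growing construction
      demands.\<close>
    ultimately have "P (Suc 0) (\<lambda>_. r) (\<lambda>_. 0)"
      by (auto simp: P_def conn_singleton lessThan_Suc)
    then show ?case by blast
  next
    case (Suc k)
    then obtain ts par where "P (Suc k) ts par" by auto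
    then have ts: "inj_on ts {..<Suc k}" "ts ` {..<Suc k} \<subseteq> verts T"
        "conn (adj T) (ts ` {..<Suc k})" "\<forall>j. 0 < j \<longrightarrow> par j < j"
        "\<forall>e\<in>edges T. e \<subseteq> ts ` {..<Suc k} \<longrightarrow> (\<exists>j<Suc k. 0 < j \<and> e = {ts j, ts (par j)})"
      unfolding P_def by simp_all
    let ?S = "ts ` {..<Suc k}"
    have "card ?S = Suc k" using ts(1) by (simp add: card_image)
    then have "?S \<noteq> verts T" using Suc.prems by auto
    then obtain w where w: "w \<in> verts T" "w \<notin> ?S" using ts(2) by blast
    have ts0: "(ts 0, w) \<in> (Restr (adj T) (verts T))\<^sup>*" "ts 0 \<in> ?S"
      using tree_conn[OF T(1)] w(1) ts(2) by (auto simp: conn_def)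
    obtain a v where av: "a \<in> ?S" "v \<notin> ?S" "(a, v) \<in> Restr (adj T) (verts T)"
      using rtrancl_crossing[OF ts0 w(2)] by (elim exE conjE)
    then obtain i where i: "i < Suc k" "a = ts i" by auto
    let ?ts = "ts(Suc k := v)" and ?par = "par(Suc k := i)"
    have im: "?ts ` {..<Suc (Suc k)} = insert v ?S"
      by (subst lessThan_Suc) auto
    have "card (?ts ` {..<Suc (Suc k)}) = Suc (Suc k)"
      unfolding im using av(2) \<open>card ?S = Suc k\<close> by (subst card_insert_disjoint) auto
    then have "inj_on ?ts {..<Suc (Suc k)}"
      by (intro eq_card_imp_inj_on) auto
    moreover have "conn (adj T) (insert v ?S)"
    proof -
      have "conn (adj T) (?S \<union> {a, v})"
        using av sym_adj by (intro conn_Un ts(3) conn_edge) auto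
      then show ?thesis using av(1) by (simp add: insert_absorb insert_commute)
    qed
    moreover have "\<forall>j. 0 < j \<longrightarrow> ?par j < j" using ts(4) i(1) by auto
    moreover have "\<exists>j<Suc (Suc k). 0 < j \<and> e = {?ts j, ?ts (?par j)}"
      if e: "e \<in> edges T" "e \<subseteq> insert v ?S" for e
    proof (cases "v \<in> e")
      case True
      have "card e = 2" using e(1) sT by (auto simp: simple_graph_def)
      then obtain b where b: "e = {b, v}" "b \<noteq> v"
        using True by (auto simp: card_2_iff)
      then have "b \<in> ?S" "(b, v) \<in> adj T" using e by (auto simp: adj_def)
      then have "b = a"
        using tree_unique_neighbour[OF T(1) ts(3,2) _ av(2) _ _ av(1)] av(3) by blast
      then have "e = {?ts (Suc k), ?ts (?par (Suc k))}" using b(1) i by auto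
      then show ?thesis by blast
    next
      case False
      then have "e \<subseteq> ?S" using e(2) by blast
      then obtain j where j: "j < Suc k" "0 < j" "e = {ts j, ts (par j)}" using ts(5) e(1) by blast
      moreover have "par j < j" using ts(4) j(2) by blast
      ultimately have "e = {?ts j, ?ts (?par j)}" by auto
      then show ?thesis using less_SucI[OF j(1)] j(2) by blast
    qed
    moreover have "insert v ?S \<subseteq> verts T" using ts(2) av(3) by blast
    ultimately have "P (Suc (Suc k)) ?ts ?par" unfolding P_def im by blast
    then show ?case by blast
  qed
  have "0 < ?n" using neT T(2) by (simp add: card_gt_0_iff)
  then obtain ts par where "P ?n ts par" using ex[of "?n - 1"] by auto
  then have ts: "inj_on ts {..<?n}" "ts ` {..<?n} \<subseteq> verts T"
        "\<forall>j. 0 < j \<longrightarrow> par j < j"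
        "\<forall>e\<in>edges T. e \<subseteq> ts ` {..<?n} \<longrightarrow> (\<exists>j<?n. 0 < j \<and> e = {ts j, ts (par j)})"
    unfolding P_def by simp_all
  have im: "ts ` {..<?n} = verts T"
    using ts(1,2) T(2) by (intro card_subset_eq) (auto simp: card_image)
  show ?thesis
  proof (rule that[of ts par])
    show "bij_betw ts {..<?n} (verts T)" using ts(1) im by (simp add: bij_betw_def)
    show "\<exists>j<?n. 0 < j \<and> e = {ts j, ts (par j)}" if "e \<in> edges T" for e
      using ts(4) that sT unfolding im by (auto simp: simple_graph_def)
  qed (use ts(3) in auto)
qed

text \<open>If \<open>V\<close> were not laid, the tree could be grown inside \<open>V\<close> in
  its enumeration order, and the minor would give a subdivision. The bound is the number of vertices
  of \<open>T\<close> because each branch set takes up one boundary vertex.\<close>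

lemma laid_if_no_subdivision:
  fixes T :: "nat ugraph" and G :: "'a ugraph"
  assumes G: "simple_graph G" and T: "tree T" "finite (verts T)" "max_degree T \<le> 3"
    and no: "\<not> (\<exists>H. is_subdivision H T \<and> contains G H)"
    and V: "finite V" "V \<subseteq> verts G" "r \<subseteq> adj G" "r \<subseteq> V \<times> V" "sym r"
  shows "V \<in> laid r (card (verts T))"
proof (rule ccontr)
  assume *: "V \<notin> laid r (card (verts T))"
  let ?n = "card (verts T)"
  obtain ts :: "nat \<Rightarrow> nat" and par where ts: "bij_betw ts {..<?n} (verts T)"
    and par: "\<And>j. 0 < j \<Longrightarrow> par j < j"
    and E: "\<And>e. e \<in> edges T \<Longrightarrow> \<exists>j<?n. 0 < j \<and> e = {ts j, ts (par j)}"
    using tree_enumeration[OF T(1,2)] by metis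
  obtain U where U: "\<And>j. j < ?n \<Longrightarrow> conn r (U j) \<and> U j \<subseteq> V" and Ud: "disjoint_family_on U {..<?n}"
    and Ue: "\<And>j. j < ?n \<Longrightarrow> 0 < j \<Longrightarrow> \<exists>x\<in>U (par j). \<exists>y\<in>U j. (x, y) \<in> r"
    using not_laid_tree_minor[OF V(1,4,5) * par] by metis
  define g where "g = inv_into {..<?n} ts"
  have g: "g t < ?n" "ts (g t) = t" if "t \<in> verts T" for t
    using ts that inv_into_into[of t ts "{..<?n}"] f_inv_into_f[of t ts "{..<?n}"]
    by (auto simp: g_def bij_betw_def)
  have gts: "g (ts j) = j" if "j < ?n" for j
    using ts that by (simp add: g_def bij_betw_def)
  have sT: "simple_graph T" using T(1) by (simp add: tree_def)
  have "\<exists>H. is_subdivision H T \<and> contains G H"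
  proof (rule subdivision_from_minor[OF G sT T(2), where U = "\<lambda>t. U (g t)"])
    fix t assume t: "t \<in> verts T"
    have "degree T t \<le> 3" using T(3) t unfolding max_degree_def by (meson SUP_upper order_trans)
    then have "ecard (neighbours T t) \<le> 3" by (simp add: degree_def)
    then show "card (neighbours T t) \<le> 3"
      by (auto simp: ecard_def numeral_eq_enat split: if_splits)
    show "conn (adj G) (U (g t)) \<and> U (g t) \<subseteq> verts G"
      using U[OF g(1)[OF t]] conn_mono_rel[OF _ V(3)] V(2) by auto
  next
    show "disjoint_family_on (\<lambda>t. U (g t)) (verts T)"
      unfolding disjoint_family_on_def
    proof (intro ballI impI)
      fix s t assume "s \<in> verts T" "t \<in> verts T" "s \<noteq> t"
      then have "g s \<noteq> g t" "g s \<in> {..<?n}" "g t \<in> {..<?n}" using g by auto metis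
      then show "U (g s) \<inter> U (g t) = {}" using Ud unfolding disjoint_family_on_def by blast
    qed
  next
    fix s t assume "{s, t} \<in> edges T"
    then obtain j where j: "j < ?n" "0 < j" "{s, t} = {ts j, ts (par j)}" using E by blast
    have pj: "par j < ?n" using par[OF j(2)] j(1) by simp
    obtain x y where xy: "x \<in> U (par j)" "y \<in> U j" "(x, y) \<in> r" "(y, x) \<in> r"
      using Ue[OF j(1,2)] V(5) by (meson symD)
    have "(x, y) \<in> adj G" "(y, x) \<in> adj G" using xy V(3) by blast+
    moreover have "(s = ts j \<and> t = ts (par j)) \<or> (s = ts (par j) \<and> t = ts j)"
      using j(3) by (auto simp: doubleton_eq_iff)
    then have "(g s = j \<and> g t = par j) \<or> (g s = par j \<and> g t = j)"
      using gts[OF j(1)] gts[OF pj] by auto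
    ultimately show "\<exists>a\<in>U (g s). \<exists>b\<in>U (g t). (a, b) \<in> adj G"
      using xy(1,2) by metis
  qed
  then show False using no by contradiction
qed

section \<open>Rays in locally finite relations\<close>

definition is_ray :: "'a rel \<Rightarrow> (nat \<Rightarrow> 'a) \<Rightarrow> bool" where
  "is_ray r f \<longleftrightarrow> inj f \<and> (\<forall>n. (f n, f (Suc n)) \<in> r)"

text \<open>The step after the last visit to \<open>v\<close> starts a walk that avoids
  \<open>v\<close>.\<close>

lemma rtrancl_first_step:
  assumes "(v, y) \<in> (Restr r A)\<^sup>*" "y \<noteq> v"
  shows "\<exists>w\<in>A - {v}. (v, w) \<in> r \<and> (w, y) \<in> (Restr r (A - {v}))\<^sup>*"
  using assms
proof (induction rule: rtrancl_induct)
  case (step y z)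
  show ?case
  proof (cases "y = v")
    case True
    then show ?thesis using step by auto
  next
    case False
    then obtain w where "w \<in> A - {v}" "(v, w) \<in> r" "(w, y) \<in> (Restr r (A - {v}))\<^sup>*"
      using step.IH by blast
    moreover have "(y, z) \<in> Restr r (A - {v})" using step False by auto
    ultimately show ?thesis by (meson rtrancl.rtrancl_into_rtrancl)
  qed
qed simp

text \<open>After removal of the current vertex, one of its finitely many neighbours still reaches
  infinitely many vertices. Removed vertices are never visited again, which makes the sequence
  injective.\<close>

lemma koenig:
  assumes lf: "\<And>x. finite (r `` {x})" and x: "x \<in> J" "infinite {y. (x, y) \<in> (Restr r J)\<^sup>*}"
  obtains f where "is_ray r f" "range f \<subseteq> J"
proof -
  \<comment> \<open>A state consists of the set of vertices still allowed and the current vertex;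
    the stage number is only an argument of the choice principle.\<close>
  let ?P = "\<lambda>(n::nat) (A, v). v \<in> A \<and> A \<subseteq> J \<and> infinite {y. (v, y) \<in> (Restr r A)\<^sup>*}"
  let ?Q = "\<lambda>(n::nat) (A, v) (A', v'). A' = A - {v} \<and> (v, v') \<in> r"
  have ex: "\<exists>s'. ?P (Suc n) s' \<and> ?Q n s s'" if "?P n s" for n s
  proof -
    obtain A v where s: "s = (A, v)" by (cases s)
    have A: "v \<in> A" "A \<subseteq> J" "infinite {y. (v, y) \<in> (Restr r A)\<^sup>*}" using that s by auto
    have "{y. (v, y) \<in> (Restr r A)\<^sup>*} \<subseteq>
        insert v (\<Union>w\<in>r `` {v} \<inter> (A - {v}). {y. (w, y) \<in> (Restr r (A - {v}))\<^sup>*})"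
      using rtrancl_first_step[of v _ r A] by blast
    then have "infinite (\<Union>w\<in>r `` {v} \<inter> (A - {v}). {y. (w, y) \<in> (Restr r (A - {v}))\<^sup>*})"
      using A(3) by (meson finite_insert finite_subset)
    then obtain w where w: "w \<in> r `` {v} \<inter> (A - {v})" "infinite {y. (w, y) \<in> (Restr r (A - {v}))\<^sup>*}"
      using lf[of v] by (meson finite_Int finite_UN_I)
    then show ?thesis using A(2) s by (intro exI[of _ "(A - {v}, w)"]) auto
  qed
  have "\<exists>S. ?P 0 S" using x by (intro exI[of _ "(J, x)"]) auto
  then have "\<exists>S. \<forall>n. ?P n (S n) \<and> ?Q n (S n) (S (Suc n))"
    using ex by (rule dependent_nat_choice)
  then obtain S where S: "\<forall>n. ?P n (S n) \<and> ?Q n (S n) (S (Suc n))" ..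
  define A where "A = (\<lambda>n. fst (S n))"
  define f where "f = (\<lambda>n. snd (S n))"
  have f: "f n \<in> A n" "A n \<subseteq> J" "A (Suc n) = A n - {f n}" "(f n, f (Suc n)) \<in> r" for n
    using S[rule_format, of n] by (auto simp: A_def f_def split: prod.splits)
  have "f (n + Suc k) \<in> A n - {f n}" for n k
  proof -
    have "A (n + Suc k) \<subseteq> A (Suc n)"
      by (induction k) (auto simp: f(3))
    then show ?thesis using f(1)[of "n + Suc k"] f(3)[of n] by auto
  qed
  then have "f m \<noteq> f n" if "n < m" for m n
    using that less_imp_Suc_add[OF that] by fastforce
  then have "inj f" by (intro linorder_injI) metis
  moreover have "range f \<subseteq> J" using f(1,2) by blast
  ultimately show ?thesis using that f(4) by (auto simp: is_ray_def)
qed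

section \<open>Limits of linear orders\<close>

definition down :: "'a set \<Rightarrow> ('a \<Rightarrow> 'a \<Rightarrow> bool) \<Rightarrow> 'a set \<Rightarrow> bool" where
  "down V lt D \<longleftrightarrow> D \<subseteq> V \<and> (\<forall>x\<in>D. \<forall>y\<in>V. lt y x \<longrightarrow> y \<in> D)"

text \<open>One question splits a sequence into two parts, at least one of them infinite;
  diagonalising settles countably many questions, each up to finitely many exceptions.\<close>

lemma diagonal_decided:
  fixes Q :: "nat \<Rightarrow> nat \<Rightarrow> bool"
  obtains d :: "nat \<Rightarrow> nat" where "strict_mono d"
    "\<And>k. eventually (\<lambda>n. Q k (d n)) sequentially \<or> eventually (\<lambda>n. \<not> Q k (d n)) sequentially"
proof -
  define P where "P = (\<lambda>k (s :: nat \<Rightarrow> nat). (\<forall>n. Q k (s n)) \<or> (\<forall>n. \<not> Q k (s n)))"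
  interpret subseqs P
  proof
    fix k and s :: "nat \<Rightarrow> nat"
    assume "strict_mono s"
    have "infinite {n. Q k (s n)} \<or> infinite {n. \<not> Q k (s n)}"
      by (metis (mono_tags) finite_Collect_not infinite_UNIV_nat)
    then show "\<exists>s'. strict_mono s' \<and> P k (s \<circ> s')"
      by (metis (mono_tags, lifting) P_def comp_apply infinite_enumerate mem_Collect_eq)
  qed
  have "eventually (\<lambda>n. Q k (diagseq n)) sequentially \<or> eventually (\<lambda>n. \<not> Q k (diagseq n)) sequentially" for k
  proof -
    have "P k (diagseq \<circ> ((+) (Suc k)))"
      by (rule diagseq_holds) (auto simp: P_def)
    then have "(\<forall>n. Q k (diagseq (Suc k + n))) \<or> (\<forall>n. \<not> Q k (diagseq (Suc k + n)))"
      by (simp add: P_def)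
    then show ?thesis
      unfolding eventually_sequentially by (metis le_iff_add)
  qed
  then show ?thesis using that subseq_diagseq by blast
qed

text \<open>\<open>lt\<close> is what the numberings of larger and larger finite sets eventually
  agree on along a subsequence. If an initial segment had more than \<open>N\<close> boundary
  vertices, \<open>N + 1\<close> of them with outer neighbours would already show up as boundary
  vertices in one finite numbering.\<close>

lemma limit_order:
  assumes "countable V" "r \<subseteq> V \<times> V"
    and lay: "\<And>W. finite W \<Longrightarrow> W \<subseteq> V \<Longrightarrow>
      \<exists>p :: 'a \<Rightarrow> nat. inj_on p W \<and> (\<forall>m. card (bd (Restr r W) {v \<in> W. p v < m}) \<le> N)"
  obtains lt where
    "\<And>x. \<not> lt x x" "\<And>x y z. lt x y \<Longrightarrow> lt y z \<Longrightarrow> lt x z"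
    "\<And>x y. x \<in> V \<Longrightarrow> y \<in> V \<Longrightarrow> x \<noteq> y \<Longrightarrow> lt x y \<or> lt y x"
    "\<And>D. down V lt D \<Longrightarrow> finite (bd r D) \<and> card (bd r D) \<le> N"
proof -
  obtain e :: "'a \<Rightarrow> nat" where e: "inj_on e V" using assms(1) by (auto simp: countable_def)
  define W where "W = (\<lambda>n. {v \<in> V. e v < n})"
  have W: "finite (W n)" "W n \<subseteq> V" for n
  proof -
    have "e ` W n \<subseteq> {..<n}" "inj_on e (W n)"
      using e by (auto simp: W_def inj_on_def)
    then show "finite (W n)" by (meson finite_imageD finite_lessThan finite_subset)
  qed (auto simp: W_def)
  have "\<forall>n. \<exists>p :: 'a \<Rightarrow> nat. inj_on p (W n) \<and> (\<forall>m. card (bd (Restr r (W n)) {v \<in> W n. p v < m}) \<le> N)"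
    using lay W by simp
  then obtain p :: "nat \<Rightarrow> 'a \<Rightarrow> nat" where p: "\<And>n. inj_on (p n) (W n)"
      "\<And>n m. card (bd (Restr r (W n)) {v \<in> W n. p n v < m}) \<le> N"
    by metis
  define g where "g = from_nat_into V"
  obtain d :: "nat \<Rightarrow> nat" where d: "strict_mono d" and
    dd: "\<And>k. eventually (\<lambda>n. p (d n) (g (fst (prod_decode k))) < p (d n) (g (snd (prod_decode k)))) sequentially \<or>
       eventually (\<lambda>n. \<not> p (d n) (g (fst (prod_decode k))) < p (d n) (g (snd (prod_decode k)))) sequentially"
    using diagonal_decided[of "\<lambda>k n. p n (g (fst (prod_decode k))) < p n (g (snd (prod_decode k)))"] by blast
  define lt where "lt = (\<lambda>x y. eventually (\<lambda>n. p (d n) x < p (d n) y) sequentially)"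
  have decided: "lt x y \<or> eventually (\<lambda>n. \<not> p (d n) x < p (d n) y) sequentially" if xy: "x \<in> V" "y \<in> V" for x y
  proof -
    obtain i j where "g i = x" "g j = y"
      using xy from_nat_into_surj[OF assms(1)] by (metis g_def)
    then show ?thesis using dd[of "prod_encode (i, j)"] by (simp add: lt_def)
  qed
  have ev_in: "eventually (\<lambda>n. x \<in> W (d n)) sequentially" if "x \<in> V" for x
  proof (rule eventually_sequentiallyI)
    fix n assume "Suc (e x) \<le> n"
    then have "e x < d n" using seq_suble[OF d, of n] by linarith
    then show "x \<in> W (d n)" using that by (simp add: W_def)
  qed
  have irr: "\<not> lt x x" for x by (simp add: lt_def)
  have tr: "lt x z" if "lt x y" "lt y z" for x y z
    using that unfolding lt_def by eventually_elim simp
  have tot: "lt x y \<or> lt y x" if xy: "x \<in> V" "y \<in> V" "x \<noteq> y" for x y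
  proof (rule disjCI)
    assume "\<not> lt y x"
    then have "eventually (\<lambda>n. \<not> p (d n) y < p (d n) x) sequentially" using decided[OF xy(2,1)] by blast
    then show "lt x y"
      unfolding lt_def using ev_in[OF xy(1)] ev_in[OF xy(2)]
    proof eventually_elim
      case (elim n)
      then have "p (d n) x \<noteq> p (d n) y" using p(1)[of "d n"] xy(3) by (auto dest: inj_onD)
      then show ?case using elim by simp
    qed
  qed
  \<comment> \<open>\<open>D\<close> may be infinite, so its boundary is tested on finite subsets
    \<open>X\<close>.\<close>
  have bound: "card X \<le> N" if D: "down V lt D" and X: "X \<subseteq> bd r D" "finite X" for D X
  proof -
    have "\<forall>x\<in>X. \<exists>y. y \<notin> D \<and> (x, y) \<in> r" using X(1) by (auto simp: bd_def)
    then obtain y where y: "\<And>x. x \<in> X \<Longrightarrow> y x \<notin> D \<and> (x, y x) \<in> r" by metis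
    have XD: "x \<in> D" if "x \<in> X" for x using X(1) that bdD by fast
    have inV: "x \<in> V" "y x \<in> V" if "x \<in> X" for x using y[OF that] assms(2) by auto
    \<comment> \<open>Every vertex of \<open>X\<close> precedes every chosen outer neighbour, not
      just its own; hence a single threshold \<open>m\<close> can separate them all.\<close>
    have "lt x (y x')" if "x \<in> X" "x' \<in> X" for x x'
    proof -
      have "x \<noteq> y x'" "\<not> lt (y x') x"
        using XD[OF that(1)] y[OF that(2)] inV(2)[OF that(2)] D by (auto simp: down_def)
      then show ?thesis using tot inV that by blast
    qed
    then have "eventually (\<lambda>n. \<forall>x\<in>X. \<forall>x'\<in>X. p (d n) x < p (d n) (y x')) sequentially"
      using X(2) by (simp add: eventually_ball_finite_distrib lt_def)
    moreover have "eventually (\<lambda>n. \<forall>x\<in>X. x \<in> W (d n) \<and> y x \<in> W (d n)) sequentially"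
      using X(2) ev_in inV by (simp add: eventually_ball_finite_distrib eventually_conj_iff)
    ultimately have "eventually (\<lambda>n. (\<forall>x\<in>X. \<forall>x'\<in>X. p (d n) x < p (d n) (y x')) \<and>
        (\<forall>x\<in>X. x \<in> W (d n) \<and> y x \<in> W (d n))) sequentially"
      by (rule eventually_conj)
    then have "\<exists>n. (\<forall>x\<in>X. \<forall>x'\<in>X. p (d n) x < p (d n) (y x')) \<and>
        (\<forall>x\<in>X. x \<in> W (d n) \<and> y x \<in> W (d n))"
      by (rule eventually_happens'[OF sequentially_bot])
    then obtain n where "(\<forall>x\<in>X. \<forall>x'\<in>X. p (d n) x < p (d n) (y x')) \<and>
        (\<forall>x\<in>X. x \<in> W (d n) \<and> y x \<in> W (d n))" ..
    then have n: "\<And>x x'. x \<in> X \<Longrightarrow> x' \<in> X \<Longrightarrow> p (d n) x < p (d n) (y x')"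
        "\<And>x. x \<in> X \<Longrightarrow> x \<in> W (d n) \<and> y x \<in> W (d n)"
      by simp_all
    show ?thesis
    proof (cases "X = {}")
      case False
      define m where "m = Suc (Max (p (d n) ` X))"
      have lo: "p (d n) x < m" if "x \<in> X" for x
        using X(2) that by (simp add: m_def less_Suc_eq_le)
      have hi: "m \<le> p (d n) (y x)" if "x \<in> X" for x
        using X(2) False n(1) that by (auto simp: m_def Suc_le_eq)
      have "X \<subseteq> bd (Restr r (W (d n))) {v \<in> W (d n). p (d n) v < m}"
      proof
        fix x assume x: "x \<in> X"
        show "x \<in> bd (Restr r (W (d n))) {v \<in> W (d n). p (d n) v < m}"
          by (rule bdI[of _ _ "y x"]) (use x lo[OF x] hi[OF x] n(2)[OF x] y[OF x] in auto)
      qed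
      then have "card X \<le> card (bd (Restr r (W (d n))) {v \<in> W (d n). p (d n) v < m})"
        by (rule card_mono[rotated]) (use W(1) in \<open>simp add: finite_bd\<close>)
      then show ?thesis using p(2) order_trans by blast
    qed simp
  qed
  show ?thesis
  proof (rule that[of lt])
    show "finite (bd r D) \<and> card (bd r D) \<le> N" if "down V lt D" for D
      using bound[OF that] by (intro finite_if_finite_subsets_card_bdd) auto
  qed (fact irr tr tot)+
qed

section \<open>Exhaustions with bounded boundary\<close>

text \<open>The sets \<open>A\<close> are not confined to \<open>J\<close>: for an interval they
  also take in the boundary of the segment below it.\<close>

definition nice :: "'a rel \<Rightarrow> nat \<Rightarrow> 'a set \<Rightarrow> bool" where
  "nice r c J \<longleftrightarrow> (\<forall>F. finite F \<longrightarrow> F \<subseteq> J \<longrightarrow> (\<exists>A. finite A \<and> F \<subseteq> A \<and> card (bd r A) \<le> c))"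

definition has_ray :: "'a rel \<Rightarrow> 'a set \<Rightarrow> bool" where
  "has_ray r J \<longleftrightarrow> (\<exists>f. is_ray r f \<and> range f \<subseteq> J)"

lemma card_bd_Un: "finite A \<Longrightarrow> finite B \<Longrightarrow> card (bd r (A \<union> B)) \<le> card (bd r A) + card (bd r B)"
proof -
  assume fin: "finite A" "finite B"
  have "card (bd r (A \<union> B)) \<le> card (bd r A \<union> bd r B)"
    using fin by (intro card_mono) (auto simp: finite_bd, auto simp: bd_def)
  then show ?thesis using card_Un_le order_trans by blast
qed

lemma nice_Un:
  assumes "nice r c J" "nice r c' J'"
  shows "nice r (c + c') (J \<union> J')"
  unfolding nice_def
proof (intro allI impI)
  fix F assume F: "finite F" "F \<subseteq> J \<union> J'"
  have "\<exists>A. finite A \<and> F \<inter> J \<subseteq> A \<and> card (bd r A) \<le> c"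
    using assms(1)[unfolded nice_def, rule_format, of "F \<inter> J"] F(1) by simp
  then obtain A where A: "finite A \<and> F \<inter> J \<subseteq> A \<and> card (bd r A) \<le> c" ..
  have "\<exists>B. finite B \<and> F \<inter> J' \<subseteq> B \<and> card (bd r B) \<le> c'"
    using assms(2)[unfolded nice_def, rule_format, of "F \<inter> J'"] F(1) by simp
  then obtain B where B: "finite B \<and> F \<inter> J' \<subseteq> B \<and> card (bd r B) \<le> c'" ..
  show "\<exists>A. finite A \<and> F \<subseteq> A \<and> card (bd r A) \<le> c + c'"
  proof (intro exI conjI)
    show "finite (A \<union> B)" using A B by simp
    show "F \<subseteq> A \<union> B" using A B F(2) by blast
    show "card (bd r (A \<union> B)) \<le> c + c'" using card_bd_Un[of A B r] A B by linarith
  qed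
qed

text \<open>A general transitive relation allows use with \<open>lt\<close> for a greatest vertex
  and with its converse for a least one.\<close>

lemma finite_has_last:
  assumes "finite F" "F \<noteq> {}" and tr: "\<And>x y z. R x y \<Longrightarrow> R y z \<Longrightarrow> R x z"
    and tot: "\<And>x y. x \<in> F \<Longrightarrow> y \<in> F \<Longrightarrow> x \<noteq> y \<Longrightarrow> R x y \<or> R y x"
  shows "\<exists>m\<in>F. \<forall>u\<in>F. u = m \<or> R u m"
  using assms(1,2) tot
proof (induction F rule: finite_ne_induct)
  case (insert x F)
  then obtain m where m: "m \<in> F" "\<forall>u\<in>F. u = m \<or> R u m" by auto
  show ?case
  proof (cases "R x m")
    case True
    then show ?thesis using m by auto
  next
    case False
    then have "R m x" using insert.prems[of m x] m(1) insert.hyps by auto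
    then have "R u x" if "u \<in> F" for u using m(2) that tr[of u m x] by auto
    then show ?thesis by auto
  qed
qed auto

section \<open>Intervals of the limit order that resist exhaustion\<close>

context
  fixes V :: "'a set" and r :: "'a rel" and lt :: "'a \<Rightarrow> 'a \<Rightarrow> bool" and N :: nat
  assumes rV: "r \<subseteq> V \<times> V" and sym: "sym r" and lf: "\<And>x. finite (r `` {x})"
    and irr: "\<And>x. \<not> lt x x" and tr: "\<And>x y z. lt x y \<Longrightarrow> lt y z \<Longrightarrow> lt x z"
    and tot: "\<And>x y. x \<in> V \<Longrightarrow> y \<in> V \<Longrightarrow> x \<noteq> y \<Longrightarrow> lt x y \<or> lt y x"
    and bound: "\<And>D. down V lt D \<Longrightarrow> finite (bd r D) \<and> card (bd r D) \<le> N"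
begin

text \<open>Without a ray, the components of an interval are finite, so that the components
  that meet a finite set can be cut off at the two ends of the interval.\<close>

lemma nice_interval:
  assumes D: "down V lt D1" "down V lt D2" "D1 \<subseteq> D2" and light: "\<not> has_ray r (D2 - D1)"
  shows "nice r (2 * N) (D2 - D1)"
  unfolding nice_def
proof (intro allI impI)
  let ?J = "D2 - D1"
  fix F assume F: "finite F" "F \<subseteq> ?J"
  let ?C = "\<lambda>x. {y. (x, y) \<in> (Restr r ?J)\<^sup>*}"
  have finC: "finite (?C x)" if xJ: "x \<in> ?J" for x
  proof (rule ccontr)
    assume "infinite (?C x)"
    then obtain f where "is_ray r f" "range f \<subseteq> ?J" using koenig[OF lf xJ] by metis
    then show False using light by (auto simp: has_ray_def)
  qed
  have CJ: "?C x \<subseteq> ?J" if "x \<in> ?J" for x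
  proof
    fix y assume "y \<in> ?C x"
    then have "(x, y) \<in> (Restr r ?J)\<^sup>*" by simp
    then show "y \<in> ?J" using that by (induction rule: rtrancl_induct) auto
  qed
  define A0 where "A0 = (\<Union>x\<in>F. ?C x)"
  \<comment> \<open>Edges from \<open>A0\<close> down into \<open>D1\<close> could turn unboundedly
    many vertices of \<open>A0\<close> into boundary vertices. Their lower ends lie in
    \<open>bd r D1\<close>, and adding this set makes those edges internal.\<close>
  define A where "A = A0 \<union> bd r D1"
  have A0J: "A0 \<subseteq> ?J" unfolding A0_def using CJ F(2) by blast
  have "finite A" unfolding A_def A0_def using F finC bound[OF D(1)] by auto
  moreover have "F \<subseteq> A" by (auto simp: A_def A0_def)
  moreover have "card (bd r A) \<le> 2 * N"
  proof -
    \<comment> \<open>An edge that leaves \<open>A\<close> from \<open>A0\<close> cannot end in the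
      interval, as \<open>A0\<close> is closed under reachability there, nor in \<open>D1\<close>;
      so it leaves \<open>D2\<close>.\<close>
    have "bd r A \<subseteq> bd r D1 \<union> bd r D2"
    proof
      fix x assume x: "x \<in> bd r A"
      then obtain y where y: "x \<in> A" "y \<notin> A" "(x, y) \<in> r" by (auto simp: bd_def)
      show "x \<in> bd r D1 \<union> bd r D2"
      proof (cases "x \<in> bd r D1")
        case False
        then have xA: "x \<in> A0" using y(1) by (simp add: A_def)
        then have xJ: "x \<in> ?J" using A0J by blast
        have "y \<notin> ?J"
        proof
          assume "y \<in> ?J"
          then have "(x, y) \<in> Restr r ?J" using xJ y(3) by blast
          then have "y \<in> A0" using xA unfolding A0_def by (auto intro: rtrancl_into_rtrancl)
          then show False using y(2) by (simp add: A_def)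
        qed
        moreover have "y \<notin> D1"
        proof
          assume "y \<in> D1"
          then have "y \<in> bd r D1" using xJ symD[OF sym y(3)] by (auto intro: bdI)
          then show False using y(2) by (simp add: A_def)
        qed
        ultimately have "y \<notin> D2" by blast
        then show ?thesis using xJ y(3) by (auto intro: bdI)
      qed simp
    qed
    then have "card (bd r A) \<le> card (bd r D1 \<union> bd r D2)"
      using bound[OF D(1)] bound[OF D(2)] by (intro card_mono) auto
    also have "\<dots> \<le> card (bd r D1) + card (bd r D2)" by (rule card_Un_le)
    finally show ?thesis using bound[OF D(1)] bound[OF D(2)] by linarith
  qed
  ultimately show "\<exists>A. finite A \<and> F \<subseteq> A \<and> card (bd r A) \<le> 2 * N" by blast
qed

lemma down_below:
  assumes D: "down V lt D1" "down V lt D2"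
  shows "down V lt (D1 \<union> {u \<in> D2. \<not> lt v u})"
  unfolding down_def
proof (intro conjI ballI impI)
  show "D1 \<union> {u \<in> D2. \<not> lt v u} \<subseteq> V" using D by (auto simp: down_def)
  fix x y assume x: "x \<in> D1 \<union> {u \<in> D2. \<not> lt v u}" "y \<in> V" "lt y x"
  show "y \<in> D1 \<union> {u \<in> D2. \<not> lt v u}"
  proof (cases "x \<in> D1")
    case True
    then show ?thesis using D(1) x(2,3) by (auto simp: down_def)
  next
    case False
    then have "x \<in> D2" "\<not> lt v x" using x(1) by auto
    then show ?thesis using D(2) x(2,3) tr[of v y x] by (auto simp: down_def)
  qed
qed

text \<open>Suppose that no cut works. If both sides of a cut have rays, neither side is bad, and
  then their union is not bad either; so every cut has a side without a ray. A finite set thus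
  consists of vertices with no ray in the part up to them and vertices with no ray above them. Each
  kind, apart from one vertex, lies in a single rayless interval, so the whole interval is not bad
  after all.\<close>

lemma bad_interval_split:
  assumes D: "down V lt D1" "down V lt D2" "D1 \<subseteq> D2" and bad: "\<And>c. \<not> nice r c (D2 - D1)"
  shows "\<exists>E. down V lt E \<and> D1 \<subseteq> E \<and> E \<subseteq> D2 \<and>
    ((\<forall>c. \<not> nice r c (E - D1)) \<and> has_ray r (D2 - E) \<or> (\<forall>c. \<not> nice r c (D2 - E)) \<and> has_ray r (E - D1))"
proof (rule ccontr)
  assume contr: "\<not> ?thesis"
  define E where "E = (\<lambda>v. D1 \<union> {u \<in> D2. \<not> lt v u})"
  have E: "down V lt (E v)" "D1 \<subseteq> E v" "E v \<subseteq> D2" for v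
    using down_below[OF D(1,2)] D(3) by (auto simp: E_def)
  have D2V: "D2 \<subseteq> V" using D(2) by (simp add: down_def)
  have cases: "\<not> has_ray r (E v - D1) \<or> \<not> has_ray r (D2 - E v)" for v
  proof (rule ccontr)
    assume "\<not> ?thesis"
    then have rays: "has_ray r (E v - D1)" "has_ray r (D2 - E v)" by auto
    then have "\<not> (\<forall>c. \<not> nice r c (E v - D1))" "\<not> (\<forall>c. \<not> nice r c (D2 - E v))"
      using contr E[of v] by blast+
    then obtain c c' where "nice r c (E v - D1)" "nice r c' (D2 - E v)" by blast
    then have "nice r (c + c') ((E v - D1) \<union> (D2 - E v))" by (rule nice_Un)
    moreover have "(E v - D1) \<union> (D2 - E v) = D2 - D1" using E(2,3)[of v] by blast
    ultimately show False using bad by simp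
  qed
  \<comment> \<open>The constant is \<open>2 * N\<close> for the vertices with a rayless lower side,
    \<open>2 * N\<close> for those with a rayless upper side, and 1 for the least of the
    latter.\<close>
  have "nice r (4 * N + 1) (D2 - D1)"
    unfolding nice_def
  proof (intro allI impI)
    fix F assume F: "finite F" "F \<subseteq> D2 - D1"
    let ?F1 = "{v \<in> F. \<not> has_ray r (E v - D1)}"
    let ?F2 = "{v \<in> F. \<not> has_ray r (D2 - E v)}"
    have FV: "F \<subseteq> V" using F(2) D2V by blast
    have "\<exists>A. finite A \<and> ?F1 \<subseteq> A \<and> card (bd r A) \<le> 2 * N"
    proof (cases "?F1 = {}")
      case True
      then show ?thesis by (intro exI[of _ "{}"]) (auto simp: bd_def)
    next
      case False
      have "\<exists>m\<in>?F1. \<forall>u\<in>?F1. u = m \<or> lt u m"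
      proof (rule finite_has_last)
        show "lt x z" if "lt x y" "lt y z" for x y z by (rule tr[OF that])
        show "lt x y \<or> lt y x" if "x \<in> ?F1" "y \<in> ?F1" "x \<noteq> y" for x y
          using that FV by (intro tot) auto
      qed (use F(1) False in auto)
      then obtain m where m: "m \<in> ?F1" "\<forall>u\<in>?F1. u = m \<or> lt u m" by (elim bexE)
      have "?F1 \<subseteq> E m - D1"
      proof
        fix u assume u: "u \<in> ?F1"
        then have "\<not> lt m u" using m(2) irr tr[of m u m] by auto
        then show "u \<in> E m - D1" using u F(2) by (auto simp: E_def)
      qed
      moreover have "nice r (2 * N) (E m - D1)"
        using nice_interval[OF D(1) E(1,2)] m(1) by simp
      ultimately show ?thesis using F(1) unfolding nice_def by simp
    qed
    then obtain A1 where A1: "finite A1 \<and> ?F1 \<subseteq> A1 \<and> card (bd r A1) \<le> 2 * N" ..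
    have "\<exists>A. finite A \<and> ?F2 \<subseteq> A \<and> card (bd r A) \<le> 2 * N + 1"
    proof (cases "?F2 = {}")
      case True
      then show ?thesis by (intro exI[of _ "{}"]) (auto simp: bd_def)
    next
      case False
      have "\<exists>m\<in>?F2. \<forall>u\<in>?F2. u = m \<or> lt m u"
      proof (rule finite_has_last)
        show "lt z x" if "lt y x" "lt z y" for x y z by (rule tr[OF that(2,1)])
        show "lt y x \<or> lt x y" if "x \<in> ?F2" "y \<in> ?F2" "x \<noteq> y" for x y
          using that FV by (intro tot) auto
      qed (use F(1) False in auto)
      then obtain m where m: "m \<in> ?F2" "\<forall>u\<in>?F2. u = m \<or> lt m u" by (elim bexE)
      \<comment> \<open>The cut at \<open>m\<close> leaves \<open>m\<close> itself on the lower
        side, so it is added afterwards as a single vertex.\<close>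
      have sub: "?F2 - {m} \<subseteq> D2 - E m"
        using m F(2) by (auto simp: E_def)
      have "nice r (2 * N) (D2 - E m)"
        using nice_interval[OF E(1) D(2) E(3)] m(1) by simp
      then have "\<exists>A. finite A \<and> ?F2 - {m} \<subseteq> A \<and> card (bd r A) \<le> 2 * N"
        using F(1) sub unfolding nice_def by simp
      then obtain A where A: "finite A \<and> ?F2 - {m} \<subseteq> A \<and> card (bd r A) \<le> 2 * N" ..
      have "card (bd r {m}) \<le> card {m}" by (intro card_mono) (auto simp: bd_def)
      then have "card (bd r ({m} \<union> A)) \<le> 2 * N + 1"
        using card_bd_Un[of "{m}" A r] A by auto
      then show ?thesis using A by (intro exI[of _ "{m} \<union> A"]) auto
    qed
    then obtain A2 where A2: "finite A2 \<and> ?F2 \<subseteq> A2 \<and> card (bd r A2) \<le> 2 * N + 1" ..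
    have "F \<subseteq> ?F1 \<union> ?F2" using cases by blast
    then have "F \<subseteq> A1 \<union> A2" using A1 A2 by blast
    moreover have "card (bd r (A1 \<union> A2)) \<le> 4 * N + 1"
      using card_bd_Un[of A1 A2 r] A1 A2 by linarith
    ultimately show "\<exists>A. finite A \<and> F \<subseteq> A \<and> card (bd r A) \<le> 4 * N + 1"
      using A1 A2 by (intro exI[of _ "A1 \<union> A2"]) simp
  qed
  then show False using bad by blast
qed

text \<open>If \<open>V\<close> were bad, it could be split forever, with one side bad again and the
  other supplying a ray. The parts cut off at different stages are disjoint, and so are the
  rays.\<close>

lemma nice_if_few_rays:
  assumes few: "\<And>f :: nat \<Rightarrow> nat \<Rightarrow> 'a. (\<And>i. is_ray r (f i)) \<Longrightarrow> disjoint_family (\<lambda>i. range (f i)) \<Longrightarrow> False"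
  shows "\<exists>c. nice r c V"
proof (rule ccontr)
  assume bad: "\<not> ?thesis"
  let ?P = "\<lambda>(n::nat) (D1, D2). down V lt D1 \<and> down V lt D2 \<and> D1 \<subseteq> D2 \<and> (\<forall>c. \<not> nice r c (D2 - D1))"
  let ?Q = "\<lambda>(n::nat) (D1, D2) (D1', D2'). D1 \<subseteq> D1' \<and> D2' \<subseteq> D2 \<and> has_ray r ((D2 - D1) - (D2' - D1'))"
  have mono: "has_ray r K" if "has_ray r J" "J \<subseteq> K" for J K
    using that by (auto simp: has_ray_def)
  have ex: "\<exists>s'. ?P (Suc n) s' \<and> ?Q n s s'" if "?P n s" for n s
  proof -
    obtain D1 D2 where s: "s = (D1, D2)" by (cases s)
    have D: "down V lt D1" "down V lt D2" "D1 \<subseteq> D2" "\<And>c. \<not> nice r c (D2 - D1)" using that s by auto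
    obtain E where E: "down V lt E" "D1 \<subseteq> E" "E \<subseteq> D2" and
      "(\<forall>c. \<not> nice r c (E - D1)) \<and> has_ray r (D2 - E) \<or> (\<forall>c. \<not> nice r c (D2 - E)) \<and> has_ray r (E - D1)"
      using bad_interval_split[OF D] by (elim exE conjE)
    then consider "\<forall>c. \<not> nice r c (E - D1)" "has_ray r (D2 - E)" | "\<forall>c. \<not> nice r c (D2 - E)" "has_ray r (E - D1)"
      by blast
    then show ?thesis
    proof cases
      case 1
      moreover have "has_ray r ((D2 - D1) - (E - D1))" by (rule mono[OF 1(2)]) (use E in auto)
      ultimately show ?thesis using D E s by (intro exI[of _ "(D1, E)"]) simp
    next
      case 2
      moreover have "has_ray r ((D2 - D1) - (D2 - E))" by (rule mono[OF 2(2)]) (use E in auto)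
      ultimately show ?thesis using D E s by (intro exI[of _ "(E, D2)"]) simp
    qed
  qed
  have "\<exists>S. ?P 0 S" using bad by (intro exI[of _ "({}, V)"]) (auto simp: down_def)
  then have "\<exists>S. \<forall>n. ?P n (S n) \<and> ?Q n (S n) (S (Suc n))"
    using ex by (rule dependent_nat_choice)
  then obtain S where S: "\<forall>n. ?P n (S n) \<and> ?Q n (S n) (S (Suc n))" ..
  define I where "I = (\<lambda>n. snd (S n) - fst (S n))"
  have I: "I (Suc n) \<subseteq> I n" "has_ray r (I n - I (Suc n))" for n
    using S[rule_format, of n] by (auto simp: I_def split: prod.splits)
  have "\<forall>n. \<exists>f. is_ray r f \<and> range f \<subseteq> I n - I (Suc n)" using I(2) by (simp add: has_ray_def)
  then obtain f where "\<forall>n. is_ray r (f n) \<and> range (f n) \<subseteq> I n - I (Suc n)"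
    by (rule choice[THEN exE])
  then have f: "is_ray r (f n)" "range (f n) \<subseteq> I n - I (Suc n)" for n by simp_all
  have "range (f m) \<inter> range (f n) = {}" if "m < n" for m n
  proof -
    have "I n \<subseteq> I (Suc m)" using lift_Suc_antimono_le[of I, OF I(1)] that by simp
    then show ?thesis using f(2)[of m] f(2)[of n] by blast
  qed
  then have "disjoint_family (\<lambda>i. range (f i))"
    unfolding disjoint_family_on_def by (metis inf_commute linorder_neqE_nat)
  then show False using few f(1) by blast
qed

end

text \<open>The layout of each difference \<open>X (Suc n) - X n\<close> is shifted behind
  \<open>X n\<close>. An initial segment of the resulting numbering is some \<open>X k\<close> with
  a beginning of the next block. Its boundary is covered by those of \<open>X k\<close>, of
  \<open>X (Suc k)\<close> and of that beginning inside its block, which gives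
  \<open>2 * c + N\<close>.\<close>

lemma positions_from_exhaustion:
  assumes "countable V" and rV: "r \<subseteq> V \<times> V" and nice: "nice r c V"
    and lay: "\<And>W. finite W \<Longrightarrow> W \<subseteq> V \<Longrightarrow> \<exists>p :: 'a \<Rightarrow> nat. inj_on p W \<and> p ` W \<subseteq> {..<card W} \<and>
      (\<forall>m. card (bd (Restr r W) {v \<in> W. p v < m}) \<le> N)"
  shows "\<exists>p :: 'a \<Rightarrow> nat. inj_on p V \<and> (\<forall>m. finite (bd r {v \<in> V. p v < m}) \<and> card (bd r {v \<in> V. p v < m}) \<le> 2 * c + N)"
proof -
  obtain e :: "'a \<Rightarrow> nat" where e: "inj_on e V" using assms(1) by (auto simp: countable_def)
  define W where "W = (\<lambda>n. {v \<in> V. e v < n})"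
  have W: "finite (W n)" for n
  proof -
    have "e ` W n \<subseteq> {..<n}" "inj_on e (W n)"
      using e by (auto simp: W_def inj_on_def)
    then show "finite (W n)" by (meson finite_imageD finite_lessThan finite_subset)
  qed
  \<comment> \<open>Starting from the empty set makes every vertex enter at a definite stage and the
    numbering begin at 0.\<close>
  let ?P = "\<lambda>n X. finite X \<and> X \<subseteq> V \<and> card (bd r X) \<le> c \<and> (n = 0 \<longrightarrow> X = {})"
  let ?Q = "\<lambda>n X X'. X \<union> W n \<subseteq> X'"
  have ex: "\<exists>X'. ?P (Suc n) X' \<and> ?Q n X X'" if P: "?P n X" for n X
  proof -
    have "finite (X \<union> W n)" "X \<union> W n \<subseteq> V" using P W by (auto simp: W_def)
    then have "\<exists>A. finite A \<and> X \<union> W n \<subseteq> A \<and> card (bd r A) \<le> c"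
      using nice[unfolded nice_def, rule_format, of "X \<union> W n"] by simp
    then obtain A where A: "finite A \<and> X \<union> W n \<subseteq> A \<and> card (bd r A) \<le> c" ..
    \<comment> \<open>All edges lie inside \<open>V\<close>, so cutting \<open>A\<close> down to
      \<open>V\<close> creates no boundary vertex.\<close>
    have "bd r (A \<inter> V) \<subseteq> bd r A" using rV by (auto simp: bd_def)
    then have "card (bd r (A \<inter> V)) \<le> card (bd r A)"
      using A by (intro card_mono finite_bd) auto
    then have "card (bd r (A \<inter> V)) \<le> c" using A by linarith
    then show ?thesis using A P by (intro exI[of _ "A \<inter> V"]) (auto simp: W_def)
  qed
  have "\<exists>X. ?P 0 X" by (intro exI[of _ "{}"]) (auto simp: bd_def)
  then have "\<exists>X. \<forall>n. ?P n (X n) \<and> ?Q n (X n) (X (Suc n))"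
    using ex by (rule dependent_nat_choice)
  then obtain X where X0: "\<forall>n. ?P n (X n) \<and> ?Q n (X n) (X (Suc n))" ..
  have X: "finite (X n)" "X n \<subseteq> V" "card (bd r (X n)) \<le> c" "X n \<subseteq> X (Suc n)" "W n \<subseteq> X (Suc n)" for n
    using X0[rule_format, of n] by simp_all
  have X_0: "X 0 = {}" using X0[rule_format, of 0] by simp
  have mono: "X m \<subseteq> X n" if "m \<le> n" for m n
    using lift_Suc_mono_le[of X, OF X(4)] that by simp
  have "\<forall>n. \<exists>p :: 'a \<Rightarrow> nat. inj_on p (X (Suc n) - X n) \<and> p ` (X (Suc n) - X n) \<subseteq> {..<card (X (Suc n) - X n)} \<and>
      (\<forall>m. card (bd (Restr r (X (Suc n) - X n)) {v \<in> X (Suc n) - X n. p v < m}) \<le> N)"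
  proof
    fix n
    show "\<exists>p :: 'a \<Rightarrow> nat. inj_on p (X (Suc n) - X n) \<and> p ` (X (Suc n) - X n) \<subseteq> {..<card (X (Suc n) - X n)} \<and>
      (\<forall>m. card (bd (Restr r (X (Suc n) - X n)) {v \<in> X (Suc n) - X n. p v < m}) \<le> N)"
      by (rule lay) (use X(1)[of "Suc n"] X(2)[of "Suc n"] in auto)
  qed
  then obtain q :: "nat \<Rightarrow> 'a \<Rightarrow> nat" where q0: "\<forall>n. inj_on (q n) (X (Suc n) - X n) \<and> q n ` (X (Suc n) - X n) \<subseteq> {..<card (X (Suc n) - X n)} \<and>
      (\<forall>m. card (bd (Restr r (X (Suc n) - X n)) {v \<in> X (Suc n) - X n. q n v < m}) \<le> N)"
    by (rule choice[THEN exE])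
  then have q: "inj_on (q n) (X (Suc n) - X n)" "q n ` (X (Suc n) - X n) \<subseteq> {..<card (X (Suc n) - X n)}"
      "card (bd (Restr r (X (Suc n) - X n)) {v \<in> X (Suc n) - X n. q n v < m}) \<le> N" for n m
    by simp_all
  \<comment> \<open>\<open>s n\<close> is the offset of the block \<open>X (Suc n) - X n\<close>,
    and \<open>stage v\<close> is the index of the block that contains \<open>v\<close>.\<close>
  define s where "s = (\<lambda>n. card (X n))"
  define stage where "stage = (\<lambda>v. LEAST n. v \<in> X (Suc n))"
  define p where "p = (\<lambda>v. s (stage v) + q (stage v) v)"
  have s_Suc: "s (Suc n) = s n + card (X (Suc n) - X n)" for n
    using card_Diff_subset[OF X(1)[of n] X(4)[of n]] card_mono[OF X(1)[of "Suc n"] X(4)[of n]] by (simp add: s_def)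
  have s_mono: "s m \<le> s n" if "m \<le> n" for m n
    unfolding s_def by (rule card_mono[OF X(1) mono[OF that]])
  have stage: "v \<in> X (Suc (stage v))" "v \<notin> X (stage v)" if v: "v \<in> V" for v
  proof -
    have "v \<in> X (Suc (Suc (e v)))" using X(5)[of "Suc (e v)"] v by (auto simp: W_def)
    then show "v \<in> X (Suc (stage v))" unfolding stage_def by (rule LeastI)
    show "v \<notin> X (stage v)"
    proof (cases "stage v")
      case (Suc n)
      then have "n < (LEAST n. v \<in> X (Suc n))" by (simp add: stage_def)
      then show ?thesis unfolding Suc by (rule not_less_Least)
    qed (simp add: X_0)
  qed
  have p_bounds: "s (stage v) \<le> p v" "p v < s (Suc (stage v))" if v: "v \<in> V" for v
    using q(2)[of "stage v"] stage[OF v] by (auto simp: p_def s_Suc)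
  have p_in: "p v < s n" if v: "v \<in> V" "v \<in> X n" for v n
  proof -
    have "Suc (stage v) \<le> n"
      using stage(2)[OF v(1)] mono[of n "stage v"] v(2) by (meson not_less_eq_eq subsetD)
    then show ?thesis using p_bounds(2)[OF v(1)] s_mono by (meson less_le_trans)
  qed
  have p_out: "s n \<le> p v" if v: "v \<in> V" "v \<notin> X n" for v n
  proof -
    have "n \<le> stage v"
      using stage(1)[OF v(1)] mono[of "Suc (stage v)" n] v(2) by (meson not_less_eq_eq subsetD)
    then show ?thesis using p_bounds(1)[OF v(1)] s_mono by (meson order_trans)
  qed
  have in_iff: "v \<in> X n \<longleftrightarrow> p v < s n" if v: "v \<in> V" for v n
    using p_in[OF v, of n] p_out[OF v, of n] by (cases "v \<in> X n") auto
  have stage_eq: "stage v = n" if v: "v \<in> X (Suc n)" "v \<notin> X n" for v n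
  proof -
    have vV: "v \<in> V" using v(1) X(2) by blast
    have "\<not> Suc n \<le> stage v" using stage(2)[OF vV] mono[of "Suc n" "stage v"] v(1) by blast
    moreover have "\<not> Suc (stage v) \<le> n" using stage(1)[OF vV] mono[of "Suc (stage v)" n] v(2) by blast
    ultimately show ?thesis by simp
  qed
  have "inj_on p V"
  proof (rule inj_onI)
    fix u v assume uv: "u \<in> V" "v \<in> V" "p u = p v"
    have "u \<in> X n \<longleftrightarrow> v \<in> X n" for n
      using in_iff[OF uv(1), of n] in_iff[OF uv(2), of n] uv(3) by simp
    then have "stage v = stage u" using stage[OF uv(1)] by (intro stage_eq) auto
    then have st: "stage u = stage v" by simp
    then have "q (stage v) u = q (stage v) v" using uv(3) by (simp add: p_def)
    then show "u = v"
      using stage[OF uv(1)] stage[OF uv(2)] st by (intro inj_onD[OF q(1)[of "stage v"]]) auto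
  qed
  moreover have "finite (bd r {v \<in> V. p v < m}) \<and> card (bd r {v \<in> V. p v < m}) \<le> 2 * c + N" for m
  proof (cases "\<exists>n. m < s n")
    case True
    define n where "n = (LEAST n. m < s n)"
    have n: "m < s n" unfolding n_def by (rule LeastI_ex[OF True])
    then obtain k where k: "n = Suc k" by (cases n) (simp add: s_def X_0)
    have "k < (LEAST n. m < s n)" using k by (simp add: n_def)
    then have sk: "s k \<le> m" using not_less_Least by (meson linorder_not_le)
    define I where "I = {v \<in> X (Suc k) - X k. q k v < m - s k}"
    have eq: "{v \<in> V. p v < m} = X k \<union> I"
    proof (intro equalityI subsetI)
      fix v assume "v \<in> {v \<in> V. p v < m}"
      then have v: "v \<in> V" "p v < m" by auto
      have "v \<in> X (Suc k)" using p_out[OF v(1), of "Suc k"] v(2) n k by fastforce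
      then show "v \<in> X k \<union> I"
        using stage_eq[of v k] v(2) by (auto simp: I_def p_def)
    next
      fix v assume v: "v \<in> X k \<union> I"
      then have vV: "v \<in> V" using X(2) by (auto simp: I_def)
      have "p v < m"
      proof (cases "v \<in> X k")
        case True
        then show ?thesis using p_in[OF vV True] sk by linarith
      next
        case False
        then show ?thesis using v stage_eq[of v k] sk by (auto simp: I_def p_def)
      qed
      then show "v \<in> {v \<in> V. p v < m}" using vV by simp
    qed
    have fin: "finite (X k \<union> I)" using X(1) by (auto simp: I_def)
    \<comment> \<open>An edge that leaves the segment from \<open>I\<close> either stays in the
      block or leaves \<open>X (Suc k)\<close>, since \<open>X k\<close> belongs to the
      segment.\<close>
    have "bd r (X k \<union> I) \<subseteq> bd r (X k) \<union> bd r (X (Suc k)) \<union> bd (Restr r (X (Suc k) - X k)) I"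
    proof
      fix x assume "x \<in> bd r (X k \<union> I)"
      then obtain y where y: "x \<in> X k \<union> I" "y \<notin> X k \<union> I" "(x, y) \<in> r" by (auto simp: bd_def)
      then show "x \<in> bd r (X k) \<union> bd r (X (Suc k)) \<union> bd (Restr r (X (Suc k) - X k)) I"
        unfolding bd_def I_def by blast
    qed
    then have "card (bd r (X k \<union> I)) \<le> card (bd r (X k) \<union> bd r (X (Suc k)) \<union> bd (Restr r (X (Suc k) - X k)) I)"
      using X(1) by (intro card_mono) (auto intro!: finite_bd simp: I_def)
    also have "\<dots> \<le> card (bd r (X k)) + card (bd r (X (Suc k))) + card (bd (Restr r (X (Suc k) - X k)) I)"
      using card_Un_le[of "bd r (X k) \<union> bd r (X (Suc k))" "bd (Restr r (X (Suc k) - X k)) I"]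
        card_Un_le[of "bd r (X k)" "bd r (X (Suc k))"] by linarith
    also have "\<dots> \<le> c + c + N"
      using X(3)[of k] X(3)[of "Suc k"] q(3)[of k "m - s k"] unfolding I_def by linarith
    finally show ?thesis using finite_bd[OF fin, of r] unfolding eq by simp
  next
    case False
    \<comment> \<open>No offset exceeds \<open>m\<close>, which happens only for finite
      \<open>V\<close>; the segment is then all of \<open>V\<close>, whose boundary is
      empty.\<close>
    then have "{v \<in> V. p v < m} = V"
      using p_bounds(2) by (auto simp: not_less) (meson less_le_trans)
    moreover have "bd r V = {}" using rV by (auto simp: bd_def)
    ultimately show ?thesis by simp
  qed
  ultimately show ?thesis by blast
qed

section \<open>Path-decompositions\<close>

lemma finite_path_widthI:
  assumes "path_decomposition G B" "\<And>t. finite (B t) \<and> card (B t) \<le> k"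
  shows "path_width G < \<infinity>"
proof -
  have "ereal_of_enat (ecard (B t)) - 1 \<le> ereal (real k)" for t
  proof -
    have "ereal_of_enat (ecard (B t)) - 1 = ereal (real (card (B t)) - 1)"
      using assms(2)[of t] by (simp add: ecard_def one_ereal_def)
    also have "\<dots> \<le> ereal (real k)" using assms(2)[of t] by simp
    finally show ?thesis .
  qed
  then have "decomposition_width B \<le> ereal (real k)"
    unfolding decomposition_width_def by (rule SUP_least)
  moreover have "path_width G \<le> decomposition_width B"
    unfolding path_width_def using assms(1) by (intro INF_lower) simp
  ultimately have "path_width G \<le> ereal (real k)" by (meson order_trans)
  then show ?thesis by (rule le_less_trans) simp
qed

lemma finite_path_widthE:
  assumes "path_width G < \<infinity>"
  obtains B k where "path_decomposition G B" "\<And>t. finite (B t) \<and> card (B t) \<le> k"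
proof -
  obtain B where B: "path_decomposition G B" "decomposition_width B < \<infinity>"
    using assms unfolding path_width_def INF_less_iff by blast
  have le: "ereal_of_enat (ecard (B t)) - 1 \<le> decomposition_width B" for t
    unfolding decomposition_width_def by (rule SUP_upper) simp
  have fin: "finite (B t)" for t
  proof (rule ccontr)
    assume "infinite (B t)"
    then have "decomposition_width B \<ge> \<infinity>" using le[of t] by (simp add: ecard_def)
    then show False using B(2) by simp
  qed
  obtain k :: nat where k: "decomposition_width B \<le> ereal (real k)"
  proof (cases "decomposition_width B")
    case (real x)
    then show ?thesis using that[of "nat \<lceil>x\<rceil>"] by (simp add: le_nat_iff) linarith
  qed (use B(2) that[of 0] in auto)
  have "card (B t) \<le> Suc k" for t
  proof -
    have "ereal (real (card (B t)) - 1) \<le> decomposition_width B"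
      using le[of t] fin[of t] by (simp add: ecard_def one_ereal_def)
    then have "ereal (real (card (B t)) - 1) \<le> ereal (real k)" using k by (rule order_trans)
    then show ?thesis by simp
  qed
  then show ?thesis using that[OF B(1), of "Suc k"] fin by blast
qed

text \<open>Bag \<open>m\<close> holds the vertex numbered \<open>m\<close>, if there is one, the
  earlier vertices that still await a neighbour numbered \<open>m\<close> or later, and all of
  \<open>Z\<close>. Keeping \<open>Z\<close> in every bag restores the deleted vertices at constant
  cost.\<close>

lemma path_decomposition_from_positions:
  fixes p :: "'a \<Rightarrow> nat"
  assumes G: "simple_graph G" and V: "V = verts G - Z" and Z: "finite Z" "Z \<subseteq> verts G"
    and r: "r = Restr (adj G) V" and p: "inj_on p V"
    and bound: "\<And>m. finite (bd r {v \<in> V. p v < m}) \<and> card (bd r {v \<in> V. p v < m}) \<le> k"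
  shows "path_width G < \<infinity>"
proof -
  define B where "B = (\<lambda>m. {v \<in> V. p v = m} \<union> bd r {v \<in> V. p v < m} \<union> Z)"
  have mem: "x \<in> B m \<longleftrightarrow> x \<in> Z \<or> x \<in> V \<and> p x = m \<or> x \<in> V \<and> p x < m \<and> (\<exists>y\<in>V. m \<le> p y \<and> (x, y) \<in> r)" for x m
    unfolding B_def bd_def r not_less[symmetric] by blast
  have BZ: "Z \<subseteq> B m" for m by (auto simp: B_def)
  have own: "v \<in> B (p v)" if "v \<in> V" for v using that by (simp add: mem)
  have "path_decomposition G B"
    unfolding path_decomposition_def
  proof (intro conjI allI impI)
    show "(\<Union>t. B t) = verts G"
    proof
      show "(\<Union>t. B t) \<subseteq> verts G" using V Z(2) by (auto simp: mem)
      show "verts G \<subseteq> (\<Union>t. B t)" using own BZ V by fastforce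
    qed
  next
    fix v w assume vw: "{v, w} \<in> edges G"
    then have vG: "v \<in> verts G" "w \<in> verts G" using adj_verts[OF G, of v w] by (auto simp: adj_def)
    show "\<exists>t. v \<in> B t \<and> w \<in> B t"
    proof (cases "v \<in> Z \<or> w \<in> Z")
      case True
      then show ?thesis
        using BZ own[of v] own[of w] vG V by (metis DiffI subsetD)
    next
      case False
      then have vV: "v \<in> V" "w \<in> V" using vG V by auto
      have e: "(v, w) \<in> r" "(w, v) \<in> r" using vw vV by (auto simp: r adj_def insert_commute)
      consider "p v \<le> p w" | "p w \<le> p v" by linarith
      then show ?thesis
      proof cases
        case 1
        then have "v \<in> B (p w)" using vV e by (auto simp: mem le_less)
        then show ?thesis using own[OF vV(2)] by blast
      next
        case 2
        then have "w \<in> B (p v)" using vV e by (auto simp: mem le_less)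
        then show ?thesis using own[OF vV(1)] by blast
      qed
    qed
  next
    fix t1 t2 t3 :: nat assume t: "t1 \<le> t2 \<and> t2 \<le> t3"
    show "B t1 \<inter> B t3 \<subseteq> B t2"
    proof
      fix x assume x: "x \<in> B t1 \<inter> B t3"
      show "x \<in> B t2"
      proof (cases "x \<in> Z")
        case False
        have xV: "x \<in> V" "p x \<le> t1" using x False by (auto simp: mem)
        show ?thesis
        proof (cases "p x = t2")
          case False
          then have "p x < t2" "p x < t3" using xV t by auto
          moreover obtain y where "y \<in> V" "t3 \<le> p y" "(x, y) \<in> r"
            using x \<open>x \<notin> Z\<close> \<open>p x < t3\<close> by (auto simp: mem)
          ultimately show ?thesis using xV(1) t unfolding mem by (meson order_trans)
        qed (use own[OF xV(1)] in auto)
      qed (use BZ in auto)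
    qed
  qed
  moreover have "finite (B m) \<and> card (B m) \<le> 1 + k + card Z" for m
  proof -
    have one: "finite {v \<in> V. p v = m} \<and> card {v \<in> V. p v = m} \<le> 1"
    proof (cases "\<exists>v\<in>V. p v = m")
      case True
      then obtain v where "v \<in> V" "p v = m" by blast
      then have "{v \<in> V. p v = m} = {v}" using p by (auto dest: inj_onD)
      then show ?thesis by simp
    next
      case False
      then have E: "{v \<in> V. p v = m} = {}" by blast
      show ?thesis unfolding E by simp
    qed
    have "card (B m) \<le> card {v \<in> V. p v = m} + card (bd r {v \<in> V. p v < m}) + card Z"
      unfolding B_def using card_Un_le[of "{v \<in> V. p v = m} \<union> bd r {v \<in> V. p v < m}" Z]
        card_Un_le[of "{v \<in> V. p v = m}" "bd r {v \<in> V. p v < m}"] by linarith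
    then show ?thesis using one bound[of m] Z(1) by (auto simp: B_def)
  qed
  ultimately show ?thesis by (rule finite_path_widthI)
qed

text \<open>The bag at \<open>t2\<close> separates the vertices of earlier bags from those that
  occur only later: an edge leaving \<open>L\<close> is covered by a later bag, so its end in
  \<open>L\<close> occurs on both sides of \<open>t2\<close>.\<close>

lemma decomposition_meets_between:
  assumes B: "path_decomposition G B" and S: "conn (adj G) S"
    and t: "S \<inter> B t1 \<noteq> {}" "S \<inter> B t3 \<noteq> {}" "t1 \<le> t2" "t2 \<le> t3"
  shows "S \<inter> B t2 \<noteq> {}"
proof
  assume none: "S \<inter> B t2 = {}"
  have B3: "x \<in> B j" if "x \<in> B i" "x \<in> B l" "i \<le> j" "j \<le> l" for x i j l
    using B that unfolding path_decomposition_def by blast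
  obtain x z where xz: "x \<in> S" "x \<in> B t1" "z \<in> S" "z \<in> B t3" using t(1,2) by blast
  define L where "L = {v. \<exists>i\<le>t2. v \<in> B i}"
  have "x \<in> L" using xz(2) t(3) by (auto simp: L_def)
  moreover have "z \<notin> L" using B3[OF _ xz(4) _ t(4)] none xz(3) by (auto simp: L_def)
  moreover have "(x, z) \<in> (Restr (adj G) S)\<^sup>*" using S xz by (simp add: conn_def)
  ultimately obtain a b where ab: "a \<in> L" "b \<notin> L" "(a, b) \<in> Restr (adj G) S"
    using rtrancl_crossing[of x z "Restr (adj G) S" L] by auto
  then have "{a, b} \<in> edges G" by (simp add: adj_def)
  then obtain j where j: "a \<in> B j" "b \<in> B j"
    using B unfolding path_decomposition_def by blast
  have "\<not> j \<le> t2" using j(2) ab(2) by (auto simp: L_def)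
  then have "a \<in> B t2" using ab(1) B3[OF _ j(1)] by (auto simp: L_def)
  then show False using none ab(3) by blast
qed

section \<open>Obstructions to bounded width\<close>

text \<open>If \<open>v\<close> were missing from a bag after one that contains it, all its bags
  would be earlier, and finitely many finite bags would hold all its neighbours.\<close>

lemma eventually_in_bag:
  assumes B: "path_decomposition G B" "\<And>t. finite (B t)"
    and v: "v \<in> verts G" "infinite (neighbours G v)"
  shows "eventually (\<lambda>t. v \<in> B t) sequentially"
proof -
  obtain t0 where t0: "v \<in> B t0" using B(1) v(1) unfolding path_decomposition_def by blast
  show ?thesis
  proof (rule eventually_sequentiallyI)
    fix t assume t: "t0 \<le> t"
    have "neighbours G v \<subseteq> (\<Union>j<t. B j)" if no: "v \<notin> B t"
    proof
      fix w assume "w \<in> neighbours G v"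
      then obtain j where j: "v \<in> B j" "w \<in> B j"
        using B(1) unfolding path_decomposition_def neighbours_def by blast
      have "j < t"
      proof (rule ccontr)
        assume "\<not> j < t"
        then have "B t0 \<inter> B j \<subseteq> B t"
          using B(1) t unfolding path_decomposition_def by (meson linorder_not_less)
        then show False using t0 j(1) no by blast
      qed
      then show "w \<in> (\<Union>j<t. B j)" using j(2) by blast
    qed
    moreover have "finite (\<Union>j<t. B j)" using B(2) by simp
    ultimately show "v \<in> B t" using v(2) by (meson finite_subset)
  qed
qed

text \<open>Finitely many finite bags cannot cover \<open>S\<close>, so \<open>S\<close> reaches
  bags arbitrarily far out and, being connected, meets those in between.\<close>

lemma eventually_meets_bag:
  assumes B: "path_decomposition G B" "\<And>t. finite (B t)"
    and S: "conn (adj G) S" "S \<subseteq> verts G" "infinite S"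
  shows "eventually (\<lambda>t. S \<inter> B t \<noteq> {}) sequentially"
proof -
  have cover: "verts G = (\<Union>t. B t)" using B(1) by (simp add: path_decomposition_def)
  obtain s where s: "s \<in> S" using S(3) by fastforce
  then obtain t0 where t0: "S \<inter> B t0 \<noteq> {}" using S(2) cover by blast
  show ?thesis
  proof (rule eventually_sequentiallyI)
    fix t assume t: "t0 \<le> t"
    have "finite (\<Union>j<t. B j)" using B(2) by simp
    then have "\<not> S \<subseteq> (\<Union>j<t. B j)" using S(3) by (meson finite_subset)
    then obtain x where x: "x \<in> S" "x \<notin> (\<Union>j<t. B j)" by blast
    then obtain j where "x \<in> B j" using S(2) cover by blast
    moreover have "t \<le> j" using x(2) calculation by (meson UN_I lessThan_iff linorder_not_less)
    ultimately show "S \<inter> B t \<noteq> {}"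
      using decomposition_meets_between[OF B(1) S(1) t0 _ t] x(1) by blast
  qed
qed

text \<open>Finitely many eventual statements hold at a common index, so any finite set of such
  vertices fits into one bag. Disjoint rays are counted in the same way below.\<close>

lemma finitely_many_of_infinite_degree:
  assumes B: "path_decomposition G B" "\<And>t. finite (B t) \<and> card (B t) \<le> k"
  shows "finite {v \<in> verts G. degree G v = \<infinity>}"
proof -
  let ?Z = "{v \<in> verts G. degree G v = \<infinity>}"
  have "card X \<le> k" if X: "X \<subseteq> ?Z" "finite X" for X
  proof -
    have "eventually (\<lambda>t. v \<in> B t) sequentially" if "v \<in> X" for v
      using X(1) that B by (intro eventually_in_bag) (auto simp: degree_def ecard_def split: if_splits)
    then have "eventually (\<lambda>t. \<forall>v\<in>X. v \<in> B t) sequentially"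
      using X(2) by (simp add: eventually_ball_finite_distrib)
    then have "\<exists>t. \<forall>v\<in>X. v \<in> B t" by (rule eventually_happens'[OF sequentially_bot])
    then obtain t where "X \<subseteq> B t" by blast
    then have "card X \<le> card (B t)" using B(2) by (intro card_mono) auto
    then show ?thesis using B(2)[of t] by linarith
  qed
  then have "finite ?Z \<and> card ?Z \<le> k" by (intro finite_if_finite_subsets_card_bdd) auto
  then show ?thesis ..
qed

lemma ray_verts:
  assumes "subgraph R G" "isomorphic R ray"
  shows "conn (adj G) (verts R)" "verts R \<subseteq> verts G" "infinite (verts R)"
proof -
  obtain f where f: "bij_betw f (verts R) (UNIV :: nat set)"
      "\<And>u v. u \<in> verts R \<Longrightarrow> v \<in> verts R \<Longrightarrow> {u, v} \<in> edges R \<longleftrightarrow> {f u, f v} \<in> edges ray"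
    using assms(2) by (auto simp: isomorphic_def ray_def)
  show "verts R \<subseteq> verts G" using assms(1) by (simp add: subgraph_def)
  show "infinite (verts R)" using bij_betw_finite[OF f(1)] by simp
  define g where "g = inv_into (verts R) f"
  have g: "g n \<in> verts R" "f (g n) = n" for n
    using f(1) inv_into_into[of n f "verts R"] f_inv_into_f[of n f "verts R"]
    by (auto simp: g_def bij_betw_def)
  have range: "\<exists>n. x = g n" if "x \<in> verts R" for x
    using f(1) that by (intro exI[of _ "f x"]) (simp add: g_def bij_betw_def)
  let ?r = "Restr (adj G) (verts R)"
  have step: "(g n, g (Suc n)) \<in> ?r" for n
  proof -
    have "{g n, g (Suc n)} \<in> edges R" using f(2)[OF g(1) g(1), of n "Suc n"] g(2) by (auto simp: ray_def)
    then show ?thesis using assms(1) g(1) by (auto simp: subgraph_def adj_def)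
  qed
  have reach: "(g 0, g n) \<in> ?r\<^sup>*" for n
    by (induction n) (blast intro: rtrancl_into_rtrancl[OF _ step])+
  have "sym ?r" using sym_adj[of G] by (auto simp: sym_def)
  then have reach': "(g n, g 0) \<in> ?r\<^sup>*" for n
    using symD[OF sym_rtrancl reach] by blast
  show "conn (adj G) (verts R)"
    unfolding conn_def
  proof (intro conjI ballI)
    show "verts R \<noteq> {}" using g(1) by blast
    fix x y assume "x \<in> verts R" "y \<in> verts R"
    then obtain m n where "x = g m" "y = g n" using range by metis
    then show "(x, y) \<in> ?r\<^sup>*" using rtrancl_trans[OF reach' reach] by simp
  qed
qed

lemma card_le_of_disjoint_meeting:
  assumes "finite B" "finite I" "\<And>i. i \<in> I \<Longrightarrow> U i \<inter> B \<noteq> {}" "disjoint_family_on U I"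
  shows "card I \<le> card B"
proof -
  have "\<forall>i\<in>I. \<exists>x. x \<in> U i \<inter> B" using assms(3) by blast
  then obtain x where x: "\<forall>i\<in>I. x i \<in> U i \<inter> B" by (rule bchoice[THEN exE])
  have "inj_on x I"
  proof (rule inj_onI)
    fix i j assume ij: "i \<in> I" "j \<in> I" "x i = x j"
    have "x i \<in> U i \<inter> U j" using x ij by auto
    then show "i = j" using assms(4) ij(1,2) unfolding disjoint_family_on_def by blast
  qed
  then show ?thesis using assms(1) x by (intro card_inj_on_le[of x]) auto
qed

lemma finitely_many_disjoint_rays:
  assumes B: "path_decomposition G B" "\<And>t. finite (B t) \<and> card (B t) \<le> k"
    and R: "\<forall>R\<in>\<R>. subgraph R G \<and> isomorphic R ray" "pairwise disjoint_graphs \<R>"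
  shows "finite \<R>"
proof -
  have "card X \<le> k" if X: "X \<subseteq> \<R>" "finite X" for X
  proof -
    have "eventually (\<lambda>t. verts R \<inter> B t \<noteq> {}) sequentially" if "R \<in> X" for R
      using R(1) X(1) that B ray_verts[of R G] by (intro eventually_meets_bag) auto
    then have "eventually (\<lambda>t. \<forall>R\<in>X. verts R \<inter> B t \<noteq> {}) sequentially"
      using X(2) by (simp add: eventually_ball_finite_distrib)
    then have "\<exists>t. \<forall>R\<in>X. verts R \<inter> B t \<noteq> {}" by (rule eventually_happens'[OF sequentially_bot])
    then obtain t where t: "\<forall>R\<in>X. verts R \<inter> B t \<noteq> {}" ..
    have "disjoint_family_on verts X"
      using R(2) X(1) unfolding disjoint_family_on_def pairwise_def disjoint_graphs_def by blast
    then have "card X \<le> card (B t)"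
      using t B(2) X(2) by (intro card_le_of_disjoint_meeting) auto
    then show ?thesis using B(2)[of t] by linarith
  qed
  then have "finite \<R> \<and> card \<R> \<le> k" by (intro finite_if_finite_subsets_card_bdd) auto
  then show ?thesis ..
qed

section \<open>Binary trees have large path-width\<close>

text \<open>Vertex \<open>i\<close> of the complete binary tree has the children \<open>2 * i\<close> and \<open>2 * i + 1\<close>.\<close>

definition heap :: "nat \<Rightarrow> nat ugraph" where
  "heap d = \<lparr>verts = {1..<2 ^ d}, edges = {{i, i div 2} | i. 2 \<le> i \<and> i < 2 ^ d}\<rparr>"

text \<open>\<open>j div 2 ^ m\<close> is the ancestor of \<open>j\<close> by \<open>m\<close>
  generations, \<open>j\<close> itself for \<open>m = 0\<close>. Above the root it is 0, so the
  definition is meant for \<open>i \<ge> 1\<close>.\<close>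

definition desc :: "nat \<Rightarrow> nat \<Rightarrow> nat set" where
  "desc d i = {j. j < 2 ^ d \<and> (\<exists>m. j div 2 ^ m = i)}"

lemma simple_heap: "simple_graph (heap d)"
  unfolding simple_graph_def
proof
  fix e assume "e \<in> edges (heap d)"
  then obtain i :: nat where i: "e = {i, i div 2}" "2 \<le> i" "i < 2 ^ d" by (auto simp: heap_def)
  have "i div 2 \<noteq> i" "1 \<le> i div 2" using i(2) by auto
  then show "e \<subseteq> verts (heap d) \<and> card e = 2" using i by (auto simp: heap_def)
qed

lemma heap_par_adj: "2 \<le> i \<Longrightarrow> i < 2 ^ d \<Longrightarrow> (i, i div 2) \<in> adj (heap d)"
  by (auto simp: adj_def heap_def)

lemma heap_edgeD: "{i, j} \<in> edges (heap d) \<Longrightarrow> j = i div 2 \<or> i = j div 2"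
  by (auto simp: heap_def doubleton_eq_iff)

text \<open>Every vertex of \<open>C\<close> climbs to \<open>i\<close> through its ancestors
  without leaving \<open>C\<close>.\<close>

lemma conn_heap_subset:
  assumes C: "i \<in> C" "C \<subseteq> {1..<2 ^ d}" "\<And>j. j \<in> C \<Longrightarrow> j \<noteq> i \<Longrightarrow> 2 \<le> j \<and> j div 2 \<in> C"
  shows "conn (adj (heap d)) C"
proof -
  let ?r = "Restr (adj (heap d)) C"
  have up: "j \<in> C \<Longrightarrow> (j, i) \<in> ?r\<^sup>*" for j
  proof (induction j rule: less_induct)
    case (less j)
    show ?case
    proof (cases "j = i")
      case False
      then have j: "2 \<le> j" "j div 2 \<in> C" using C(3) less.prems by auto
      then have "(j, j div 2) \<in> ?r" using heap_par_adj[of j d] less.prems C(2) by auto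
      moreover have "(j div 2, i) \<in> ?r\<^sup>*" using less.IH[of "j div 2"] j by auto
      ultimately show ?thesis by (rule converse_rtrancl_into_rtrancl)
    qed simp
  qed
  have "sym ?r" using sym_adj[of "heap d"] by (auto simp: sym_def)
  then have "(i, j) \<in> ?r\<^sup>*" if "j \<in> C" for j
    using symD[OF sym_rtrancl up[OF that]] by blast
  then show ?thesis
    unfolding conn_def using C(1) up by (blast intro: rtrancl_trans)
qed

text \<open>The largest vertex of a cycle would have two different smaller neighbours on it, but a
  smaller neighbour can only be its parent.\<close>

lemma tree_heap:
  assumes "0 < d"
  shows "tree (heap d)"
  unfolding tree_def
proof (intro conjI notI)
  show "simple_graph (heap d)" by (rule simple_heap)
  have one: "1 < (2::nat) ^ d" using assms by (intro one_less_power) auto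
  have c: "conn (adj (heap d)) (verts (heap d))"
    by (rule conn_heap_subset[of 1]) (use one in \<open>auto simp: heap_def\<close>)
  show "connected_graph (heap d)"
    unfolding connected_graph_def
  proof (intro conjI ballI)
    show "verts (heap d) \<noteq> {}" using c by (simp add: conn_def)
    fix u v assume "u \<in> verts (heap d)" "v \<in> verts (heap d)"
    then obtain p where "rpath (adj (heap d)) p" "hd p = u" "last p = v" "set p \<subseteq> verts (heap d)"
      using conn_rpath[OF c] by metis
    then show "\<exists>p. graph_path (heap d) p \<and> hd p = u \<and> last p = v"
      by (intro exI[of _ p]) (simp add: graph_path_iff)
  qed
next
  assume "\<exists>p. graph_cycle (heap d) p"
  then obtain p where p: "graph_path (heap d) p" "3 \<le> length p" "{last p, hd p} \<in> edges (heap d)"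
    by (auto simp: graph_cycle_def)
  let ?n = "length p"
  have ne: "p \<noteq> []" and dist: "distinct p" using p(1) by (auto simp: graph_path_def)
  have e: "{p ! i, p ! Suc i} \<in> edges (heap d)" if "Suc i < ?n" for i
    using p(1) that by (auto simp: graph_path_def path_edges_def)
  have cyc: "{p ! (?n - 1), p ! 0} \<in> edges (heap d)"
    using p(3) ne by (simp add: last_conv_nth hd_conv_nth)
  define m where "m = Max (set p)"
  have "m \<in> set p" unfolding m_def using ne by (intro Max_in) auto
  then obtain i where i: "i < ?n" "p ! i = m" by (auto simp: in_set_conv_nth)
  have par: "p ! j = m div 2" if "j < ?n" "j \<noteq> i" "{p ! i, p ! j} \<in> edges (heap d)" for j
  proof -
    have le: "p ! j \<le> m" unfolding m_def using that(1) by (intro Max_ge) auto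
    have "p ! j \<noteq> m" using dist that(1,2) i by (metis nth_eq_iff_index_eq)
    then show ?thesis using heap_edgeD[OF that(3)] le i(2) by auto
  qed
  have "\<exists>j l. j < ?n \<and> l < ?n \<and> j \<noteq> i \<and> l \<noteq> i \<and> j \<noteq> l \<and>
      {p ! i, p ! j} \<in> edges (heap d) \<and> {p ! i, p ! l} \<in> edges (heap d)"
  proof -
    consider "i = 0" | "i = ?n - 1" "i \<noteq> 0" | "0 < i" "Suc i < ?n" using i(1) by linarith
    then show ?thesis
    proof cases
      case 1
      then show ?thesis using e[of 0] cyc p(2)
        by (intro exI[of _ 1] exI[of _ "?n - 1"]) (auto simp: insert_commute)
    next
      case 2
      obtain k where "i = Suc k" using 2(2) not0_implies_Suc by blast
      then have "i = Suc k" "?n - 1 = Suc k" using 2(1) by simp_all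
      then show ?thesis using e[of k] cyc p(2) i(1)
        by (intro exI[of _ k] exI[of _ 0]) (auto simp: insert_commute)
    next
      case 3
      then obtain k where k: "i = Suc k" by (cases i) auto
      then show ?thesis using e[of k] e[of i] 3(2)
        by (intro exI[of _ k] exI[of _ "Suc i"]) (auto simp: insert_commute)
    qed
  qed
  then obtain j l where jl: "j < ?n" "l < ?n" "j \<noteq> i" "l \<noteq> i" "j \<noteq> l"
      "{p ! i, p ! j} \<in> edges (heap d)" "{p ! i, p ! l} \<in> edges (heap d)" by blast
  then have "p ! j = p ! l" using par by metis
  then show False using dist jl(1,2,5) by (simp add: nth_eq_iff_index_eq)
qed

lemma max_degree_heap:
  assumes "3 \<le> d"
  shows "max_degree (heap d) = 3"
proof (rule antisym)
  have "degree (heap d) v \<le> 3" for v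
  proof -
    have "neighbours (heap d) v \<subseteq> {v div 2, 2 * v, 2 * v + 1}"
    proof
      fix w assume "w \<in> neighbours (heap d) v"
      then have "w = v div 2 \<or> v = w div 2" by (auto simp: neighbours_def dest: heap_edgeD)
      then show "w \<in> {v div 2, 2 * v, 2 * v + 1}" by auto
    qed
    moreover have "card {v div 2, 2 * v, 2 * v + 1} \<le> 3" by (simp add: card_insert_if)
    ultimately have "finite (neighbours (heap d) v) \<and> card (neighbours (heap d) v) \<le> 3"
      by (meson card_mono finite.emptyI finite.insertI finite_subset order_trans)
    then show ?thesis by (simp add: degree_def ecard_def numeral_eq_enat)
  qed
  then show "max_degree (heap d) \<le> 3" unfolding max_degree_def by (intro SUP_least)
  \<comment> \<open>Three levels contain 4 and 5, so that vertex 2 has a parent and two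
    children.\<close>
  have d: "(8::nat) \<le> 2 ^ d" using power_increasing[of 3 d "2::nat"] assms by simp
  have "neighbours (heap d) 2 = {1, 4, 5}"
  proof (intro equalityI subsetI)
    fix w assume "w \<in> neighbours (heap d) 2"
    then have "w = 2 div 2 \<or> 2 = w div 2" by (auto simp: neighbours_def dest: heap_edgeD)
    then show "w \<in> {1, 4, 5}" by auto
  next
    fix w :: nat assume "w \<in> {1, 4, 5}"
    moreover have "(2, 1) \<in> adj (heap d)" "(4, 2) \<in> adj (heap d)" "(5, 2) \<in> adj (heap d)"
      using heap_par_adj[of 2 d] heap_par_adj[of 4 d] heap_par_adj[of 5 d] d by simp_all
    ultimately show "w \<in> neighbours (heap d) 2"
      by (auto simp: neighbours_def adj_def insert_commute)
  qed
  then have "degree (heap d) 2 = 3" by (simp add: degree_def ecard_def numeral_eq_enat)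
  moreover have "2 \<in> verts (heap d)" using d by (simp add: heap_def)
  ultimately show "3 \<le> max_degree (heap d)" unfolding max_degree_def by (metis SUP_upper)
qed

section \<open>Subtrees below the grandchildren of a vertex\<close>

lemma desc_subset: "1 \<le> i \<Longrightarrow> desc d i \<subseteq> verts (heap d)"
  by (auto simp: desc_def heap_def Suc_le_eq intro: ccontr)

lemma desc_child: "desc d (4 * i + s) \<subseteq> desc d i" if "s < 4"
proof
  fix j assume "j \<in> desc d (4 * i + s)"
  then obtain m where j: "j < 2 ^ d" "j div 2 ^ m = 4 * i + s" by (auto simp: desc_def)
  have "j div 2 ^ (m + 2) = j div (2 ^ m * 4)" by (simp add: power_add mult.commute)
  also have "\<dots> = j div 2 ^ m div 4" by (rule div_mult2_eq)
  also have "\<dots> = i" using that j(2) by simp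
  finally have "\<exists>n. j div 2 ^ n = i" ..
  then show "j \<in> desc d i" using j(1) by (simp add: desc_def)
qed

text \<open>Two ancestors of one vertex are comparable, and if distinct, the smaller is at most half
  the larger. The grandchildren \<open>4 * i\<close> to \<open>4 * i + 3\<close> are too close
  together for that when \<open>i \<ge> 1\<close>.\<close>

lemma desc_disjoint:
  assumes i: "1 \<le> i" and a: "a \<in> {4 * i..<4 * i + 4}" and b: "b \<in> {4 * i..<4 * i + 4}" and "a \<noteq> b"
  shows "desc d a \<inter> desc d b = {}"
proof -
  have le: "n < m" if ab: "j div 2 ^ m = a" "j div 2 ^ n = b" "a \<noteq> b"
      "a \<in> {4 * i..<4 * i + 4}" "b \<in> {4 * i..<4 * i + 4}" for j m n a b :: nat
  proof (rule ccontr)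
    assume "\<not> n < m"
    then obtain l where l: "n = m + l" by (auto simp: not_less le_iff_add)
    have "l \<noteq> 0"
    proof
      assume "l = 0"
      then have "a = b" using l ab(1,2) by simp
      then show False using ab(3) by contradiction
    qed
    then have two: "(2::nat) \<le> 2 ^ l" by (cases l) auto
    have "b = j div (2 ^ m * 2 ^ l)" using ab(2) l by (simp add: power_add)
    also have "\<dots> = a div 2 ^ l" unfolding ab(1)[symmetric] by (rule div_mult2_eq)
    also have "\<dots> \<le> a div 2" using two by (intro div_le_mono2) auto
    finally have "b \<le> a div 2" .
    moreover have "4 * i \<le> b" "a < 4 * i + 4" using ab(4,5) by auto
    ultimately show False using i by linarith
  qed
  show ?thesis
  proof (rule ccontr)
    assume "\<not> ?thesis"
    then obtain j m n where "j div 2 ^ m = a" "j div 2 ^ n = b" by (auto simp: desc_def)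
    then show False using le[of j m a n b] le[of j n b m a] a b \<open>a \<noteq> b\<close> by simp
  qed
qed

text \<open>A vertex outside the subtree of \<open>b\<close> has its parent outside that subtree
  too. The condition \<open>i < b\<close> keeps the top vertex \<open>i\<close>.\<close>

lemma conn_desc_diff:
  assumes i: "1 \<le> i" "i < 2 ^ d" and b: "i < b"
  shows "conn (adj (heap d)) (desc d i - desc d b)"
proof (rule conn_heap_subset)
  have "i \<in> desc d i" using i(2) by (auto simp: desc_def intro: exI[of _ 0])
  moreover have "i \<notin> desc d b"
  proof
    assume "i \<in> desc d b"
    then obtain m where "i div 2 ^ m = b" by (auto simp: desc_def)
    then show False using b div_le_dividend[of i "2 ^ m"] by simp
  qed
  ultimately show "i \<in> desc d i - desc d b" by blast
  show "desc d i - desc d b \<subseteq> {1..<2 ^ d}" using desc_subset[OF i(1), of d] by (auto simp: heap_def)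
  fix j assume j: "j \<in> desc d i - desc d b" "j \<noteq> i"
  then obtain m where m: "j < 2 ^ d" "j div 2 ^ m = i" by (auto simp: desc_def)
  obtain l where l: "m = Suc l" using m(2) j(2) by (cases m) auto
  have jl: "j div 2 div 2 ^ l = i" using m(2) l by (simp add: div_mult2_eq)
  then have "1 \<le> j div 2" using i(1) by (cases "j div 2") auto
  then have "2 \<le> j" by linarith
  moreover have "j div 2 \<in> desc d i" using jl m(1) by (auto simp: desc_def)
  moreover have "j div 2 \<notin> desc d b"
  proof
    assume "j div 2 \<in> desc d b"
    then obtain n where "j div 2 div 2 ^ n = b" by (auto simp: desc_def)
    then have "j div 2 ^ Suc n = b" by (simp add: div_mult2_eq)
    then have "j \<in> desc d b" using m(1) by (auto simp: desc_def simp del: power_Suc)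
    then show False using j(1) by blast
  qed
  ultimately show "2 \<le> j \<and> j div 2 \<in> desc d i - desc d b" by blast
qed

lemma middle_of_three:
  fixes t :: "nat \<Rightarrow> nat"
  shows "\<exists>a b c. a \<in> {n, n + 1, n + 2} \<and> b \<in> {n, n + 1, n + 2} \<and> c \<in> {n, n + 1, n + 2} \<and>
    a \<noteq> b \<and> c \<noteq> b \<and> t a \<le> t b \<and> t b \<le> t c"
proof -
  consider "t n \<le> t (n + 1)" "t (n + 1) \<le> t (n + 2)" | "t (n + 2) \<le> t (n + 1)" "t (n + 1) \<le> t n"
    | "t (n + 1) \<le> t n" "t n \<le> t (n + 2)" | "t (n + 2) \<le> t n" "t n \<le> t (n + 1)"
    | "t n \<le> t (n + 2)" "t (n + 2) \<le> t (n + 1)" | "t (n + 1) \<le> t (n + 2)" "t (n + 2) \<le> t n"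
    by linarith
  then show ?thesis
  proof cases
    case 1 then show ?thesis by (intro exI[of _ n] exI[of _ "n + 1"] exI[of _ "n + 2"]) simp
  next
    case 2 then show ?thesis by (intro exI[of _ "n + 2"] exI[of _ "n + 1"] exI[of _ n]) simp
  next
    case 3 then show ?thesis by (intro exI[of _ "n + 1"] exI[of _ n] exI[of _ "n + 2"]) simp
  next
    case 4 then show ?thesis by (intro exI[of _ "n + 2"] exI[of _ n] exI[of _ "n + 1"]) simp
  next
    case 5 then show ?thesis by (intro exI[of _ n] exI[of _ "n + 2"] exI[of _ "n + 1"]) simp
  next
    case 6 then show ?thesis by (intro exI[of _ "n + 1"] exI[of _ "n + 2"] exI[of _ n]) simp
  qed
qed

text \<open>Of three of the grandchildren, take the one whose large bag comes second: the rest of the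
  tree is connected and meets the two outer bags, so it adds a vertex to the middle bag.\<close>

lemma heap_large_bag:
  assumes B: "path_decomposition (heap d) B"
  shows "1 \<le> i \<Longrightarrow> (i + 1) * 4 ^ h \<le> 2 ^ d \<Longrightarrow> \<exists>t. h + 1 \<le> card (B t \<inter> desc d i)"
proof (induction h arbitrary: i)
  have fin: "finite (desc d i)" for i by (auto simp: desc_def)
  {
    case 0
    then have "i \<in> verts (heap d)" "i \<in> desc d i" by (auto simp: heap_def desc_def intro: exI[of _ 0])
    then obtain t where "i \<in> B t \<inter> desc d i" using B unfolding path_decomposition_def by blast
    then have "card (B t \<inter> desc d i) \<noteq> 0" using fin by auto
    then show ?case by (intro exI[of _ t]) simp
  next
    case (Suc h)
    have lt: "i < 2 ^ d"
    proof -
      have "(i + 1) * 1 \<le> (i + 1) * 4 ^ Suc h" by (intro mult_le_mono2) simp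
      then have "(i + 1) * 1 \<le> 2 ^ d" using Suc.prems(2) by (rule order_trans)
      then show ?thesis by simp
    qed
    \<comment> \<open>Two children have no middle one, so three of the four grandchildren are used.
      Each further vertex in the bag costs two levels, hence the factor 4.\<close>
    have "\<exists>t. h + 1 \<le> card (B t \<inter> desc d c)" if c: "c \<in> {4 * i, 4 * i + 1, 4 * i + 2}" for c
    proof (rule Suc.IH)
      show "1 \<le> c" using c Suc.prems(1) by auto
      \<comment> \<open>The hypothesis says that the tree contains the descendants of
        \<open>c\<close> by \<open>2 * h\<close> generations, the last of which is
        \<open>(c + 1) * 4 ^ h - 1\<close>. It passes down since
        \<open>c + 1 \<le> 4 * (i + 1)\<close>.\<close>
      have "(c + 1) * 4 ^ h \<le> ((i + 1) * 4) * 4 ^ h" using c by (intro mult_le_mono1) auto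
      also have "\<dots> = (i + 1) * 4 ^ Suc h" by (simp only: power_Suc mult.assoc)
      finally show "(c + 1) * 4 ^ h \<le> 2 ^ d" using Suc.prems(2) by (rule order_trans)
    qed
    then have "\<forall>c\<in>{4 * i, 4 * i + 1, 4 * i + 2}. \<exists>t. h + 1 \<le> card (B t \<inter> desc d c)" by blast
    then obtain t where t: "\<forall>c\<in>{4 * i, 4 * i + 1, 4 * i + 2}. h + 1 \<le> card (B (t c) \<inter> desc d c)"
      by (rule bchoice[THEN exE])
    obtain a b c where abc: "a \<in> {4 * i, 4 * i + 1, 4 * i + 2}" "b \<in> {4 * i, 4 * i + 1, 4 * i + 2}"
        "c \<in> {4 * i, 4 * i + 1, 4 * i + 2}" "a \<noteq> b" "c \<noteq> b" "t a \<le> t b" "t b \<le> t c"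
      using middle_of_three[of "4 * i" t] by (elim exE conjE)
    have sub: "desc d x \<subseteq> desc d i" if "x \<in> {4 * i, 4 * i + 1, 4 * i + 2}" for x
      using that desc_child[of 0 d i] desc_child[of 1 d i] desc_child[of 2 d i] by auto
    let ?C = "desc d i - desc d b"
    have C: "conn (adj (heap d)) ?C" using conn_desc_diff[OF Suc.prems(1) lt] abc(2) Suc.prems(1) by auto
    have meet: "?C \<inter> B (t x) \<noteq> {}" if x: "x \<in> {4 * i, 4 * i + 1, 4 * i + 2}" "x \<noteq> b" for x
    proof -
      have "card (B (t x) \<inter> desc d x) \<noteq> 0" using t x(1) by auto
      then have "B (t x) \<inter> desc d x \<noteq> {}" by (metis card.empty)
      moreover have "desc d x \<inter> desc d b = {}"
        using x abc(2) by (intro desc_disjoint[OF Suc.prems(1)]) auto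
      ultimately show ?thesis using sub[OF x(1)] by blast
    qed
    have "?C \<inter> B (t b) \<noteq> {}"
      using decomposition_meets_between[OF B C meet[OF abc(1,4)] meet[OF abc(3,5)] abc(6,7)] .
    then obtain w where w: "w \<in> ?C" "w \<in> B (t b)" by blast
    have "insert w (B (t b) \<inter> desc d b) \<subseteq> B (t b) \<inter> desc d i" using w sub[OF abc(2)] by blast
    then have "card (insert w (B (t b) \<inter> desc d b)) \<le> card (B (t b) \<inter> desc d i)"
      using fin by (intro card_mono) auto
    moreover have "card (insert w (B (t b) \<inter> desc d b)) = Suc (card (B (t b) \<inter> desc d b))"
      using w(1) fin by (intro card_insert_disjoint) auto
    moreover have "h + 1 \<le> card (B (t b) \<inter> desc d b)" using t abc(2) by blast
    ultimately show ?case by (intro exI[of _ "t b"]) simp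
  }
qed

text \<open>Contracting the branch sets turns each bag into the list of branch sets that meet it.
  Their connectedness yields the interval condition. When they are disjoint, the new bags are no
  larger than the old ones.\<close>

lemma minor_decomposition:
  assumes B: "path_decomposition G B"
    and U: "\<And>j. j \<in> verts T \<Longrightarrow> conn (adj G) (U j) \<and> U j \<subseteq> verts G"
    and e: "\<And>i j. {i, j} \<in> edges T \<Longrightarrow> i \<in> verts T \<and> j \<in> verts T \<and> (\<exists>x\<in>U i. \<exists>y\<in>U j. (x, y) \<in> adj G)"
  shows "path_decomposition T (\<lambda>t. {j \<in> verts T. U j \<inter> B t \<noteq> {}})"
  unfolding path_decomposition_def
proof (intro conjI allI impI)
  have cover: "verts G = (\<Union>t. B t)" using B by (simp add: path_decomposition_def)
  have "\<exists>t. U j \<inter> B t \<noteq> {}" if j: "j \<in> verts T" for j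
  proof -
    obtain x where "x \<in> U j" using U[OF j] by (auto simp: conn_def)
    then show ?thesis using U[OF j] cover by blast
  qed
  then show "(\<Union>t. {j \<in> verts T. U j \<inter> B t \<noteq> {}}) = verts T" by auto
next
  fix i j assume "{i, j} \<in> edges T"
  then obtain x y where xy: "i \<in> verts T" "j \<in> verts T" "x \<in> U i" "y \<in> U j" "{x, y} \<in> edges G"
    using e[of i j] by (auto simp: adj_def)
  then obtain t where "x \<in> B t" "y \<in> B t" using B unfolding path_decomposition_def by blast
  then show "\<exists>t. i \<in> {j \<in> verts T. U j \<inter> B t \<noteq> {}} \<and> j \<in> {j \<in> verts T. U j \<inter> B t \<noteq> {}}"
    using xy by blast
next
  fix t1 t2 t3 :: nat assume t: "t1 \<le> t2 \<and> t2 \<le> t3"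
  have "U j \<inter> B t2 \<noteq> {}" if "j \<in> verts T" "U j \<inter> B t1 \<noteq> {}" "U j \<inter> B t3 \<noteq> {}" for j
    using decomposition_meets_between[OF B _ that(2,3)] U[OF that(1)] t by blast
  then show "{j \<in> verts T. U j \<inter> B t1 \<noteq> {}} \<inter> {j \<in> verts T. U j \<inter> B t3 \<noteq> {}}
      \<subseteq> {j \<in> verts T. U j \<inter> B t2 \<noteq> {}}" by blast
qed

text \<open>A path without one end is connected and still contains a neighbour of that end.
  \<open>is_subdivision\<close> fixes only the unordered pair of ends, so both directions
  occur.\<close>

lemma path_minus_end:
  assumes r: "sym r" and p: "rpath r p" "{hd p, last p} = {a, b}" "a \<noteq> b"
  shows "conn r (set p - {b}) \<and> a \<in> set p - {b} \<and> (\<exists>x\<in>set p - {b}. (x, b) \<in> r)"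
proof -
  have *: "conn r (set q - {b}) \<and> a \<in> set q - {b} \<and> (\<exists>x\<in>set q - {b}. (x, b) \<in> r)"
    if q: "rpath r q" "hd q = a" "last q = b" for q
  proof -
    have ne: "q \<noteq> []" using q(1) by (simp add: rpath_def)
    obtain q' where q': "q = q' @ [b]" using ne q(3) by (metis append_butlast_last_id)
    have ne': "q' \<noteq> []" using q(2) q' p(3) by auto
    have "rpath r q'" "(last q', b) \<in> r" "b \<notin> set q'"
      using q(1) ne' unfolding q' by (auto simp: rpath_def successively_append_iff)
    moreover have "set q - {b} = set q'" using calculation(3) q' by auto
    moreover have "hd q' = a" using q(2) ne' q' by simp
    ultimately show ?thesis
      using ne' successively_conn[OF r, of q'] last_in_set[OF ne'] hd_in_set[OF ne']
      by (auto simp: rpath_def)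
  qed
  have ne: "p \<noteq> []" using p(1) by (simp add: rpath_def)
  consider "hd p = a" "last p = b" | "hd p = b" "last p = a" using p(2) by (auto simp: doubleton_eq_iff)
  then show ?thesis
  proof cases
    case 1 then show ?thesis using *[OF p(1)] by simp
  next
    case 2 then show ?thesis using *[of "rev p"] p(1) ne rpath_rev[OF r, of p] by (simp add: hd_rev last_rev)
  qed
qed

text \<open>The branch set of \<open>j\<close> is the subdivided edge to its parent without the
  parent; the root stands alone. By \<open>par_inj\<close> different vertices use different edges,
  whose interiors are disjoint.\<close>

lemma subdivision_minor:
  fixes T :: "'b ugraph" and H :: "'b ugraph" and root :: 'b
  assumes sub: "is_subdivision H T" and T: "simple_graph T"
    and par: "\<And>j. j \<in> verts T \<Longrightarrow> j \<noteq> root \<Longrightarrow> {j, par j} \<in> edges T"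
    and par_inj: "\<And>i j. {i, par i} = {j, par j} \<Longrightarrow> i \<in> verts T - {root} \<Longrightarrow> j \<in> verts T - {root} \<Longrightarrow> i = j"
  obtains U where "\<forall>j\<in>verts T. conn (adj H) (U j) \<and> U j \<subseteq> verts H" "disjoint_family_on U (verts T)"
    "\<forall>j\<in>verts T. j \<noteq> root \<longrightarrow> (\<exists>x\<in>U j. \<exists>y\<in>U (par j). (x, y) \<in> adj H)"
proof -
  obtain P where P0: "\<forall>e\<in>edges T. graph_path H (P e) \<and> {hd (P e), last (P e)} = e \<and> (set (P e) - e) \<inter> verts T = {}"
    and Pd0: "\<forall>e\<in>edges T. \<forall>f\<in>edges T. e \<noteq> f \<longrightarrow> (set (P e) - e) \<inter> (set (P f) - f) = {}"
    and vH: "verts H = verts T \<union> (\<Union>e\<in>edges T. set (P e))"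
    using sub unfolding is_subdivision_def by (elim exE conjE)
  have P: "graph_path H (P e) \<and> {hd (P e), last (P e)} = e \<and> (set (P e) - e) \<inter> verts T = {}"
    if "e \<in> edges T" for e using P0 that by simp
  have Pd: "(set (P e) - e) \<inter> (set (P f) - f) = {}" if "e \<in> edges T" "f \<in> edges T" "e \<noteq> f" for e f
    using Pd0 that by simp
  define U where "U = (\<lambda>j. if j = root then {root} else set (P {j, par j}) - {par j})"
  have ne: "j \<noteq> par j \<and> par j \<in> verts T" if j: "j \<in> verts T" "j \<noteq> root" for j
  proof -
    have "card {j, par j} = 2 \<and> {j, par j} \<subseteq> verts T"
      using T par[OF j] unfolding simple_graph_def by blast
    then show ?thesis by (auto split: if_splits)
  qed
  have U: "conn (adj H) (U j) \<and> j \<in> U j \<and> (\<exists>x\<in>U j. (x, par j) \<in> adj H)" if j: "j \<in> verts T" "j \<noteq> root" for j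
    using path_minus_end[OF sym_adj, of H "P {j, par j}" j "par j"] P[OF par[OF j]] ne[OF j] j(2)
    by (simp add: U_def graph_path_iff)
  have Uo: "conn (adj H) (U root) \<and> root \<in> U root" by (simp add: U_def conn_singleton)
  have Uself: "j \<in> U j" if "j \<in> verts T" for j
    using U[OF that] Uo by (cases "j = root") auto
  have Umem: "w = j \<or> (j \<noteq> root \<and> w \<notin> verts T \<and> w \<in> set (P {j, par j}) - {j, par j})"
    if "j \<in> verts T" "w \<in> U j" for j w
  proof (cases "j = root")
    case False
    then have "w \<in> set (P {j, par j})" "w \<noteq> par j" using that(2) by (auto simp: U_def)
    then show ?thesis using False P[OF par[OF that(1) False]] by blast
  qed (use that(2) in \<open>simp add: U_def\<close>)
  show ?thesis
  proof (rule that[of U], intro ballI)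
    show "conn (adj H) (U j) \<and> U j \<subseteq> verts H" if j: "j \<in> verts T" for j
    proof (cases "j = root")
      case True
      then show ?thesis using Uo j vH by (auto simp: U_def)
    next
      case False
      then have "set (P {j, par j}) \<subseteq> verts H" using vH par[OF j False] by blast
      then show ?thesis using U[OF j False] False by (auto simp: U_def)
    qed
    have "\<exists>x\<in>U j. \<exists>y\<in>U (par j). (x, y) \<in> adj H" if j: "j \<in> verts T" "j \<noteq> root" for j
      using U[OF j] Uself[of "par j"] ne[OF j] by blast
    then show "\<forall>j\<in>verts T. j \<noteq> root \<longrightarrow> (\<exists>x\<in>U j. \<exists>y\<in>U (par j). (x, y) \<in> adj H)" by blast
    show "disjoint_family_on U (verts T)"
      unfolding disjoint_family_on_def
    proof (intro ballI impI)
      fix i j assume ij: "i \<in> verts T" "j \<in> verts T" "i \<noteq> j"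
      have False if w: "w \<in> U i" "w \<in> U j" for w
      proof -
        have wi: "w = i \<or> (i \<noteq> root \<and> w \<notin> verts T \<and> w \<in> set (P {i, par i}) - {i, par i})"
          using Umem[OF ij(1) w(1)] .
        have wj: "w = j \<or> (j \<noteq> root \<and> w \<notin> verts T \<and> w \<in> set (P {j, par j}) - {j, par j})"
          using Umem[OF ij(2) w(2)] .
        have "w \<noteq> i" "w \<noteq> j" using wi wj ij by metis+
        then have ij_root: "i \<noteq> root" "j \<noteq> root"
          and wd: "w \<in> (set (P {i, par i}) - {i, par i}) \<inter> (set (P {j, par j}) - {j, par j})"
          using wi wj by simp_all
        have "{i, par i} \<noteq> {j, par j}" using par_inj[of i j] ij ij_root by blast
        then show False using Pd[OF par[OF ij(1) ij_root(1)] par[OF ij(2) ij_root(2)]] wd by blast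
      qed
      then show "U i \<inter> U j = {}" by blast
    qed
  qed
qed

lemma conn_image:
  assumes "conn r X" "\<And>x y. x \<in> X \<Longrightarrow> y \<in> X \<Longrightarrow> (x, y) \<in> r \<Longrightarrow> (g x, g y) \<in> s"
  shows "conn s (g ` X)"
proof -
  have "(g x, g y) \<in> (Restr s (g ` X))\<^sup>*" if "(x, y) \<in> (Restr r X)\<^sup>*" for x y
    using that
  proof (induction rule: rtrancl_induct)
    case (step y z)
    then have "(g y, g z) \<in> Restr s (g ` X)" using assms(2) by auto
    with step.IH show ?case by (rule rtrancl_into_rtrancl)
  qed simp
  then show ?thesis using assms(1) unfolding conn_def by auto
qed

lemma contains_embedding:
  assumes "contains G H"
  obtains g where "inj_on g (verts H)" "g ` verts H \<subseteq> verts G"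
    "\<And>x y. x \<in> verts H \<Longrightarrow> y \<in> verts H \<Longrightarrow> (x, y) \<in> adj H \<Longrightarrow> (g x, g y) \<in> adj G"
proof -
  obtain S f where S: "subgraph S G" and f: "bij_betw f (verts S) (verts H)"
    and e: "\<forall>u\<in>verts S. \<forall>v\<in>verts S. {u, v} \<in> edges S \<longleftrightarrow> {f u, f v} \<in> edges H"
    using assms unfolding contains_def isomorphic_def by blast
  define g where "g = inv_into (verts S) f"
  have g: "bij_betw g (verts H) (verts S)" unfolding g_def by (rule bij_betw_inv_into[OF f])
  have fg: "f (g x) = x" if "x \<in> verts H" for x
    using that f by (simp add: g_def bij_betw_def f_inv_into_f)
  show ?thesis
  proof (rule that[of g])
    show "inj_on g (verts H)" using g by (simp add: bij_betw_def)
    show "g ` verts H \<subseteq> verts G" using g S by (auto simp: bij_betw_def subgraph_def)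
    fix x y assume xy: "x \<in> verts H" "y \<in> verts H" "(x, y) \<in> adj H"
    have "g x \<in> verts S" "g y \<in> verts S" using g xy(1,2) by (auto simp: bij_betw_def)
    then have "{g x, g y} \<in> edges S" using e xy fg by (auto simp: adj_def)
    then show "(g x, g y) \<in> adj G" using S by (auto simp: subgraph_def adj_def)
  qed
qed

text \<open>\<open>heap_large_bag\<close> at the root with \<open>h = k\<close> asks for
  \<open>2 * 4 ^ k \<le> 2 ^ d\<close>, for which \<open>2 * k + 1\<close> levels suffice; two more
  ensure maximum degree 3 even for \<open>k = 0\<close>. A bag meeting \<open>k + 1\<close> disjoint
  branch sets has \<open>k + 1\<close> vertices.\<close>

lemma no_large_heap_subdivision:
  assumes B: "path_decomposition G B" "\<And>t. finite (B t) \<and> card (B t) \<le> k"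
  shows "\<not> (\<exists>H. is_subdivision H (heap (2 * k + 3)) \<and> contains G H)"
proof
  let ?T = "heap (2 * k + 3)"
  assume "\<exists>H. is_subdivision H ?T \<and> contains G H"
  then obtain H where H: "is_subdivision H ?T" "contains G H" by blast
  have VT: "verts ?T = {1..<2 ^ (2 * k + 3)}" by (simp add: heap_def)
  obtain O' where O0: "\<forall>j\<in>verts ?T. conn (adj H) (O' j) \<and> O' j \<subseteq> verts H"
    and Od: "disjoint_family_on O' (verts ?T)"
    and Oe: "\<forall>j\<in>verts ?T. j \<noteq> 1 \<longrightarrow> (\<exists>x\<in>O' j. \<exists>y\<in>O' (j div 2). (x, y) \<in> adj H)"
  proof (rule subdivision_minor[OF H(1) simple_heap, where root = 1 and par = "\<lambda>j. j div 2"])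
    show "{j, j div 2} \<in> edges ?T" if "j \<in> verts ?T" "j \<noteq> 1" for j
      using that by (auto simp: heap_def)
    show "i = j" if "{i, i div 2} = {j, j div 2}" "i \<in> verts ?T - {1}" "j \<in> verts ?T - {1}" for i j
      using that by (auto simp: doubleton_eq_iff)
  qed
  have O': "conn (adj H) (O' j) \<and> O' j \<subseteq> verts H" if "j \<in> verts ?T" for j
    using O0 that by blast
  obtain g where g: "inj_on g (verts H)" "g ` verts H \<subseteq> verts G"
    "\<And>x y. x \<in> verts H \<Longrightarrow> y \<in> verts H \<Longrightarrow> (x, y) \<in> adj H \<Longrightarrow> (g x, g y) \<in> adj G"
    using contains_embedding[OF H(2)] by metis
  define U where "U = (\<lambda>j. g ` O' j)"
  have U: "conn (adj G) (U j) \<and> U j \<subseteq> verts G" if j: "j \<in> verts ?T" for j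
  proof
    show "conn (adj G) (U j)"
      unfolding U_def by (rule conn_image[of "adj H"]) (use O'[OF j] g(3) in auto)
    show "U j \<subseteq> verts G" using O'[OF j] g(2) by (auto simp: U_def)
  qed
  have par_e: "\<exists>x\<in>U j. \<exists>y\<in>U (j div 2). (x, y) \<in> adj G"
    if j: "j \<in> verts ?T" "j \<noteq> 1" for j
  proof -
    have pj: "j div 2 \<in> verts ?T" using j unfolding VT by auto
    obtain x y where xy: "x \<in> O' j" "y \<in> O' (j div 2)" "(x, y) \<in> adj H" using Oe j by blast
    then have "(g x, g y) \<in> adj G" using O'[OF j(1)] O'[OF pj] by (intro g(3)) auto
    then show ?thesis using xy by (auto simp: U_def)
  qed
  let ?B = "\<lambda>t. {j \<in> verts ?T. U j \<inter> B t \<noteq> {}}"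
  have dec: "path_decomposition ?T ?B"
  proof (rule minor_decomposition[OF B(1) U])
    fix i j assume ij: "{i, j} \<in> edges ?T"
    have v: "i \<in> verts ?T" "j \<in> verts ?T" "i \<noteq> j"
      using adj_verts[OF simple_heap, of i j] ij by (auto simp: adj_def)
    have "\<exists>x\<in>U i. \<exists>y\<in>U j. (x, y) \<in> adj G"
    proof -
      consider "j = i div 2" | "i = j div 2" using heap_edgeD[OF ij] by blast
      then show ?thesis
      proof cases
        case 1
        then have "i \<noteq> 1" using v(2) unfolding VT by auto
        then show ?thesis using par_e[OF v(1)] 1 by simp
      next
        case 2
        then have "j \<noteq> 1" using v(1) unfolding VT by auto
        then obtain x y where "x \<in> U j" "y \<in> U i" "(x, y) \<in> adj G" using par_e[OF v(2)] 2 by blast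
        then show ?thesis using symD[OF sym_adj, of x y G] by blast
      qed
    qed
    then show "i \<in> verts ?T \<and> j \<in> verts ?T \<and> (\<exists>x\<in>U i. \<exists>y\<in>U j. (x, y) \<in> adj G)" using v by blast
  qed
  have "(1 + 1) * (4::nat) ^ k \<le> 2 ^ (2 * k + 3)"
    by (simp add: power_add power_mult)
  then obtain t where t: "k + 1 \<le> card (?B t \<inter> desc (2 * k + 3) 1)"
    using heap_large_bag[OF dec, of 1 k] by auto
  have fin: "finite (?B t)" unfolding VT by simp
  have "disjoint_family_on U (?B t)"
    unfolding disjoint_family_on_def
  proof (intro ballI impI)
    fix i j assume ij: "i \<in> ?B t" "j \<in> ?B t" "i \<noteq> j"
    then have v: "i \<in> verts ?T" "j \<in> verts ?T" by auto
    have "O' i \<inter> O' j = {}" using Od v ij(3) unfolding disjoint_family_on_def by blast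
    moreover have "g ` (O' i \<inter> O' j) = g ` O' i \<inter> g ` O' j"
      using O'[OF v(1)] O'[OF v(2)] by (intro inj_on_image_Int[OF g(1)]) auto
    ultimately show "U i \<inter> U j = {}" by (simp add: U_def)
  qed
  then have "card (?B t) \<le> card (B t)"
    using B(2)[of t] fin by (intro card_le_of_disjoint_meeting) auto
  moreover have "card (?B t \<inter> desc (2 * k + 3) 1) \<le> card (?B t)" using fin by (intro card_mono) auto
  ultimately show False using t B(2)[of t] by linarith
qed

section \<open>The characterisation\<close>

lemma ray_graph:
  assumes "simple_graph G" "is_ray r f" "r \<subseteq> adj G"
  defines "R \<equiv> \<lparr>verts = range f, edges = {{f n, f (Suc n)} | n. True}\<rparr>"
  shows "subgraph R G" "isomorphic R ray"
proof -
  have f: "inj f" "\<And>n. (f n, f (Suc n)) \<in> adj G" using assms(2,3) by (auto simp: is_ray_def)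
  have "edges R \<subseteq> edges G" using f(2) by (auto simp: R_def adj_def)
  moreover have "verts R \<subseteq> verts G" using adj_verts[OF assms(1) f(2)] by (auto simp: R_def)
  ultimately show "subgraph R G"
    using assms(1) by (auto simp: subgraph_def simple_graph_def R_def)
  have inv: "inv f (f n) = n" for n using f(1) by simp
  show "isomorphic R ray"
    unfolding isomorphic_def
  proof (intro exI[of _ "inv f"] conjI ballI)
    show "bij_betw (inv f) (verts R) (verts ray)"
      using inj_imp_bij_betw_inv[OF f(1), of UNIV] by (simp add: R_def ray_def)
    fix u v assume "u \<in> verts R" "v \<in> verts R"
    then obtain m n where mn: "u = f m" "v = f n" by (auto simp: R_def)
    have "{f m, f n} = {f k, f (Suc k)} \<longleftrightarrow> {m, n} = {k, Suc k}" for k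
      using f(1) by (auto simp: doubleton_eq_iff inj_eq)
    then show "{u, v} \<in> edges R \<longleftrightarrow> {inv f u, inv f v} \<in> edges ray"
      by (auto simp: mn inv R_def ray_def)
  qed
qed

lemma bounded_path_width:
  fixes G :: "'a ugraph" and T :: "nat ugraph"
  assumes G: "simple_graph G" "countable (verts G)"
    and Z: "finite {v \<in> verts G. degree G v = \<infinity>}"
    and rays: "\<not> (\<exists>\<R>. infinite \<R> \<and> (\<forall>R\<in>\<R>. subgraph R G \<and> isomorphic R ray) \<and> pairwise disjoint_graphs \<R>)"
    and T: "tree T" "finite (verts T)" "max_degree T \<le> 3" "\<not> (\<exists>H. is_subdivision H T \<and> contains G H)"
  shows "path_width G < \<infinity>"
proof -
  let ?Z = "{v \<in> verts G. degree G v = \<infinity>}"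
  let ?N = "card (verts T)"
  \<comment> \<open>Without \<open>?Z\<close> every vertex has finitely many neighbours, as Koenig's
    lemma requires.\<close>
  define V where "V = verts G - ?Z"
  define r where "r = Restr (adj G) V"
  have cV: "countable V" using G(2) by (simp add: V_def)
  have rV: "r \<subseteq> V \<times> V" and rG: "r \<subseteq> adj G" by (auto simp: r_def)
  have sr: "sym r" using sym_adj[of G] by (auto simp: r_def sym_def)
  have lf: "finite (r `` {x})" for x
  proof (cases "x \<in> V")
    case True
    then have "finite (neighbours G x)"
      by (auto simp: V_def degree_def ecard_def split: if_splits)
    then show ?thesis by (rule finite_subset[rotated]) (auto simp: r_def adj_def neighbours_def)
  next
    case False
    then have "r `` {x} = {}" by (auto simp: r_def)
    then show ?thesis by simp
  qed
  have few: False if f: "\<And>i. is_ray r (f i)" and fd: "disjoint_family (\<lambda>i. range (f i))"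
    for f :: "nat \<Rightarrow> nat \<Rightarrow> 'a"
  proof -
    define R where "R = (\<lambda>i. \<lparr>verts = range (f i), edges = {{f i n, f i (Suc n)} | n. True}\<rparr>)"
    have disj: "verts (R i) \<inter> verts (R j) = {}" if "i \<noteq> j" for i j
      using fd that unfolding disjoint_family_on_def R_def by simp
    \<comment> \<open>The hypothesis speaks of an infinite set of rays, not of a family, so
      different indices must give different subgraphs; disjoint nonempty vertex sets ensure
      this.\<close>
    have "inj R"
    proof (rule injI, rule ccontr)
      fix i j assume "R i = R j" "i \<noteq> j"
      then have "verts (R i) = {}" using disj[of i j] by simp
      then show False by (simp add: R_def)
    qed
    then have "infinite (range R)" by (rule range_inj_infinite)
    moreover have "\<forall>S\<in>range R. subgraph S G \<and> isomorphic S ray"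
      using ray_graph[OF G(1) f rG] by (simp add: R_def)
    moreover have "pairwise disjoint_graphs (range R)"
    proof (rule pairwiseI)
      fix S S' assume "S \<in> range R" "S' \<in> range R" "S \<noteq> S'"
      then obtain i j where "S = R i" "S' = R j" "i \<noteq> j" by auto
      then show "disjoint_graphs S S'" using disj[of i j] by (simp add: disjoint_graphs_def)
    qed
    ultimately show False using rays by blast
  qed
  \<comment> \<open>These layouts serve twice: in the limit order and, with the bound on their
    range, in the finite blocks of the exhaustion.\<close>
  have lay: "\<exists>p :: 'a \<Rightarrow> nat. inj_on p W \<and> p ` W \<subseteq> {..<card W} \<and>
      (\<forall>m. card (bd (Restr r W) {v \<in> W. p v < m}) \<le> ?N)" if W: "finite W" "W \<subseteq> V" for W
  proof (rule laid_positions, rule laid_if_no_subdivision[OF G(1) T W(1)])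
    show "W \<subseteq> verts G" using W(2) by (auto simp: V_def)
    show "sym (Restr r W)" using sr by (auto simp: sym_def)
  qed (use rG in auto)
  have lay': "\<exists>p :: 'a \<Rightarrow> nat. inj_on p W \<and> (\<forall>m. card (bd (Restr r W) {v \<in> W. p v < m}) \<le> ?N)"
    if "finite W" "W \<subseteq> V" for W
    using lay[OF that] by blast
  show ?thesis
  proof (rule limit_order[OF cV rV lay'])
    fix lt
    assume lt: "\<And>x. \<not> lt x x" "\<And>x y z. lt x y \<Longrightarrow> lt y z \<Longrightarrow> lt x z"
      "\<And>x y. x \<in> V \<Longrightarrow> y \<in> V \<Longrightarrow> x \<noteq> y \<Longrightarrow> lt x y \<or> lt y x"
      "\<And>D. down V lt D \<Longrightarrow> finite (bd r D) \<and> card (bd r D) \<le> ?N"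
    have "\<exists>c. nice r c V"
      by (rule nice_if_few_rays[OF rV sr lf lt few])
    then obtain c where c: "nice r c V" ..
    have "\<exists>p :: 'a \<Rightarrow> nat. inj_on p V \<and>
        (\<forall>m. finite (bd r {v \<in> V. p v < m}) \<and> card (bd r {v \<in> V. p v < m}) \<le> 2 * c + ?N)"
      by (rule positions_from_exhaustion[OF cV rV c lay])
    then obtain p :: "'a \<Rightarrow> nat" where p: "inj_on p V"
        "\<forall>m. finite (bd r {v \<in> V. p v < m}) \<and> card (bd r {v \<in> V. p v < m}) \<le> 2 * c + ?N"
      by (elim exE conjE)
    show ?thesis
      by (rule path_decomposition_from_positions[OF G(1) V_def Z _ r_def p(1)]) (use p(2) in auto)
  qed
qed

theorem corollary2:
  fixes G :: "'a ugraph"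
  assumes "simple_graph G" and "countable (verts G)"
  shows "path_width G < \<infinity> \<longleftrightarrow>
      finite {v \<in> verts G. degree G v = \<infinity>} \<and>
      \<not> (\<exists>\<R>. infinite \<R> \<and> (\<forall>R\<in>\<R>. subgraph R G \<and> isomorphic R ray)
               \<and> pairwise disjoint_graphs \<R>) \<and>
      (\<exists>T :: nat ugraph. tree T \<and> finite (verts T) \<and> max_degree T = 3 \<and>
               \<not> (\<exists>H. is_subdivision H T \<and> contains G H))"
    (is "?pw \<longleftrightarrow> ?deg \<and> ?rays \<and> ?tree")
proof
  assume ?pw
  then obtain B k where B: "path_decomposition G B" "\<And>t. finite (B t) \<and> card (B t) \<le> k"
    using finite_path_widthE[of G] by metis
  have ?deg using finitely_many_of_infinite_degree[OF B] .
  moreover have ?rays using finitely_many_disjoint_rays[OF B] by blast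
  moreover have ?tree
    using tree_heap[of "2 * k + 3"] max_degree_heap[of "2 * k + 3"] no_large_heap_subdivision[OF B]
    by (intro exI[of _ "heap (2 * k + 3)"]) (simp add: heap_def)
  ultimately show "?deg \<and> ?rays \<and> ?tree" by blast
next
  assume rhs: "?deg \<and> ?rays \<and> ?tree"
  then obtain T :: "nat ugraph" where T: "tree T" "finite (verts T)" "max_degree T = 3"
      "\<not> (\<exists>H. is_subdivision H T \<and> contains G H)" by blast
  show ?pw
    by (rule bounded_path_width[OF assms _ _ T(1,2) _ T(4)]) (use rhs T(3) in simp_all)
qed

end
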